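(* Let $M^3$ be an indefinite proper affine hypersphere of $\mathbb{R}^4$ (with $S=H\,\mathrm{Id}$, $H\neq0$) which admits a pointwise $\mathbb{Z}_3$-symmetry or a pointwise $SO(2)$-symmetry. Let $H=a_{22}^2-a_4^2$ $(\neq0)$ on $M^3$. Then $M^3$ is affine equivalent with $$\varphi:I\times N^2\to\mathbb{R}^4,\qquad (t,v,w)\mapsto(\gamma_1(t)v,\ \gamma_1(t)w,\ \gamma_1(t)f(v,w)+\gamma_2(t),\ \gamma_1(t)),$$ where $\psi:N^2\to\mathbb{R}^3$, $(v,w)\mapsto(v,w,f(v,w))$, is a positive definite improper affine sphere with affine normal $(0,0,1)$ and $\gamma=(\gamma_1,\gamma_2):I\to\mathbb{R}^2$ is a curve. Moreover, if $M^3$ admits a pointwise $SO(2)$-symmetry, then $N^2$ is an elliptic paraboloid.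
   Context: Affine hyperspheres. $D$ is the flat connection and $\det$ the volume form of $\mathbb{R}^{n+1}$; $M^n$ is connected and oriented. For a nondegenerate immersed hypersurface $\varphi:M^n\to\mathbb{R}^{n+1}$ the affine (Blaschke) normal $\xi$ is the transverse vector field, unique up to sign, such that (identifying tangent vectors with their images under $\varphi_*$) $D_XY=\nabla_XY+h(X,Y)\xi$, $D_X\xi=-SX$ with $SX$ tangential, and the volume form $\det(\varphi_*X_1,\dots,\varphi_*X_n,\xi)$ equals the volume form $|\det h|^{1/2}$ of $h$. $\nabla$ is the induced connection, $h$ the affine metric, $S$ the shape operator, $\widehat\nabla$ the Levi-Civita connection of $h$, and $K(X,Y)=\nabla_XY-\widehat\nabla_XY$ the difference tensor. $\varphi$ is an affine (hyper)sphere if $S=H\,\mathrm{Id}$ with $H$ constant; it is proper if $H\ne0$ and improper if $H=0$; it is positive definite / indefinite if $h$ is. For $n=3$ and $h$ indefinite, the sign of $\xi$ is fixed so that $h$ has exactly one negative direction. Pointwise symmetry. $M^3$ admits a pointwise $SO(2)$-symmetry (resp. $\mathbb{Z}_3$-symmetry) if at each $p\in M^3$ there is a basis $\{T,V,W\}$ of $T_pM$, orthonormal for $h$ with $h(T,T)=-1$, $h(V,V)=h(W,W)=1$, such that $K(T,T)=-2a_4T$, $K(T,V)=a_4V$, $K(T,W)=a_4W$, $K(V,V)=-a_4T+a_6V$, $K(V,W)=-a_6W$, $K(W,W)=-a_4T-a_6V$, with $a_4>0$ and $a_6=0$ (resp. $a_4>0$ and $a_6>0$). (This is the canonical form of $K$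 when its stabilizer in the isometry group $SO(1,2)$ of $(T_pM,h)$ is $SO(2)$, resp. $\mathbb{Z}_3$.) The vector field $T$ and the function $a_4$ are then globally defined and smooth, and $a_{22}:=h(\widehat\nabla_VT,V)$, which does not depend on the choice of the unit vector $V\perp T$. Affine equivalent means equal up to an affine transformation of $\mathbb{R}^4$ and reparametrization; $I$ is an interval and $N^2$ is a surface with coordinates $(v,w)$. The statement that $N^2$ is a paraboloid refers to its immersion $\psi$.
   Formalization: The equivalence with I×N² is local: one affine map of R⁴ serves all of M³, but each point has its own piece I×N² with its own γ and f, and N² is an open part of the paraboloid; a global product fails, e.g. when a point is removed from I×N². *)

theory Defs
  imports "HOL-Analysis.Analysis"
begin

section \<open>Smooth maps and smooth manifolds\<close>

text \<open>\<open>C_k_on k f U\<close> is used for open \<open>U\<close> only: all iterated directional derivatives up to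
  order \<open>k\<close> exist (as Frechet derivatives) and are continuous.\<close>

primrec C_k_on :: "nat \<Rightarrow> ('a::real_normed_vector \<Rightarrow> 'b::real_normed_vector) \<Rightarrow> 'a set \<Rightarrow> bool" where
  "C_k_on 0 f U \<longleftrightarrow> continuous_on U f"
| "C_k_on (Suc k) f U \<longleftrightarrow> (\<forall>x\<in>U. f differentiable (at x)) \<and>
     (\<forall>v. C_k_on k (\<lambda>x. frechet_derivative f (at x) v) U)"

definition smooth_on :: "'a::real_normed_vector set \<Rightarrow> ('a \<Rightarrow> 'b::real_normed_vector) \<Rightarrow> bool" where
  "smooth_on U f \<longleftrightarrow> (\<forall>k. C_k_on k f U)"

text \<open>A manifold is a subset \<open>M\<close> of a topological space, with the subspace topology, together with
  a set \<open>A\<close> of local parametrizations \<open>(D, c)\<close>, \<open>c : D \<rightarrow> M\<close>, \<open>D\<close> open in a Euclidean space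
  (inverses of charts).\<close>

definition topological_parametrization ::
    "'p::topological_space set \<Rightarrow> 'a::topological_space set \<Rightarrow> ('a \<Rightarrow> 'p) \<Rightarrow> bool" where
  "topological_parametrization M D c \<longleftrightarrow>
     open D \<and> openin (top_of_set M) (c ` D) \<and> homeomorphism D (c ` D) c (inv_into D c)"

definition transition :: "'b set \<Rightarrow> ('b \<Rightarrow> 'p) \<Rightarrow> ('a \<Rightarrow> 'p) \<Rightarrow> 'a \<Rightarrow> 'b" where
  "transition D' c' c = inv_into D' c' \<circ> c"

definition smooth_parametrization ::
    "'p::topological_space set \<Rightarrow> ('b::real_normed_vector set \<times> ('b \<Rightarrow> 'p)) set
      \<Rightarrow> 'a::real_normed_vector set \<Rightarrow> ('a \<Rightarrow> 'p) \<Rightarrow> bool" where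
  "smooth_parametrization M A W \<Theta> \<longleftrightarrow>
     topological_parametrization M W \<Theta> \<and>
     (\<forall>(D, c)\<in>A. smooth_on (W \<inter> \<Theta> -` (c ` D)) (transition D c \<Theta>) \<and>
                 smooth_on (D \<inter> c -` (\<Theta> ` W)) (transition W \<Theta> c))"

definition oriented_atlas ::
    "'p::topological_space set \<Rightarrow> ((real^'n) set \<times> (real^'n \<Rightarrow> 'p)) set \<Rightarrow> bool" where
  "oriented_atlas M A \<longleftrightarrow>
     M = (\<Union>(D, c)\<in>A. c ` D) \<and>
     (\<forall>(D, c)\<in>A. smooth_parametrization M A D c) \<and>
     (\<forall>(D, c)\<in>A. \<forall>(D', c')\<in>A. \<forall>x \<in> D \<inter> c -` (c' ` D').
        det (matrix (frechet_derivative (transition D' c' c) (at x))) > 0)"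


section \<open>Affine hypersurfaces in a local parametrization\<close>

text \<open>
  \<open>\<sigma>\<close> is a parametrized hypersurface and \<open>\<xi>\<close> a transversal field along it. Tangent vectors are
  written in coordinates, so \<open>\<sigma>\<^sub>*u\<close> at \<open>x\<close> is \<open>frechet_derivative \<sigma> (at x) u\<close>. The constant
  vectors \<open>u\<close>, \<open>v\<close> stand for the coordinate vector fields with these constant components; the
  tensors \<open>h\<close>, \<open>S\<close>, \<open>K\<close> and both connections are determined by their values on such fields.

  The Gauss formula for them is \<open>D\<^sub>u (\<sigma>\<^sub>* v) = \<sigma>\<^sub>* (\<nabla>\<^sub>u v) + h(u, v) \<xi>\<close>.
\<close>

definition affine_metric ::
    "('a::real_normed_vector \<Rightarrow> 'b::real_normed_vector) \<Rightarrow> ('a \<Rightarrow> 'b) \<Rightarrow> 'a \<Rightarrow> 'a \<Rightarrow> 'a \<Rightarrow> real" where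
  "affine_metric \<sigma> \<xi> x u v = (THE r. \<exists>w.
     frechet_derivative (\<lambda>y. frechet_derivative \<sigma> (at y) v) (at x) u
       = frechet_derivative \<sigma> (at x) w + r *\<^sub>R \<xi> x)"

definition induced_connection ::
    "('a::real_normed_vector \<Rightarrow> 'b::real_normed_vector) \<Rightarrow> ('a \<Rightarrow> 'b) \<Rightarrow> 'a \<Rightarrow> 'a \<Rightarrow> 'a \<Rightarrow> 'a" where
  "induced_connection \<sigma> \<xi> x u v = (THE w. \<exists>r.
     frechet_derivative (\<lambda>y. frechet_derivative \<sigma> (at y) v) (at x) u
       = frechet_derivative \<sigma> (at x) w + r *\<^sub>R \<xi> x)"

definition shape_operator ::
    "('a::real_normed_vector \<Rightarrow> 'b::real_normed_vector) \<Rightarrow> ('a \<Rightarrow> 'b) \<Rightarrow> 'a \<Rightarrow> 'a \<Rightarrow> 'a" where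
  "shape_operator \<sigma> \<xi> x u = (THE w.
     frechet_derivative \<xi> (at x) u = - frechet_derivative \<sigma> (at x) w)"

text \<open>\<open>levi_civita h x u v\<close> is the Levi-Civita derivative at \<open>x\<close> of the constant field \<open>v\<close> in
  direction \<open>u\<close>: the unique torsion-free (constant fields commute) and metric connection.\<close>

definition levi_civita ::
    "('a::real_normed_vector \<Rightarrow> 'a \<Rightarrow> 'a \<Rightarrow> real) \<Rightarrow> 'a \<Rightarrow> 'a \<Rightarrow> 'a \<Rightarrow> 'a" where
  "levi_civita h x = (THE G. bilinear G \<and> (\<forall>u v. G u v = G v u) \<and>
     (\<forall>u v w. frechet_derivative (\<lambda>y. h y v w) (at x) u = h x (G u v) w + h x v (G u w)))"

definition levi_civita_deriv ::
    "('a::real_normed_vector \<Rightarrow> 'a \<Rightarrow> 'a \<Rightarrow> real) \<Rightarrow> 'a \<Rightarrow> 'a \<Rightarrow> ('a \<Rightarrow> 'a) \<Rightarrow> 'a" where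
  "levi_civita_deriv h x u Y = frechet_derivative Y (at x) u + levi_civita h x u (Y x)"

definition difference_tensor ::
    "('a::real_normed_vector \<Rightarrow> 'b::real_normed_vector) \<Rightarrow> ('a \<Rightarrow> 'b) \<Rightarrow> 'a \<Rightarrow> 'a \<Rightarrow> 'a \<Rightarrow> 'a" where
  "difference_tensor \<sigma> \<xi> x u v =
     induced_connection \<sigma> \<xi> x u v - levi_civita (affine_metric \<sigma> \<xi>) x u v"

text \<open>Columns \<open>\<sigma>\<^sub>*\<partial>\<^sub>k\<close> (at \<open>Some k\<close>) and \<open>\<xi>\<close> (at \<open>None\<close>). The bijection \<open>b\<close> only numbers the columns
  and affects at most the sign of the determinant; its existence says that the ambient dimension
  is \<open>n + 1\<close>.\<close>

definition frame_matrix ::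
    "('k \<Rightarrow> 'n option) \<Rightarrow> (real^'n \<Rightarrow> real^'k) \<Rightarrow> (real^'n \<Rightarrow> real^'k) \<Rightarrow> real^'n \<Rightarrow> real^'k^'k" where
  "frame_matrix b \<sigma> \<xi> x = (\<chi> i j. case b j of
      None \<Rightarrow> \<xi> x $ i
    | Some k \<Rightarrow> frechet_derivative \<sigma> (at x) (axis k 1) $ i)"

definition gram_matrix :: "(real^'n \<Rightarrow> real^'n \<Rightarrow> real) \<Rightarrow> real^'n^'n" where
  "gram_matrix g = (\<chi> i j. g (axis i 1) (axis j 1))"

text \<open>\<open>\<sigma>\<close> is a nondegenerate immersion with affine normal \<open>\<xi>\<close>. The absolute value in the volume
  condition reflects that \<open>\<xi>\<close> is determined only up to sign.\<close>

definition blaschke_immersion ::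
    "(real^'n) set \<Rightarrow> (real^'n \<Rightarrow> real^'k) \<Rightarrow> (real^'n \<Rightarrow> real^'k) \<Rightarrow> bool" where
  "blaschke_immersion D \<sigma> \<xi> \<longleftrightarrow>
     smooth_on D \<sigma> \<and> smooth_on D \<xi> \<and>
     (\<forall>x\<in>D.
        inj (frechet_derivative \<sigma> (at x)) \<and>
        \<xi> x \<notin> range (frechet_derivative \<sigma> (at x)) \<and>
        (\<forall>u. u \<noteq> 0 \<longrightarrow> (\<exists>v. affine_metric \<sigma> \<xi> x u v \<noteq> 0)) \<and>
        range (frechet_derivative \<xi> (at x)) \<subseteq> range (frechet_derivative \<sigma> (at x)) \<and>
        (\<exists>b. bij b \<and> \<bar>det (frame_matrix b \<sigma> \<xi> x)\<bar>
                       = sqrt \<bar>det (gram_matrix (affine_metric \<sigma> \<xi> x))\<bar>))"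

definition affine_sphere_on ::
    "(real^'n) set \<Rightarrow> (real^'n \<Rightarrow> real^'k) \<Rightarrow> (real^'n \<Rightarrow> real^'k) \<Rightarrow> real \<Rightarrow> bool" where
  "affine_sphere_on D \<sigma> \<xi> H \<longleftrightarrow> blaschke_immersion D \<sigma> \<xi> \<and>
     (\<forall>x\<in>D. \<forall>u. shape_operator \<sigma> \<xi> x u = H *\<^sub>R u)"

definition positive_definite :: "('a::real_vector \<Rightarrow> 'a \<Rightarrow> real) \<Rightarrow> bool" where
  "positive_definite g \<longleftrightarrow> (\<forall>u. u \<noteq> 0 \<longrightarrow> g u u > 0)"

definition negative_index :: "('a::euclidean_space \<Rightarrow> 'a \<Rightarrow> real) \<Rightarrow> nat" where
  "negative_index g = Max {dim S |S. subspace S \<and> (\<forall>u\<in>S. u \<noteq> 0 \<longrightarrow> g u u < 0)}"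


section \<open>Affine hypersurfaces and pointwise symmetry\<close>

definition affine_sphere ::
    "((real^'n) set \<times> (real^'n \<Rightarrow> 'p)) set \<Rightarrow> ('p \<Rightarrow> real^'k) \<Rightarrow> ('p \<Rightarrow> real^'k) \<Rightarrow> real \<Rightarrow> bool" where
  "affine_sphere A \<phi> \<xi> H \<longleftrightarrow> (\<forall>(D, c)\<in>A. affine_sphere_on D (\<phi> \<circ> c) (\<xi> \<circ> c) H)"

text \<open>The metric has exactly one negative direction; for a three-dimensional hypersurface this
  means that it is indefinite and that the sign of \<open>\<xi>\<close> is the normalized one.\<close>

definition lorentzian_hypersurface ::
    "((real^'n) set \<times> (real^'n \<Rightarrow> 'p)) set \<Rightarrow> ('p \<Rightarrow> real^'k) \<Rightarrow> ('p \<Rightarrow> real^'k) \<Rightarrow> bool" where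
  "lorentzian_hypersurface A \<phi> \<xi> \<longleftrightarrow>
     (\<forall>(D, c)\<in>A. \<forall>x\<in>D. negative_index (affine_metric (\<phi> \<circ> c) (\<xi> \<circ> c) x) = 1)"

definition canonical_frame ::
    "('a::real_vector \<Rightarrow> 'a \<Rightarrow> real) \<Rightarrow> ('a \<Rightarrow> 'a \<Rightarrow> 'a) \<Rightarrow> real \<Rightarrow> real \<Rightarrow> 'a \<Rightarrow> 'a \<Rightarrow> 'a \<Rightarrow> bool" where
  "canonical_frame h K a4 a6 T V W \<longleftrightarrow>
     h T T = -1 \<and> h V V = 1 \<and> h W W = 1 \<and> h T V = 0 \<and> h T W = 0 \<and> h V W = 0 \<and>
     K T T = (- 2 * a4) *\<^sub>R T \<and>
     K T V = a4 *\<^sub>R V \<and>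
     K T W = a4 *\<^sub>R W \<and>
     K V V = (- a4) *\<^sub>R T + a6 *\<^sub>R V \<and>
     K V W = (- a6) *\<^sub>R W \<and>
     K W W = (- a4) *\<^sub>R T - a6 *\<^sub>R V"

definition pointwise_SO2_symmetry ::
    "((real^3) set \<times> (real^3 \<Rightarrow> 'p)) set \<Rightarrow> ('p \<Rightarrow> real^4) \<Rightarrow> ('p \<Rightarrow> real^4) \<Rightarrow> bool" where
  "pointwise_SO2_symmetry A \<phi> \<xi> \<longleftrightarrow> (\<forall>(D, c)\<in>A. \<forall>x\<in>D. \<exists>T V W a4 a6. a4 > 0 \<and> a6 = 0 \<and>
     canonical_frame (affine_metric (\<phi> \<circ> c) (\<xi> \<circ> c) x)
       (difference_tensor (\<phi> \<circ> c) (\<xi> \<circ> c) x) a4 a6 T V W)"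

definition pointwise_Z3_symmetry ::
    "((real^3) set \<times> (real^3 \<Rightarrow> 'p)) set \<Rightarrow> ('p \<Rightarrow> real^4) \<Rightarrow> ('p \<Rightarrow> real^4) \<Rightarrow> bool" where
  "pointwise_Z3_symmetry A \<phi> \<xi> \<longleftrightarrow> (\<forall>(D, c)\<in>A. \<forall>x\<in>D. \<exists>T V W a4 a6. a4 > 0 \<and> a6 > 0 \<and>
     canonical_frame (affine_metric (\<phi> \<circ> c) (\<xi> \<circ> c) x)
       (difference_tensor (\<phi> \<circ> c) (\<xi> \<circ> c) x) a4 a6 T V W)"

text \<open>Under either symmetry \<open>T\<close> and \<open>a\<^sub>4\<close> are unique at every point, and the value \<open>a\<^sub>2\<^sub>2\<close> below does
  not depend on \<open>V\<close>.\<close>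

definition field_T :: "(real^3 \<Rightarrow> real^4) \<Rightarrow> (real^3 \<Rightarrow> real^4) \<Rightarrow> real^3 \<Rightarrow> real^3" where
  "field_T \<sigma> \<xi> x = (THE T. \<exists>V W a4 a6. a4 > 0 \<and> a6 \<ge> 0 \<and>
     canonical_frame (affine_metric \<sigma> \<xi> x) (difference_tensor \<sigma> \<xi> x) a4 a6 T V W)"

definition coeff_a4 :: "(real^3 \<Rightarrow> real^4) \<Rightarrow> (real^3 \<Rightarrow> real^4) \<Rightarrow> real^3 \<Rightarrow> real" where
  "coeff_a4 \<sigma> \<xi> x = (THE a4. \<exists>T V W a6. a4 > 0 \<and> a6 \<ge> 0 \<and>
     canonical_frame (affine_metric \<sigma> \<xi> x) (difference_tensor \<sigma> \<xi> x) a4 a6 T V W)"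

definition coeff_a22 :: "(real^3 \<Rightarrow> real^4) \<Rightarrow> (real^3 \<Rightarrow> real^4) \<Rightarrow> real^3 \<Rightarrow> real" where
  "coeff_a22 \<sigma> \<xi> x = (THE r. \<forall>V.
     affine_metric \<sigma> \<xi> x V V = 1 \<and> affine_metric \<sigma> \<xi> x (field_T \<sigma> \<xi> x) V = 0 \<longrightarrow>
     affine_metric \<sigma> \<xi> x (levi_civita_deriv (affine_metric \<sigma> \<xi>) x V (field_T \<sigma> \<xi>)) V = r)"


section \<open>Affine transformations and elliptic paraboloids\<close>

definition affine_transformation :: "('a::real_vector \<Rightarrow> 'a) \<Rightarrow> bool" where
  "affine_transformation B \<longleftrightarrow> (\<exists>L b. linear L \<and> bij L \<and> B = (\<lambda>x. L x + b))"

definition elliptic_paraboloid :: "(real^3) set \<Rightarrow> bool" where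
  "elliptic_paraboloid P \<longleftrightarrow> (\<exists>B. affine_transformation B \<and>
     P = B ` {q. q $ 3 = (q $ 1)\<^sup>2 + (q $ 2)\<^sup>2})"

definition graph_immersion :: "(real^2 \<Rightarrow> real) \<Rightarrow> real^2 \<Rightarrow> real^3" where
  "graph_immersion f z = vector [z $ 1, z $ 2, f z]"

end

theory Submission
  imports Defs
begin

text \<open>
  Write \<open>a = a\<^sub>2\<^sub>2\<close>, \<open>b = a\<^sub>4\<close>, \<open>\<tau> = h(T, \<cdot>)\<close> and \<open>t = \<sigma>\<^sub>*T\<close>. The Codazzi equation for \<open>K\<close> with \<open>T\<close> in
  one slot, together with \<open>H = a\<^sup>2 - b\<^sup>2\<close>, gives \<open>\<nabla>\<^sub>zT = a (z + \<tau>(z) T)\<close> for the Levi-Civita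
  connection, and the integrability conditions yield the closed system \<open>da = 4 b\<^sup>2 \<tau>\<close>, \<open>db = 4 a b \<tau>\<close>,
  \<open>dt = (a + b) d\<sigma> + ((a + 3 b) t + \<xi>) \<tau>\<close>, \<open>d\<xi> = - H d\<sigma>\<close>. Hence \<open>\<xi> + (a - b) t\<close> keeps a constant
  direction \<open>e\<close>, the covector that annihilates \<open>e\<close> and the images of the vectors orthogonal to \<open>T\<close> keeps a constant
  direction \<open>L\<close>, and the leaves orthogonal to \<open>T\<close> lie in the hyperplanes \<open>L = const\<close>. In affine
  coordinates whose third axis is \<open>e\<close> and whose fourth coordinate is \<open>L\<close>, the integral curves of \<open>T\<close>
  leave \<open>x\<^sub>1 / x\<^sub>4\<close> and \<open>x\<^sub>2 / x\<^sub>4\<close> fixed, and \<open>x\<^sub>3 / x\<^sub>4\<close> splits into a function \<open>f\<close> of these two and a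
  function of \<open>x\<^sub>4\<close>. The affine metric restricted to a leaf is a multiple of the Hessian of \<open>f\<close>, which the
  volume condition normalizes to have determinant \<open>1\<close>, and \<open>a\<^sub>6 = 0\<close> makes the third derivatives of
  \<open>f\<close> vanish.
\<close>

section \<open>Smooth functions\<close>

text \<open>All computations take place in single charts, while the affine map has to be one for all
  of M. Directions are therefore rescaled by integrating factors to constant vectors, which are
  shown not to depend on the chart and to be global by connectedness. H \<noteq> 0 enters through H
  = (a - b)(a + b). This factorization cancels the d\<sigma> terms in the derivative of \<xi> + (a -
  b) t, it makes the fourth coordinate strictly monotone along T, so that this coordinate can serve
  as the parameter with \<gamma>1(t) = t, and it allows the position relative to the centre of the
  sphere to be written as a multiple of \<xi>. No flow of T is constructed. The map \<Psi> = (s4,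
  s1/s4, s2/s4) is a local diffeomorphism that sends T to a multiple of the first axis, so its local
  inverse is already the product chart. The delicate hypothesis is H = a22^2 - a4^2, because the
  description of a22 has a meaningful value only where the complement of T is umbilical, and this
  has to be proved first. The scale r^2 = |det B| and the exponents of the integrating factors are
  matched so that the volume condition becomes |det Hess f| = 1 without a further constant.\<close>

abbreviation dd :: "('a::real_normed_vector \<Rightarrow> 'b::real_normed_vector) \<Rightarrow> 'a \<Rightarrow> 'a \<Rightarrow> 'b" where
  "dd f x v \<equiv> frechet_derivative f (at x) v"

lemma has_derivative_dd:
  "f differentiable (at x) \<Longrightarrow> (f has_derivative (\<lambda>v. dd f x v)) (at x)"
  by (simp add: frechet_derivative_works)

lemma dd_eq: "(f has_derivative f') (at x) \<Longrightarrow> dd f x v = f' v"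
  by (metis frechet_derivative_at)

lemma dd_cong:
  assumes "open U" "x \<in> U" "f differentiable (at x)" "\<And>y. y \<in> U \<Longrightarrow> f y = g y"
  shows "dd f x v = dd g x v"
  by (metis assms frechet_derivative_transform_within_open)

section \<open>Closure properties of k times continuously differentiable maps\<close>

lemma C_k_on_cong:
  assumes "open U" "C_k_on k f U" "\<And>x. x \<in> U \<Longrightarrow> f x = g x"
  shows "C_k_on k g U"
  using assms(2,3)
proof (induction k arbitrary: f g)
  case 0
  then show ?case by (metis C_k_on.simps(1) continuous_on_cong)
next
  case (Suc k)
  have d: "f differentiable (at x)" if "x \<in> U" for x using Suc.prems that by simp
  have "g differentiable (at x)" if "x \<in> U" for x
    using d[OF that] Suc.prems(2) assms(1) that
    by (metis differentiable_def has_derivative_transform_within_open)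
  moreover have "C_k_on k (\<lambda>x. dd g x v) U" for v
    by (rule Suc.IH[of "\<lambda>x. dd f x v"])
      (use Suc.prems dd_cong[OF assms(1) _ d, of _ g] in simp_all)
  ultimately show ?case by simp
qed

lemma C_k_on_SucI:
  assumes "open U" "\<And>x. x \<in> U \<Longrightarrow> (f has_derivative f' x) (at x)" "\<And>v. C_k_on k (\<lambda>x. f' x v) U"
  shows "C_k_on (Suc k) f U"
proof -
  have "C_k_on k (\<lambda>x. dd f x v) U" for v
    by (rule C_k_on_cong[OF assms(1) assms(3)[of v]]) (metis assms(2) dd_eq)
  then show ?thesis using assms(2) by (auto simp: differentiable_def)
qed

lemma C_k_on_continuous: "C_k_on k f U \<Longrightarrow> open U \<Longrightarrow> continuous_on U f"
  by (cases k) (auto intro!: differentiable_imp_continuous_on simp: differentiable_on_def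
      differentiable_at_withinI)

lemma C_k_on_pred: "C_k_on (Suc k) f U \<Longrightarrow> open U \<Longrightarrow> C_k_on k f U"
proof (induction k arbitrary: f)
  case 0
  then show ?case using C_k_on_continuous C_k_on.simps(1) by blast
qed auto

lemma C_k_on_subset: "C_k_on k f U \<Longrightarrow> V \<subseteq> U \<Longrightarrow> C_k_on k f V"
  by (induction k arbitrary: f) (auto intro: continuous_on_subset)

lemma C_k_on_local:
  assumes "\<And>x. x \<in> U \<Longrightarrow> \<exists>V. open V \<and> x \<in> V \<and> C_k_on k f V"
  shows "C_k_on k f U"
  using assms
proof (induction k arbitrary: f)
  case 0
  show ?case unfolding C_k_on.simps
  proof (rule continuous_at_imp_continuous_on, rule ballI)
    fix x assume "x \<in> U"
    then obtain V where "open V" "x \<in> V" "continuous_on V f" using 0 by auto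
    then show "isCont f x" by (simp add: continuous_on_eq_continuous_at)
  qed
next
  case (Suc k)
  have "C_k_on k (\<lambda>x. dd f x v) U" for v
    by (rule Suc.IH) (use Suc.prems in fastforce)
  then show ?case using Suc.prems by fastforce
qed

lemma C_k_on_const: "open U \<Longrightarrow> C_k_on k (\<lambda>x. c) U"
proof (induction k arbitrary: c)
  case (Suc k)
  then show ?case by (intro C_k_on_SucI[where f' = "\<lambda>_ _. 0"]) simp_all
qed simp

lemma C_k_on_bounded_linear: "bounded_linear f \<Longrightarrow> open U \<Longrightarrow> C_k_on k f U"
proof (cases k)
  case 0
  then show "bounded_linear f \<Longrightarrow> open U \<Longrightarrow> C_k_on k f U"
    by (simp add: linear_continuous_on)
next
  case (Suc n)
  assume "bounded_linear f" "open U"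
  then show "C_k_on k f U" unfolding Suc
    by (intro C_k_on_SucI[where f' = "\<lambda>x. f"])
      (auto intro: bounded_linear_imp_has_derivative C_k_on_const)
qed

lemma C_k_on_add:
  "C_k_on k f U \<Longrightarrow> C_k_on k g U \<Longrightarrow> open U \<Longrightarrow> C_k_on k (\<lambda>x. f x + g x) U"
proof (induction k arbitrary: f g)
  case 0
  then show ?case by (auto intro: continuous_intros)
next
  case (Suc k)
  show ?case
  proof (rule C_k_on_SucI[where f' = "\<lambda>x v. dd f x v + dd g x v"])
    show "((\<lambda>x. f x + g x) has_derivative (\<lambda>v. dd f x v + dd g x v)) (at x)" if "x \<in> U" for x
      using Suc.prems that by (intro has_derivative_add has_derivative_dd) auto
    show "C_k_on k (\<lambda>x. dd f x v + dd g x v) U" for v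
      using Suc.prems by (intro Suc.IH) auto
  qed (rule Suc.prems)
qed

lemma C_k_on_bilinear:
  assumes "bounded_bilinear p" "open U"
  shows "C_k_on k f U \<Longrightarrow> C_k_on k g U \<Longrightarrow> C_k_on k (\<lambda>x. p (f x) (g x)) U"
proof (induction k arbitrary: f g)
  case 0
  then show ?case using assms bounded_bilinear.continuous_on by auto
next
  case (Suc k)
  have "C_k_on k f U" "C_k_on k g U" using C_k_on_pred Suc.prems assms by blast+
  note pred = this
  show ?case
  proof (rule C_k_on_SucI[where f' = "\<lambda>x v. p (f x) (dd g x v) + p (dd f x v) (g x)"])
    show "((\<lambda>x. p (f x) (g x)) has_derivative (\<lambda>v. p (f x) (dd g x v) + p (dd f x v) (g x))) (at x)"
      if "x \<in> U" for x
      using Suc.prems that by (intro bounded_bilinear.FDERIV[OF assms(1)] has_derivative_dd) auto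
    show "C_k_on k (\<lambda>x. p (f x) (dd g x v) + p (dd f x v) (g x)) U" for v
      using Suc.prems pred by (intro C_k_on_add Suc.IH assms(2)) auto
  qed (rule assms(2))
qed

lemmas C_k_on_mult = C_k_on_bilinear[OF bounded_bilinear_mult]
lemmas C_k_on_scaleR = C_k_on_bilinear[OF bounded_bilinear_scaleR]
lemmas C_k_on_inner = C_k_on_bilinear[OF bounded_bilinear_inner]

lemma C_k_on_sum:
  "open U \<Longrightarrow> (\<And>i. i \<in> I \<Longrightarrow> C_k_on k (f i) U) \<Longrightarrow> C_k_on k (\<lambda>x. \<Sum>i\<in>I. f i x) U"
  by (induction I rule: infinite_finite_induct) (auto intro: C_k_on_const C_k_on_add)

lemma C_k_on_prod:
  fixes f :: "'i \<Rightarrow> 'a::real_normed_vector \<Rightarrow> real"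
  shows "open U \<Longrightarrow> (\<And>i. i \<in> I \<Longrightarrow> C_k_on k (f i) U) \<Longrightarrow> C_k_on k (\<lambda>x. \<Prod>i\<in>I. f i x) U"
  by (induction I rule: infinite_finite_induct) (auto intro: C_k_on_const C_k_on_mult)

lemma linear_family_sum:
  fixes g :: "'a::euclidean_space"
  assumes "linear f" shows "f g = (\<Sum>b\<in>Basis. (g \<bullet> b) *\<^sub>R f b)"
proof -
  have "f g = f (\<Sum>b\<in>Basis. (g \<bullet> b) *\<^sub>R b)" by (simp add: euclidean_representation)
  also have "\<dots> = (\<Sum>b\<in>Basis. (g \<bullet> b) *\<^sub>R f b)"
    using assms by (simp add: linear_sum linear_cmul)
  finally show ?thesis .
qed

text \<open>The chain rule evaluates the derivative of \<open>g\<close> in the moving direction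
  \<open>dd f x v\<close>, whereas \<open>C_k_on\<close> controls it in fixed directions only.
  Expanding the direction in a basis of the middle space gives a finite sum of products to which the
  induction hypothesis applies.\<close>

lemma C_k_on_compose:
  fixes f :: "'a::real_normed_vector \<Rightarrow> 'b::euclidean_space"
  assumes "open U" "open V" "f ` U \<subseteq> V"
  shows "C_k_on k f U \<Longrightarrow> C_k_on k g V \<Longrightarrow> C_k_on k (\<lambda>x. g (f x)) U"
proof (induction k arbitrary: g)
  case 0
  then show ?case using assms(3) by (auto intro: continuous_on_compose2)
next
  case (Suc k)
  have fk: "C_k_on k f U" using Suc.prems assms C_k_on_pred by blast
  have der: "((\<lambda>x. g (f x)) has_derivative (\<lambda>v. dd g (f x) (dd f x v))) (at x)" if "x \<in> U" for x
    using Suc.prems that assms(3)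
    by (intro has_derivative_compose[OF has_derivative_dd has_derivative_dd]) (simp_all add: image_subset_iff)
  have lin: "dd g (f x) w = (\<Sum>b\<in>Basis. (w \<bullet> b) *\<^sub>R dd g (f x) b)" if "x \<in> U" for x w
  proof -
    have "linear (dd g (f x))"
      using Suc.prems(2) that assms(3) by (intro linear_frechet_derivative) (simp add: image_subset_iff)
    then show ?thesis by (rule linear_family_sum)
  qed
  have "C_k_on k (\<lambda>x. \<Sum>b\<in>Basis. (dd f x v \<bullet> b) *\<^sub>R dd g (f x) b) U" for v
    using Suc.prems fk assms(1)
    by (intro C_k_on_sum C_k_on_scaleR C_k_on_inner Suc.IH C_k_on_const) simp_all
  then have "C_k_on k (\<lambda>x. dd g (f x) (dd f x v)) U" for v
    by (rule C_k_on_cong[OF assms(1)]) (rule lin[symmetric])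
  with der show ?case by (intro C_k_on_SucI[OF assms(1)]) auto
qed

text \<open>The derivative is a polynomial in \<open>inverse\<close> itself, so the induction
  closes. The square root works in the same way, through the inverse of the root.\<close>

lemma C_k_on_inverse: "C_k_on k (inverse :: real \<Rightarrow> real) {x. x \<noteq> 0}"
proof (induction k)
  case 0
  then show ?case by (simp add: continuous_on_inverse)
next
  case (Suc k)
  have o: "open {x::real. x \<noteq> 0}" by (simp add: open_Collect_neq)
  have "C_k_on k (\<lambda>x::real. (inverse x * v) * (- inverse x)) {x. x \<noteq> 0}" for v
    using C_k_on_mult[OF o C_k_on_const[OF o, of k "-1"] Suc]
    by (intro C_k_on_mult Suc C_k_on_const o) simp
  then show ?case
    by (intro C_k_on_SucI[OF o, where f' = "\<lambda>x v. (inverse x * v) * (- inverse x)"])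
      (auto intro!: derivative_eq_intros simp: mult_ac)
qed

lemma C_k_on_sqrt: "C_k_on k sqrt {0<..}"
proof (induction k)
  case 0
  then show ?case by (simp add: continuous_on_real_sqrt)
next
  case (Suc k)
  have o: "open {0::real<..}" by simp
  have o2: "open {x::real. x \<noteq> 0}" by (simp add: open_Collect_neq)
  have "C_k_on k (\<lambda>x. inverse (sqrt x)) {0<..}"
    by (rule C_k_on_compose[OF o o2 _ Suc C_k_on_inverse]) auto
  then have "C_k_on k (\<lambda>x::real. v / 2 * inverse (sqrt x)) {0<..}" for v
    by (intro C_k_on_mult C_k_on_const o)
  then show ?case
    by (intro C_k_on_SucI[OF o, where f' = "\<lambda>x v. v / 2 * inverse (sqrt x)"])
      (auto intro!: derivative_eq_intros simp: field_simps)
qed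

section \<open>Closure properties of smooth maps\<close>

lemma smooth_on_cong:
  "smooth_on U f \<Longrightarrow> open U \<Longrightarrow> (\<And>x. x \<in> U \<Longrightarrow> f x = g x) \<Longrightarrow> smooth_on U g"
  using C_k_on_cong[of U _ f g] by (simp add: smooth_on_def)

lemma smooth_on_subset: "smooth_on U f \<Longrightarrow> V \<subseteq> U \<Longrightarrow> smooth_on V f"
  using C_k_on_subset[of _ f U V] by (simp add: smooth_on_def)

lemma smooth_on_local:
  "(\<And>x. x \<in> U \<Longrightarrow> \<exists>V. open V \<and> x \<in> V \<and> smooth_on V f) \<Longrightarrow> smooth_on U f"
  unfolding smooth_on_def by (meson C_k_on_local)

lemma smooth_on_differentiable: "smooth_on U f \<Longrightarrow> x \<in> U \<Longrightarrow> f differentiable (at x)"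
  unfolding smooth_on_def by (drule spec[of _ 1]) simp

lemma smooth_on_has_derivative:
  "smooth_on U f \<Longrightarrow> x \<in> U \<Longrightarrow> (f has_derivative (\<lambda>v. dd f x v)) (at x)"
  by (intro has_derivative_dd smooth_on_differentiable)

lemma smooth_on_continuous: "smooth_on U f \<Longrightarrow> continuous_on U f"
  unfolding smooth_on_def by (drule spec[of _ 0]) simp

lemma smooth_on_dd: "smooth_on U f \<Longrightarrow> smooth_on U (\<lambda>x. dd f x v)"
  unfolding smooth_on_def by (rule allI, drule_tac x = "Suc k" in spec) simp

lemma smooth_on_linear_dd: "smooth_on U f \<Longrightarrow> x \<in> U \<Longrightarrow> linear (\<lambda>v. dd f x v)"
  by (intro linear_frechet_derivative smooth_on_differentiable)

lemma smooth_on_const: "open U \<Longrightarrow> smooth_on U (\<lambda>x. c)"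
  by (simp add: smooth_on_def C_k_on_const)

lemma smooth_on_bounded_linear: "bounded_linear f \<Longrightarrow> open U \<Longrightarrow> smooth_on U f"
  by (simp add: smooth_on_def C_k_on_bounded_linear)

lemma smooth_on_linear:
  fixes f :: "'a::euclidean_space \<Rightarrow> 'b::real_normed_vector"
  shows "linear f \<Longrightarrow> open U \<Longrightarrow> smooth_on U f"
  by (simp add: smooth_on_bounded_linear linear_conv_bounded_linear)

lemma smooth_on_ident: "open U \<Longrightarrow> smooth_on U (\<lambda>x. x)"
  by (simp add: smooth_on_bounded_linear bounded_linear_ident)

lemma smooth_on_bilinear:
  "bounded_bilinear p \<Longrightarrow> open U \<Longrightarrow> smooth_on U f \<Longrightarrow> smooth_on U g \<Longrightarrow>
    smooth_on U (\<lambda>x. p (f x) (g x))"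
  by (simp add: smooth_on_def C_k_on_bilinear)

lemmas smooth_on_mult = smooth_on_bilinear[OF bounded_bilinear_mult]
lemmas smooth_on_scaleR = smooth_on_bilinear[OF bounded_bilinear_scaleR]
lemmas smooth_on_inner = smooth_on_bilinear[OF bounded_bilinear_inner]

lemma smooth_on_add:
  "open U \<Longrightarrow> smooth_on U f \<Longrightarrow> smooth_on U g \<Longrightarrow> smooth_on U (\<lambda>x. f x + g x)"
  by (simp add: smooth_on_def C_k_on_add)

lemma smooth_on_uminus: "open U \<Longrightarrow> smooth_on U f \<Longrightarrow> smooth_on U (\<lambda>x. - f x)"
  using smooth_on_scaleR[OF _ smooth_on_const[of U "-1"], of f] by simp

lemma smooth_on_diff:
  "open U \<Longrightarrow> smooth_on U f \<Longrightarrow> smooth_on U g \<Longrightarrow> smooth_on U (\<lambda>x. f x - g x)"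
  using smooth_on_add[OF _ _ smooth_on_uminus, of U f g] by simp

lemma smooth_on_sum:
  "open U \<Longrightarrow> (\<And>i. i \<in> I \<Longrightarrow> smooth_on U (f i)) \<Longrightarrow> smooth_on U (\<lambda>x. \<Sum>i\<in>I. f i x)"
  by (simp add: smooth_on_def C_k_on_sum)

lemma smooth_on_compose:
  fixes f :: "'a::real_normed_vector \<Rightarrow> 'b::euclidean_space"
  shows "open U \<Longrightarrow> open V \<Longrightarrow> f ` U \<subseteq> V \<Longrightarrow> smooth_on U f \<Longrightarrow> smooth_on V g \<Longrightarrow>
    smooth_on U (\<lambda>x. g (f x))"
  by (simp add: smooth_on_def C_k_on_compose)

lemma smooth_on_divide:
  fixes f g :: "'a::real_normed_vector \<Rightarrow> real"
  assumes "open U" "smooth_on U f" "smooth_on U g" "\<And>x. x \<in> U \<Longrightarrow> g x \<noteq> 0"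
  shows "smooth_on U (\<lambda>x. f x / g x)"
proof -
  have o: "open {x::real. x \<noteq> 0}" by (simp add: open_Collect_neq)
  have "smooth_on {x. x \<noteq> 0} (inverse :: real \<Rightarrow> real)" by (simp add: smooth_on_def C_k_on_inverse)
  then have "smooth_on U (\<lambda>x. inverse (g x))"
    using assms(4) by (intro smooth_on_compose[OF assms(1) o _ assms(3)]) auto
  from smooth_on_mult[OF assms(1,2) this] show ?thesis by (simp add: divide_inverse)
qed

lemma smooth_on_sqrt:
  fixes f :: "'a::real_normed_vector \<Rightarrow> real"
  assumes "open U" "smooth_on U f" "\<And>x. x \<in> U \<Longrightarrow> f x > 0"
  shows "smooth_on U (\<lambda>x. sqrt (f x))"
proof (rule smooth_on_compose[OF assms(1) _ _ assms(2)])
  show "smooth_on {0<..} sqrt" by (simp add: smooth_on_def C_k_on_sqrt)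
qed (use assms(3) in auto)

text \<open>Tensors are known to be smooth on constant fields; the basis expansion extends this to
  variable ones.\<close>

lemma smooth_on_family:
  fixes f :: "'x::real_normed_vector \<Rightarrow> 'a::euclidean_space \<Rightarrow> 'b::real_normed_vector"
  assumes "open U" "\<And>x. x \<in> U \<Longrightarrow> linear (f x)" "\<And>u. smooth_on U (\<lambda>x. f x u)" "smooth_on U g"
  shows "smooth_on U (\<lambda>x. f x (g x))"
proof (rule smooth_on_cong[OF _ assms(1)])
  show "smooth_on U (\<lambda>x. \<Sum>b\<in>Basis. (g x \<bullet> b) *\<^sub>R f x b)"
    by (intro smooth_on_sum smooth_on_scaleR smooth_on_inner assms smooth_on_const)
qed (rule linear_family_sum[symmetric, OF assms(2)])

text \<open>Product rule for a field of linear maps applied to a variable vector: one term freezes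
  the vector, the other differentiates it. The covariant derivatives below are split in this
  way.\<close>

lemma dd_family:
  fixes f :: "'x::real_normed_vector \<Rightarrow> 'a::euclidean_space \<Rightarrow> 'b::real_normed_vector"
  assumes "open U" "x \<in> U" "\<And>y. y \<in> U \<Longrightarrow> linear (f y)" "\<And>u. smooth_on U (\<lambda>y. f y u)" "smooth_on U g"
  shows "dd (\<lambda>y. f y (g y)) x z = dd (\<lambda>y. f y (g x)) x z + f x (dd g x z)"
proof -
  have df: "((\<lambda>y. f y u) has_derivative (\<lambda>z. dd (\<lambda>y. f y u) x z)) (at x)" for u
    by (rule smooth_on_has_derivative[OF assms(4,2)])
  have dg: "((\<lambda>y. g y \<bullet> b) has_derivative (\<lambda>z. dd g x z \<bullet> b)) (at x)" for b
    by (rule has_derivative_inner_left[OF smooth_on_has_derivative[OF assms(5,2)]])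
  have 1: "((\<lambda>y. \<Sum>b\<in>Basis. (g y \<bullet> b) *\<^sub>R f y b) has_derivative
    (\<lambda>z. \<Sum>b\<in>Basis. (g x \<bullet> b) *\<^sub>R dd (\<lambda>y. f y b) x z + (dd g x z \<bullet> b) *\<^sub>R f x b)) (at x)"
    by (intro has_derivative_sum has_derivative_scaleR df dg)
  have 2: "((\<lambda>y. \<Sum>b\<in>Basis. (g x \<bullet> b) *\<^sub>R f y b) has_derivative
    (\<lambda>z. \<Sum>b\<in>Basis. (g x \<bullet> b) *\<^sub>R dd (\<lambda>y. f y b) x z)) (at x)"
    by (intro has_derivative_sum has_derivative_scaleR_right df)
  have e: "f y w = (\<Sum>b\<in>Basis. (w \<bullet> b) *\<^sub>R f y b)" if "y \<in> U" for y w
    using assms(3)[OF that] by (rule linear_family_sum)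
  have 3: "((\<lambda>y. f y (g y)) has_derivative
    (\<lambda>z. \<Sum>b\<in>Basis. (g x \<bullet> b) *\<^sub>R dd (\<lambda>y. f y b) x z + (dd g x z \<bullet> b) *\<^sub>R f x b)) (at x)"
    by (rule has_derivative_transform_within_open[OF 1 assms(1,2)]) (rule e[symmetric])
  have 4: "((\<lambda>y. f y (g x)) has_derivative (\<lambda>z. \<Sum>b\<in>Basis. (g x \<bullet> b) *\<^sub>R dd (\<lambda>y. f y b) x z)) (at x)"
    by (rule has_derivative_transform_within_open[OF 2 assms(1,2)]) (rule e[symmetric])
  show ?thesis
    unfolding dd_eq[OF 3] dd_eq[OF 4] e[OF assms(2), of "dd g x z"] by (simp add: sum.distrib)
qed

lemma C_k_on_vec:
  fixes f :: "'a::real_normed_vector \<Rightarrow> real^'n"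
  assumes "open U" "\<And>i. C_k_on k (\<lambda>x. f x $ i) U"
  shows "C_k_on k f U"
proof -
  have "C_k_on k (\<lambda>x. \<Sum>i\<in>UNIV. (f x $ i) *\<^sub>R axis i (1::real)) U"
    by (intro C_k_on_sum C_k_on_scaleR assms C_k_on_const)
  moreover have "(\<Sum>i\<in>UNIV. (f x $ i) *\<^sub>R axis i (1::real)) = f x" for x
    using basis_expansion[of "f x"] by (simp add: scalar_mult_eq_scaleR)
  ultimately show ?thesis by simp
qed

lemma C_k_on_nth:
  fixes f :: "'a::real_normed_vector \<Rightarrow> real^'n"
  assumes "open U" "C_k_on k f U"
  shows "C_k_on k (\<lambda>x. f x $ i) U"
  using C_k_on_inner[OF assms C_k_on_const[OF assms(1), of k "axis i 1"]] by (simp add: inner_axis)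

lemma smooth_on_vec:
  fixes f :: "'a::real_normed_vector \<Rightarrow> real^'n"
  shows "open U \<Longrightarrow> (\<And>i. smooth_on U (\<lambda>x. f x $ i)) \<Longrightarrow> smooth_on U f"
  by (simp add: smooth_on_def C_k_on_vec)

lemma smooth_on_nth:
  fixes f :: "'a::real_normed_vector \<Rightarrow> real^'n"
  shows "open U \<Longrightarrow> smooth_on U f \<Longrightarrow> smooth_on U (\<lambda>x. f x $ i)"
  by (simp add: smooth_on_def C_k_on_nth)

lemma C_k_on_det:
  fixes A :: "'a::real_normed_vector \<Rightarrow> real^'n^'n"
  assumes "open U" "\<And>i j. C_k_on k (\<lambda>x. A x $ i $ j) U"
  shows "C_k_on k (\<lambda>x. det (A x)) U"
  unfolding det_def by (intro C_k_on_sum C_k_on_mult C_k_on_prod C_k_on_const assms)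

text \<open>Cramer's rule writes the solution as a quotient of determinants. The version for a
  single order k is what the bootstrapping of local inverses uses.\<close>

lemma C_k_on_solve:
  fixes A :: "'a::real_normed_vector \<Rightarrow> real^'n^'n"
  assumes "open U" "\<And>i j. C_k_on k (\<lambda>x. A x $ i $ j) U" "C_k_on k b U"
    and "\<And>x. x \<in> U \<Longrightarrow> det (A x) \<noteq> 0" "\<And>x. x \<in> U \<Longrightarrow> A x *v y x = b x"
  shows "C_k_on k y U"
proof (rule C_k_on_cong[OF assms(1)])
  let ?d = "\<lambda>x l. det (\<chi> i j. if j = l then b x $ i else A x $ i $ j)"
  have o: "open {x::real. x \<noteq> 0}" by (simp add: open_Collect_neq)
  have "C_k_on k (\<lambda>x. inverse (det (A x))) U"
    using assms(4)
    by (intro C_k_on_compose[OF assms(1) o _ C_k_on_det[OF assms(1,2)] C_k_on_inverse]) auto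
  moreover have "C_k_on k (\<lambda>x. ?d x l) U" for l
  proof (rule C_k_on_det[OF assms(1)])
    show "C_k_on k (\<lambda>x. (\<chi> i j. if j = l then b x $ i else A x $ i $ j) $ i $ j) U" for i j
      by (cases "j = l") (use assms C_k_on_nth in auto)
  qed
  ultimately show "C_k_on k (\<lambda>x. \<chi> l. ?d x l * inverse (det (A x))) U"
    by (intro C_k_on_vec[OF assms(1)]) (auto intro: C_k_on_mult[OF assms(1)])
  show "(\<chi> l. ?d x l * inverse (det (A x))) = y x" if "x \<in> U" for x
    using cramer[OF assms(4)[OF that], of "y x" "b x"] assms(5)[OF that] by (simp add: divide_inverse)
qed

lemma smooth_on_solve:
  fixes A :: "'a::real_normed_vector \<Rightarrow> real^'n^'n"
  assumes "open U" "\<And>i j. smooth_on U (\<lambda>x. A x $ i $ j)" "smooth_on U b"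
    and "\<And>x. x \<in> U \<Longrightarrow> det (A x) \<noteq> 0" "\<And>x. x \<in> U \<Longrightarrow> A x *v y x = b x"
  shows "smooth_on U y"
  using assms unfolding smooth_on_def by (blast intro: C_k_on_solve)

section \<open>Symmetry of second derivatives\<close>

lemma has_real_derivative_line:
  fixes f :: "'a::real_normed_vector \<Rightarrow> real"
  assumes "f differentiable (at (c + r *\<^sub>R u))"
  shows "((\<lambda>r. f (c + r *\<^sub>R u)) has_real_derivative dd f (c + r *\<^sub>R u) u) (at r)"
proof -
  have "((\<lambda>r. c + r *\<^sub>R u) has_derivative (\<lambda>h. h *\<^sub>R u)) (at r)"
    by (auto intro!: derivative_eq_intros)
  from has_derivative_compose[OF this has_derivative_dd[OF assms]]
  have "((\<lambda>r. f (c + r *\<^sub>R u)) has_derivative (\<lambda>h. dd f (c + r *\<^sub>R u) (h *\<^sub>R u))) (at r)" .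
  moreover have "(\<lambda>h. dd f (c + r *\<^sub>R u) (h *\<^sub>R u)) = (*) (dd f (c + r *\<^sub>R u) u)"
    using linear_frechet_derivative[OF assms] by (auto simp: linear_cmul)
  ultimately show ?thesis by (simp add: has_field_derivative_def)
qed

text \<open>The mean value theorem is applied first along \<open>u\<close> and then along
  \<open>v\<close>. The second difference is symmetric in \<open>u\<close> and \<open>v\<close>,
  while the right-hand side records the order of differentiation.\<close>

lemma second_difference:
  fixes f :: "'a::real_normed_vector \<Rightarrow> real"
  assumes f: "smooth_on U f" and s: "0 < s"
    and seg: "\<And>p q. 0 \<le> p \<Longrightarrow> p \<le> s \<Longrightarrow> 0 \<le> q \<Longrightarrow> q \<le> s \<Longrightarrow> x + p *\<^sub>R u + q *\<^sub>R v \<in> U"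
  shows "\<exists>p q. 0 \<le> p \<and> p \<le> s \<and> 0 \<le> q \<and> q \<le> s \<and>
    f (x + s *\<^sub>R u + s *\<^sub>R v) - f (x + s *\<^sub>R u) - f (x + s *\<^sub>R v) + f x
      = s\<^sup>2 * dd (\<lambda>y. dd f y u) (x + p *\<^sub>R u + q *\<^sub>R v) v"
proof -
  have d: "f differentiable (at y)" "(\<lambda>y. dd f y u) differentiable (at y)" if "y \<in> U" for y
    using smooth_on_differentiable[OF f that] smooth_on_differentiable[OF smooth_on_dd[OF f] that] .
  let ?\<phi> = "\<lambda>p. f ((x + s *\<^sub>R v) + p *\<^sub>R u) - f (x + p *\<^sub>R u)"
  have "\<exists>p>0. p < s \<and> ?\<phi> s - ?\<phi> 0 = (s - 0) * (dd f ((x + s *\<^sub>R v) + p *\<^sub>R u) u - dd f (x + p *\<^sub>R u) u)"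
  proof (rule MVT2[OF s])
    fix p assume "0 \<le> p" "p \<le> s"
    then have "(x + s *\<^sub>R v) + p *\<^sub>R u \<in> U" "x + p *\<^sub>R u \<in> U"
      using seg[of p s] seg[of p 0] s by (simp_all add: add_ac)
    then show "(?\<phi> has_real_derivative dd f ((x + s *\<^sub>R v) + p *\<^sub>R u) u - dd f (x + p *\<^sub>R u) u) (at p)"
      by (intro DERIV_diff has_real_derivative_line d)
  qed
  then obtain p where p: "0 < p" "p < s"
    "?\<phi> s - ?\<phi> 0 = s * (dd f ((x + s *\<^sub>R v) + p *\<^sub>R u) u - dd f (x + p *\<^sub>R u) u)" by auto
  let ?\<psi> = "\<lambda>q. dd f ((x + p *\<^sub>R u) + q *\<^sub>R v) u"
  have "\<exists>q>0. q < s \<and> ?\<psi> s - ?\<psi> 0 = (s - 0) * dd (\<lambda>y. dd f y u) ((x + p *\<^sub>R u) + q *\<^sub>R v) v"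
    using p seg by (intro MVT2[OF s] has_real_derivative_line d) simp
  then obtain q where q: "0 < q" "q < s"
    "?\<psi> s - ?\<psi> 0 = s * dd (\<lambda>y. dd f y u) (x + p *\<^sub>R u + q *\<^sub>R v) v" by auto
  have "?\<psi> s - ?\<psi> 0 = dd f ((x + s *\<^sub>R v) + p *\<^sub>R u) u - dd f (x + p *\<^sub>R u) u"
    by (simp add: add_ac)
  with p(3) q(3) have "?\<phi> s - ?\<phi> 0 = s\<^sup>2 * dd (\<lambda>y. dd f y u) (x + p *\<^sub>R u + q *\<^sub>R v) v"
    by (simp add: power2_eq_square)
  then show ?thesis
    using p q by (intro exI[of _ p] exI[of _ q]) (simp add: algebra_simps)
qed

text \<open>One and the same second difference equals either mixed derivative at some point of a
  small parallelogram; by continuity the two cannot differ at \<open>x\<close>.\<close>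

lemma dd_commute_real:
  fixes f :: "'a::real_normed_vector \<Rightarrow> real"
  assumes "open U" "x \<in> U" and f: "smooth_on U f"
  shows "dd (\<lambda>y. dd f y v) x u = dd (\<lambda>y. dd f y u) x v"
proof (rule ccontr)
  let ?P = "\<lambda>y. dd (\<lambda>y. dd f y v) y u" and ?Q = "\<lambda>y. dd (\<lambda>y. dd f y u) y v"
  assume "?P x \<noteq> ?Q x"
  then have e: "dist (?P x) (?Q x) / 2 > 0" (is "?e > 0") by simp
  have near: "\<forall>\<^sub>F y in nhds x. dist (R y) (R x) < e" if "isCont R x" "e > 0" for R :: "'a \<Rightarrow> real" and e
    using that by (simp add: tendstoD isCont_def tendsto_at_iff_tendsto_nhds)
  have "isCont ?P x" "isCont ?Q x"
    using smooth_on_continuous[OF smooth_on_dd[OF smooth_on_dd[OF f]]] assms(1,2)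
    by (simp_all add: continuous_on_eq_continuous_at)
  then have "\<forall>\<^sub>F y in nhds x. dist (?P y) (?P x) < ?e" "\<forall>\<^sub>F y in nhds x. dist (?Q y) (?Q x) < ?e"
    using near[OF _ e] by blast+
  moreover have "\<forall>\<^sub>F y in nhds x. y \<in> U" using assms(1,2) by (rule eventually_nhds_in_open)
  ultimately have "\<forall>\<^sub>F y in nhds x. dist (?P y) (?P x) < ?e \<and> dist (?Q y) (?Q x) < ?e \<and> y \<in> U"
    by eventually_elim auto
  then obtain d where d: "d > 0"
    "\<And>y. dist y x < d \<Longrightarrow> dist (?P y) (?P x) < ?e \<and> dist (?Q y) (?Q x) < ?e \<and> y \<in> U"
    unfolding eventually_nhds_metric by blast
  \<comment> \<open>Keeps the whole parallelogram of size \<open>s\<close> inside the ball of radius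
    \<open>d\<close>; the summand 1 makes the estimate strict and covers u = v = 0.\<close>
  define s where "s = d / (norm u + norm v + 1)"
  have n: "norm u + norm v + 1 > 0" by (smt (verit) norm_ge_zero)
  then have s: "s > 0" using d(1) by (simp add: s_def)
  have seg: "dist (x + p *\<^sub>R u + q *\<^sub>R v) x < d" if "0 \<le> p" "p \<le> s" "0 \<le> q" "q \<le> s" for p q
  proof -
    have "dist (x + p *\<^sub>R u + q *\<^sub>R v) x \<le> p * norm u + q * norm v"
      using norm_triangle_ineq[of "p *\<^sub>R u" "q *\<^sub>R v"] that by (simp add: dist_norm add.assoc)
    also have "\<dots> \<le> s * norm u + s * norm v"
      using that by (intro add_mono mult_right_mono) auto
    also have "\<dots> < s * (norm u + norm v + 1)" using s by (simp add: algebra_simps)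
    also have "\<dots> = d" using n by (simp add: s_def)
    finally show ?thesis .
  qed
  have seg': "dist (x + p *\<^sub>R v + q *\<^sub>R u) x < d" if "0 \<le> p" "p \<le> s" "0 \<le> q" "q \<le> s" for p q
    using seg[of q p] that by (simp add: add_ac)
  obtain p q where 1: "0 \<le> p" "p \<le> s" "0 \<le> q" "q \<le> s"
    "f (x + s *\<^sub>R u + s *\<^sub>R v) - f (x + s *\<^sub>R u) - f (x + s *\<^sub>R v) + f x
      = s\<^sup>2 * ?Q (x + p *\<^sub>R u + q *\<^sub>R v)"
    using second_difference[OF f s, of x u v] seg d(2) by blast
  obtain p' q' where 2: "0 \<le> p'" "p' \<le> s" "0 \<le> q'" "q' \<le> s"
    "f (x + s *\<^sub>R v + s *\<^sub>R u) - f (x + s *\<^sub>R v) - f (x + s *\<^sub>R u) + f x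
      = s\<^sup>2 * ?P (x + p' *\<^sub>R v + q' *\<^sub>R u)"
    using second_difference[OF f s, of x v u] seg' d(2) by blast
  have swap: "x + s *\<^sub>R v + s *\<^sub>R u = x + s *\<^sub>R u + s *\<^sub>R v" by (simp add: add_ac)
  have "s\<^sup>2 * ?Q (x + p *\<^sub>R u + q *\<^sub>R v) = s\<^sup>2 * ?P (x + p' *\<^sub>R v + q' *\<^sub>R u)"
    using 1(5) 2(5)[unfolded swap] by linarith
  then have "?Q (x + p *\<^sub>R u + q *\<^sub>R v) = ?P (x + p' *\<^sub>R v + q' *\<^sub>R u)" using s by simp
  moreover have "dist (?Q (x + p *\<^sub>R u + q *\<^sub>R v)) (?Q x) < ?e" using d(2)[OF seg] 1 by blast
  moreover have "dist (?P (x + p' *\<^sub>R v + q' *\<^sub>R u)) (?P x) < ?e" using d(2)[OF seg'] 2 by blast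
  ultimately show False
    using dist_triangle3[of "?P x" "?Q x" "?P (x + p' *\<^sub>R v + q' *\<^sub>R u)"] by simp
qed

lemma dd_commute:
  fixes f :: "'a::real_normed_vector \<Rightarrow> 'b::euclidean_space"
  assumes "open U" "x \<in> U" and f: "smooth_on U f"
  shows "dd (\<lambda>y. dd f y v) x u = dd (\<lambda>y. dd f y u) x v"
proof (rule euclidean_eqI)
  fix b :: 'b assume "b \<in> Basis"
  have fb: "smooth_on U (\<lambda>y. f y \<bullet> b)" by (intro smooth_on_inner smooth_on_const assms)
  have 1: "dd (\<lambda>y. f y \<bullet> b) y w = dd f y w \<bullet> b" if "y \<in> U" for y w
    by (rule dd_eq[OF has_derivative_inner_left[OF smooth_on_has_derivative[OF f that]]])
  have 2: "dd (\<lambda>y. dd (\<lambda>y. f y \<bullet> b) y w) x w' = dd (\<lambda>y. dd f y w) x w' \<bullet> b" for w w'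
  proof -
    have "dd (\<lambda>y. dd (\<lambda>y. f y \<bullet> b) y w) x w' = dd (\<lambda>y. dd f y w \<bullet> b) x w'"
      by (rule dd_cong[OF assms(1,2) smooth_on_differentiable[OF smooth_on_dd[OF fb] assms(2)]])
        (rule 1)
    also have "\<dots> = dd (\<lambda>y. dd f y w) x w' \<bullet> b"
      by (rule dd_eq[OF has_derivative_inner_left[OF smooth_on_has_derivative[OF smooth_on_dd[OF f] assms(2)]]])
    finally show ?thesis .
  qed
  show "dd (\<lambda>y. dd f y v) x u \<bullet> b = dd (\<lambda>y. dd f y u) x v \<bullet> b"
    using dd_commute_real[OF assms(1,2) fb] unfolding 2 .
qed

section \<open>Smooth local inverses\<close>

lemma det_matrix_inj:
  fixes f :: "real^'n \<Rightarrow> real^'n"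
  assumes "linear f" "inj f" shows "det (matrix f) \<noteq> 0"
  by (metis assms det_nz_iff_inj matrix_of_matrix_vector_mul matrix_vector_mul(2) matrix_works)

text \<open>Bootstrapping: the derivative of the local inverse \<open>g\<close> solves a linear
  system whose matrix is the derivative of \<open>f\<close> at \<open>g y\<close>. By Cramer's rule
  it is as regular as \<open>g\<close>, so \<open>g\<close> gains one order of differentiability at
  each step.\<close>

lemma smooth_local_inverse:
  fixes f :: "real^'n \<Rightarrow> real^'n"
  assumes U: "open U" "x0 \<in> U" and f: "smooth_on U f" and inj: "inj (\<lambda>v. dd f x0 v)"
  obtains U' V g where "open U'" "U' \<subseteq> U" "x0 \<in> U'" "open V" "f x0 \<in> V" "homeomorphism U' V f g"
    "smooth_on V g" "\<And>y v. y \<in> V \<Longrightarrow> dd f (g y) (dd g y v) = v"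
proof -
  define f' where "f' x = Blinfun (\<lambda>v. dd f x v)" for x
  have f': "blinfun_apply (f' x) = dd f x" if "x \<in> U" for x
    unfolding f'_def using smooth_on_has_derivative[OF f that]
    by (intro bounded_linear_Blinfun_apply) (rule has_derivative_bounded_linear)
  have der: "(f has_derivative blinfun_apply (f' x)) (at x)" if "x \<in> U" for x
    using smooth_on_has_derivative[OF f that] f'[OF that] by simp
  have cont: "continuous_on U f'"
  proof (rule continuous_on_blinfun_componentwise)
    fix i :: "real^'n"
    have "continuous_on U (\<lambda>x. dd f x i)" by (intro smooth_on_continuous smooth_on_dd f)
    then show "continuous_on U (\<lambda>x. blinfun_apply (f' x) i)"
      by (rule continuous_on_eq) (simp add: f')
  qed
  have lin: "linear (dd f x0)" using smooth_on_linear_dd[OF f U(2)] by simp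
  obtain g0 where g0: "linear g0" "g0 \<circ> dd f x0 = id"
    using linear_injective_left_inverse[OF lin] inj by auto
  have "Blinfun g0 o\<^sub>L f' x0 = id_blinfun"
  proof (rule blinfun_eqI)
    fix v
    have "blinfun_apply (Blinfun g0) w = g0 w" for w
      using g0(1) by (simp add: bounded_linear_Blinfun_apply linear_conv_bounded_linear)
    then show "blinfun_apply (Blinfun g0 o\<^sub>L f' x0) v = blinfun_apply id_blinfun v"
      using g0(2) f'[OF U(2)] by (simp add: pointfree_idE)
  qed
  from inverse_function_theorem[OF U(1) der cont U(2) this]
  obtain U' V g g' where 1: "open U'" "U' \<subseteq> U" "x0 \<in> U'" "open V" "f x0 \<in> V" and hom: "homeomorphism U' V f g"
    and g: "\<And>y. y \<in> V \<Longrightarrow> (g has_derivative (g' y)) (at y)"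
    and g': "\<And>y. y \<in> V \<Longrightarrow> g' y = inv (blinfun_apply (f'(g y)))"
    and bij: "\<And>y. y \<in> V \<Longrightarrow> bij (blinfun_apply (f'(g y)))" by blast
  have gU: "g y \<in> U" if "y \<in> V" for y using hom that 1(2) by (auto simp: homeomorphism_def)
  have solve: "dd f (g y) (g' y v) = v" if "y \<in> V" for y v
    using g'[OF that] bij[OF that] f'[OF gU[OF that]] by (simp add: bij_is_surj surj_f_inv_f)
  have "C_k_on k g V" for k
  proof (induction k)
    case 0
    then show ?case using hom by (simp add: homeomorphism_def)
  next
    case (Suc k)
    show ?case
    proof (rule C_k_on_SucI[OF 1(4) g])
      fix v
      show "C_k_on k (\<lambda>y. g' y v) V"
      proof (rule C_k_on_solve[OF 1(4), where A = "\<lambda>y. matrix (dd f (g y))" and b = "\<lambda>y. v"])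
        fix i j
        have "C_k_on k (\<lambda>x. dd f x (axis j 1) $ i) U"
          using smooth_on_nth[OF U(1) smooth_on_dd[OF f]] by (simp add: smooth_on_def)
        from C_k_on_compose[OF 1(4) U(1) _ Suc this]
        show "C_k_on k (\<lambda>y. matrix (dd f (g y)) $ i $ j) V"
          using gU by (auto simp: matrix_def)
      next
        fix y assume y: "y \<in> V"
        have l: "linear (dd f (g y))" using smooth_on_linear_dd[OF f gU[OF y]] by simp
        show "det (matrix (dd f (g y))) \<noteq> 0"
          using bij[OF y] f'[OF gU[OF y]] by (intro det_matrix_inj l) (simp add: bij_is_inj)
        show "matrix (dd f (g y)) *v g' y v = v"
          using solve[OF y] by (simp add: matrix_works l)
      qed (rule C_k_on_const[OF 1(4)])
    qed
  qed
  then have "smooth_on V g" by (simp add: smooth_on_def)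
  moreover have "dd f (g y) (dd g y v) = v" if "y \<in> V" for y v
    using solve[OF that] dd_eq[OF g[OF that]] by simp
  ultimately show thesis using that 1 hom by blast
qed

section \<open>Lorentzian frames and the canonical form of the difference tensor\<close>

definition sym_bilinear :: "('a::real_vector \<Rightarrow> 'a \<Rightarrow> 'b::real_vector) \<Rightarrow> bool" where
  "sym_bilinear h \<longleftrightarrow> bilinear h \<and> (\<forall>u v. h u v = h v u)"

lemma sym_bilinearD:
  assumes "sym_bilinear h"
  shows "h (u + v) w = h u w + h v w" "h w (u + v) = h w u + h w v"
    "h (r *\<^sub>R u) w = r *\<^sub>R h u w" "h w (r *\<^sub>R u) = r *\<^sub>R h w u"
    "h (- u) w = - h u w" "h w (- u) = - h w u"
    "h (u - v) w = h u w - h v w" "h w (u - v) = h w u - h w v"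
    "h 0 w = 0" "h w 0 = 0"
  using assms unfolding sym_bilinear_def
  by (simp_all add: bilinear_ladd bilinear_radd bilinear_lmul bilinear_rmul bilinear_lneg bilinear_rneg
      bilinear_lsub bilinear_rsub bilinear_lzero bilinear_rzero)

lemma sym_bilinear_commute: "sym_bilinear h \<Longrightarrow> h u v = h v u"
  unfolding sym_bilinear_def by blast

lemma sym_bilinear_linear: "sym_bilinear h \<Longrightarrow> linear (h u)" "sym_bilinear h \<Longrightarrow> linear (\<lambda>u. h u v)"
  unfolding sym_bilinear_def bilinear_def by auto

definition lorentz_frame :: "('a::real_vector \<Rightarrow> 'a \<Rightarrow> real) \<Rightarrow> 'a \<Rightarrow> 'a \<Rightarrow> 'a \<Rightarrow> bool" where
  "lorentz_frame h T V W \<longleftrightarrow>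
     h T T = -1 \<and> h V V = 1 \<and> h W W = 1 \<and> h T V = 0 \<and> h T W = 0 \<and> h V W = 0"

text \<open>Pairing with T, V and W detects the coefficients, so the three vectors are independent
  and, by dimension, span. The minus sign compensates h(T, T) = -1.\<close>

lemma lorentz_frame_expand:
  fixes h :: "'a::euclidean_space \<Rightarrow> 'a \<Rightarrow> real"
  assumes h: "sym_bilinear h" and f: "lorentz_frame h T V W" and d: "DIM('a) = 3"
  shows "u = (- h T u) *\<^sub>R T + h V u *\<^sub>R V + h W u *\<^sub>R W"
proof -
  note hl = sym_bilinearD[OF h]
  have f': "h T T = -1" "h V V = 1" "h W W = 1" "h T V = 0" "h T W = 0" "h V W = 0"
    "h V T = 0" "h W T = 0" "h W V = 0"
    using f sym_bilinear_commute[OF h] unfolding lorentz_frame_def by metis+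
  have ne: "T \<noteq> V" "T \<noteq> W" "V \<noteq> W" using f' by auto
  have "independent {T, V, W}"
    unfolding independent_explicit_module
  proof (intro allI impI)
    fix t :: "'a set" and c :: "'a \<Rightarrow> real" and v
    assume t: "finite t" "t \<subseteq> {T, V, W}" "(\<Sum>v\<in>t. c v *\<^sub>R v) = 0" "v \<in> t"
    let ?c = "\<lambda>v. if v \<in> t then c v else 0"
    have "(\<Sum>v\<in>{T, V, W}. ?c v *\<^sub>R v) = (\<Sum>v\<in>t. c v *\<^sub>R v)"
      using t(2) by (intro sum.mono_neutral_cong_right) auto
    then have z: "?c T *\<^sub>R T + ?c V *\<^sub>R V + ?c W *\<^sub>R W = 0" using t(3) ne by (simp add: add.assoc)
    have "h T (?c T *\<^sub>R T + ?c V *\<^sub>R V + ?c W *\<^sub>R W) = 0"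
      "h V (?c T *\<^sub>R T + ?c V *\<^sub>R V + ?c W *\<^sub>R W) = 0"
      "h W (?c T *\<^sub>R T + ?c V *\<^sub>R V + ?c W *\<^sub>R W) = 0"
      unfolding z by (simp_all add: hl)
    then have "?c T = 0" "?c V = 0" "?c W = 0" unfolding hl f' by simp_all
    then show "c v = 0" using t(2,4) by (metis insertE singletonD subsetD)
  qed
  moreover have "card {T, V, W} = 3" using ne by simp
  ultimately have "span {T, V, W} = UNIV"
    using d by (metis dim_eq_card_independent dim_eq_full)
  then have "u \<in> span {T, V, W}" by simp
  then obtain a b c where u: "u = a *\<^sub>R T + b *\<^sub>R V + c *\<^sub>R W"
    unfolding span_insert[of T] span_insert[of V] span_singleton
    by clarsimp (metis add.assoc add_diff_cancel_left' add_diff_eq diff_add_cancel)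
  have "h T u = - a" "h V u = b" "h W u = c" unfolding u hl f' by simp_all
  then show ?thesis using u by simp
qed

text \<open>The basis dual to T, V, W is -h(T, .), h(V, .), h(W, .), and the trace may be taken in
  any basis.\<close>

lemma trace_lorentz_frame:
  fixes F :: "real^3 \<Rightarrow> real^3"
  assumes h: "sym_bilinear h" and f: "lorentz_frame h T V W" and F: "linear F"
  shows "trace (matrix F) = - h T (F T) + h V (F V) + h W (F W)"
proof -
  have e: "F (axis i 1) $ i = - (h T (axis i 1) * F T $ i) + h V (axis i 1) * F V $ i + h W (axis i 1) * F W $ i"
    for i :: 3
  proof -
    have "F (axis i 1) = F ((- h T (axis i 1)) *\<^sub>R T + h V (axis i 1) *\<^sub>R V + h W (axis i 1) *\<^sub>R W)"
      using lorentz_frame_expand[OF h f, of "axis i 1"] by simp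
    then show ?thesis by (simp add: linear_add[OF F] linear_cmul[OF F] linear_neg[OF F] linear_diff[OF F])
  qed
  have s: "(\<Sum>i\<in>UNIV. h X (axis i 1) * y $ i) = h X y" for X and y :: "real^3"
  proof -
    have "h X y = h X (\<Sum>i\<in>UNIV. y $ i *\<^sub>R axis i 1)"
      using basis_expansion[of y] by (simp add: scalar_mult_eq_scaleR)
    also have "\<dots> = (\<Sum>i\<in>UNIV. y $ i * h X (axis i 1))"
      using sym_bilinear_linear[OF h] by (simp add: linear_sum sym_bilinearD[OF h])
    finally show ?thesis by (simp add: mult.commute)
  qed
  have "trace (matrix F) = (\<Sum>i\<in>UNIV. F (axis i 1) $ i)" by (simp add: trace_def matrix_def)
  then show ?thesis unfolding e sum.distrib sum_negf s .
qed

text \<open>The form tr(K_u K_v) is built from K alone, without a choice of frame; T and the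
  coefficients of the canonical form are recovered from it.\<close>

definition contraction_form :: "(real^3 \<Rightarrow> real^3 \<Rightarrow> real^3) \<Rightarrow> real^3 \<Rightarrow> real^3 \<Rightarrow> real" where
  "contraction_form K u v = trace (matrix (\<lambda>w. K u (K v w)))"

lemma canonical_frame_lorentz: "canonical_frame h K b a6 T V W \<Longrightarrow> lorentz_frame h T V W"
  by (auto simp: canonical_frame_def lorentz_frame_def)

text \<open>Invariance under the stabilizer of K leaves only combinations of h and the square of
  h(T, .). The coefficients come from the values at (T, T) and (V, V), namely 6 b^2 and 2 a6^2 - 2
  b^2.\<close>

lemma contraction_form_canonical:
  assumes h: "sym_bilinear h" and K: "sym_bilinear K" and c: "canonical_frame h K b a6 T V W"
  shows "contraction_form K u v =
    (2 * a6\<^sup>2 - 2 * b\<^sup>2) * h u v + (4 * b\<^sup>2 + 2 * a6\<^sup>2) * (h T u * h T v)"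
proof -
  note hl = sym_bilinearD[OF h] and Kl = sym_bilinearD[OF K]
  note fr = canonical_frame_lorentz[OF c]
  have f: "h T T = -1" "h V V = 1" "h W W = 1" "h T V = 0" "h T W = 0" "h V W = 0"
    "h V T = 0" "h W T = 0" "h W V = 0"
    using fr sym_bilinear_commute[OF h] unfolding lorentz_frame_def by metis+
  have k: "K T T = (- 2 * b) *\<^sub>R T" "K T V = b *\<^sub>R V" "K T W = b *\<^sub>R W" "K V T = b *\<^sub>R V" "K W T = b *\<^sub>R W"
     "K V V = (- b) *\<^sub>R T + a6 *\<^sub>R V" "K V W = (- a6) *\<^sub>R W" "K W V = (- a6) *\<^sub>R W"
     "K W W = (- b) *\<^sub>R T - a6 *\<^sub>R V"
    using c sym_bilinear_commute[OF K] unfolding canonical_frame_def by metis+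
  obtain u0 u1 u2 where u: "u = u0 *\<^sub>R T + u1 *\<^sub>R V + u2 *\<^sub>R W"
    by (rule that[OF lorentz_frame_expand[OF h fr]]) simp
  obtain v0 v1 v2 where v: "v = v0 *\<^sub>R T + v1 *\<^sub>R V + v2 *\<^sub>R W"
    by (rule that[OF lorentz_frame_expand[OF h fr]]) simp
  have lin: "linear (\<lambda>w. K u (K v w))"
    using linear_compose[OF sym_bilinear_linear(1)[OF K, of v] sym_bilinear_linear(1)[OF K, of u]]
    by (simp add: o_def)
  show ?thesis
    unfolding contraction_form_def trace_lorentz_frame[OF h fr lin] unfolding u v hl Kl k f
    by (simp add: algebra_simps power2_eq_square)
qed

text \<open>P is m Id + n h(T, .) T and has the eigenvalues m, m, m - n. Hence tr P = 3 m - n and tr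
  P^2 - (tr P)^2 / 3 = 2 n^2 / 3, which explains the factor 3/2, and n \<ge> 0 selects the root. So
  m and n are obtained without choosing eigenvectors.\<close>

lemma canonical_invariants:
  assumes h: "sym_bilinear h" and K: "sym_bilinear K" and c: "canonical_frame h K b a6 T V W"
    and P: "linear P" "\<And>u v. h (P u) v = contraction_form K u v"
  defines "N \<equiv> sqrt (3/2 * (trace (matrix (\<lambda>u. P (P u))) - (trace (matrix P))\<^sup>2 / 3))"
  shows "N = 4 * b\<^sup>2 + 2 * a6\<^sup>2" "(trace (matrix P) + N) / 3 = 2 * a6\<^sup>2 - 2 * b\<^sup>2"
proof -
  note fr = canonical_frame_lorentz[OF c]
  note hl = sym_bilinearD[OF h]
  have f: "h T T = -1" "h V V = 1" "h W W = 1" "h T V = 0" "h T W = 0" "h V W = 0"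
    "h V T = 0" "h W T = 0" "h W V = 0"
    using fr sym_bilinear_commute[OF h] unfolding lorentz_frame_def by metis+
  let ?m = "2 * a6\<^sup>2 - 2 * b\<^sup>2" and ?n = "4 * b\<^sup>2 + 2 * a6\<^sup>2"
  have Pu: "P u = ?m *\<^sub>R u + (?n * h T u) *\<^sub>R T" for u
  proof -
    let ?d = "P u - (?m *\<^sub>R u + (?n * h T u) *\<^sub>R T)"
    have "h ?d v = 0" for v
      unfolding hl P(2) contraction_form_canonical[OF h K c] by simp
    then have "?d = 0"
      using lorentz_frame_expand[OF h fr, of ?d] sym_bilinear_commute[OF h, of _ ?d] by simp
    then show ?thesis by simp
  qed
  have lin: "linear (\<lambda>u. P (P u))" using linear_compose[OF P(1) P(1)] by (simp add: o_def)
  have t1: "trace (matrix P) = 3 * ?m - ?n"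
    unfolding trace_lorentz_frame[OF h fr P(1)] unfolding Pu hl f by simp
  have t2: "trace (matrix (\<lambda>u. P (P u))) = 2 * ?m\<^sup>2 + (?m - ?n)\<^sup>2"
    unfolding trace_lorentz_frame[OF h fr lin] unfolding Pu hl f by (simp add: algebra_simps power2_eq_square)
  have "3/2 * (trace (matrix (\<lambda>u. P (P u))) - (trace (matrix P))\<^sup>2 / 3) = ?n\<^sup>2"
    unfolding t1 t2 by (simp add: field_simps power2_eq_square)
  then have "N = \<bar>?n\<bar>" unfolding N_def by simp
  then show N: "N = ?n" by simp
  show "(trace (matrix P) + N) / 3 = ?m" unfolding N t1 by simp
qed

text \<open>Traces fix b and a6, and the contraction form then fixes T up to sign. The sign is
  decided by K(T, T) = -2 b T, whose left side is even and whose right side is odd in T.\<close>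

lemma canonical_unique:
  fixes K :: "real^3 \<Rightarrow> real^3 \<Rightarrow> real^3"
  assumes h: "sym_bilinear h" and K: "sym_bilinear K"
    and c: "canonical_frame h K b a6 T V W" "b > 0" "a6 \<ge> 0"
    and c': "canonical_frame h K b' a6' T' V' W'" "b' > 0" "a6' \<ge> 0"
  shows "T = T'" "b = b'" "a6 = a6'"
proof -
  note fr = canonical_frame_lorentz[OF c(1)]
  define P where "P u = (2 * a6\<^sup>2 - 2 * b\<^sup>2) *\<^sub>R u + ((4 * b\<^sup>2 + 2 * a6\<^sup>2) * h T u) *\<^sub>R T" for u
  have Pl: "linear P"
    unfolding P_def by (rule linearI) (simp_all add: sym_bilinearD[OF h] algebra_simps)
  have P: "h (P u) v = contraction_form K u v" for u v
    unfolding P_def contraction_form_canonical[OF h K c(1)] sym_bilinearD[OF h] by simp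
  have 1: "4 * b\<^sup>2 + 2 * a6\<^sup>2 = 4 * b'\<^sup>2 + 2 * a6'\<^sup>2" "2 * a6\<^sup>2 - 2 * b\<^sup>2 = 2 * a6'\<^sup>2 - 2 * b'\<^sup>2"
    using canonical_invariants[OF h K c(1) Pl P] canonical_invariants[OF h K c'(1) Pl P] by metis+
  then have "b\<^sup>2 = b'\<^sup>2" "a6\<^sup>2 = a6'\<^sup>2" by simp_all
  then show b: "b = b'" and "a6 = a6'" using c c' by (simp_all add: power2_eq_iff_nonneg)
  have "(4 * b\<^sup>2 + 2 * a6\<^sup>2) * (h T u * h T v) = (4 * b\<^sup>2 + 2 * a6\<^sup>2) * (h T' u * h T' v)" for u v
    using contraction_form_canonical[OF h K c(1), of u v] contraction_form_canonical[OF h K c'(1), of u v]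
    unfolding 1 by linarith
  moreover have "4 * b\<^sup>2 + 2 * a6\<^sup>2 > 0" using c(2) by (simp add: add_pos_nonneg)
  ultimately have tt: "h T u * h T v = h T' u * h T' v" for u v by simp
  \<comment> \<open>The only candidate for a factor with T = s T', because h(T', T') = -1.\<close>
  let ?s = "- h T' T"
  have T: "h T T = -1" "K T T = (-2 * b) *\<^sub>R T" "K T' T' = (-2 * b) *\<^sub>R T'"
    using c(1) c'(1) b by (auto simp: canonical_frame_def)
  have "h (T - ?s *\<^sub>R T') v = 0" for v
    using tt[of T v] T(1) by (simp add: sym_bilinearD[OF h])
  then have "T - ?s *\<^sub>R T' = 0"
    using lorentz_frame_expand[OF h fr, of "T - ?s *\<^sub>R T'"] sym_bilinear_commute[OF h, of _ "T - ?s *\<^sub>R T'"]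
    by simp
  then have Ts: "T = ?s *\<^sub>R T'" by (simp add: eq_neg_iff_add_eq_0)
  then have "K T T = ?s\<^sup>2 *\<^sub>R K T' T'"
    by (metis sym_bilinearD(3,4)[OF K] scaleR_scaleR power2_eq_square)
  moreover have "?s\<^sup>2 = 1" using tt[of T T] T(1) by (simp add: power2_eq_square)
  ultimately have "(-2 * b) *\<^sub>R T = (-2 * b) *\<^sub>R T'" using T by simp
  then show "T = T'" using c(2) by simp
qed

section \<open>Gauss structures and their reparametrizations\<close>

lemma dd_compose:
  assumes "f differentiable (at x)" "g differentiable (at (f x))"
  shows "dd (\<lambda>y. g (f y)) x v = dd g (f x) (dd f x v)"
  by (rule dd_eq[OF has_derivative_compose[OF has_derivative_dd[OF assms(1)] has_derivative_dd[OF assms(2)]]])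

lemma smooth_on_family2:
  fixes f :: "'x::real_normed_vector \<Rightarrow> 'a::euclidean_space \<Rightarrow> 'c::euclidean_space \<Rightarrow> 'b::real_normed_vector"
  assumes "open U" "\<And>x. x \<in> U \<Longrightarrow> bilinear (f x)" "\<And>u v. smooth_on U (\<lambda>x. f x u v)"
    "smooth_on U g" "smooth_on U k"
  shows "smooth_on U (\<lambda>x. f x (g x) (k x))"
proof (rule smooth_on_family[OF assms(1) _ _ assms(5)])
  fix v show "smooth_on U (\<lambda>x. f x (g x) v)"
    by (rule smooth_on_family[where f = "\<lambda>x u. f x u v", OF assms(1) _ assms(3,4)])
      (use assms(2) in \<open>auto simp: bilinear_def\<close>)
qed (use assms(2) in \<open>auto simp: bilinear_def\<close>)

lemma dd_family2:
  fixes f :: "'x::real_normed_vector \<Rightarrow> 'a::euclidean_space \<Rightarrow> 'c::euclidean_space \<Rightarrow> 'b::real_normed_vector"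
  assumes "open U" "x \<in> U" "\<And>x. x \<in> U \<Longrightarrow> bilinear (f x)" "\<And>u v. smooth_on U (\<lambda>x. f x u v)"
    "smooth_on U g" "smooth_on U k"
  shows "dd (\<lambda>y. f y (g y) (k y)) x z =
    dd (\<lambda>y. f y (g x) (k x)) x z + f x (dd g x z) (k x) + f x (g x) (dd k x z)"
proof -
  have l: "linear (f y u)" "linear (\<lambda>u. f y u v)" if "y \<in> U" for y u v
    using assms(3)[OF that] by (auto simp: bilinear_def)
  have s: "smooth_on U (\<lambda>x. f x (g x) v)" for v
    by (rule smooth_on_family[where f = "\<lambda>x u. f x u v", OF assms(1) l(2) assms(4,5)])
  have "dd (\<lambda>y. f y (g y) (k y)) x z = dd (\<lambda>y. f y (g y) (k x)) x z + f x (g x) (dd k x z)"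
    by (rule dd_family[OF assms(1,2) l(1) s assms(6)])
  also have "dd (\<lambda>y. f y (g y) (k x)) x z = dd (\<lambda>y. f y (g x) (k x)) x z + f x (dd g x z) (k x)"
    by (rule dd_family[where f = "\<lambda>y u. f y u (k x)", OF assms(1,2) l(2) assms(4,5)])
  finally show ?thesis by simp
qed

lemma linear_dd_family:
  assumes "open U" "x \<in> U" "\<And>y. y \<in> U \<Longrightarrow> linear (f y)" "\<And>u. smooth_on U (\<lambda>y. f y u)"
  shows "linear (\<lambda>u. dd (\<lambda>y. f y u) x z)"
proof (rule linearI)
  have d: "((\<lambda>y. f y u) has_derivative (\<lambda>z. dd (\<lambda>y. f y u) x z)) (at x)" for u
    by (rule smooth_on_has_derivative[OF assms(4,2)])
  fix u v r
  have "((\<lambda>y. f y (u + v)) has_derivative (\<lambda>z. dd (\<lambda>y. f y u) x z + dd (\<lambda>y. f y v) x z)) (at x)"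
    by (rule has_derivative_transform_within_open[OF has_derivative_add[OF d d] assms(1,2)])
      (simp add: linear_add[OF assms(3)])
  then show "dd (\<lambda>y. f y (u + v)) x z = dd (\<lambda>y. f y u) x z + dd (\<lambda>y. f y v) x z" by (rule dd_eq)
  have "((\<lambda>y. f y (r *\<^sub>R u)) has_derivative (\<lambda>z. r *\<^sub>R dd (\<lambda>y. f y u) x z)) (at x)"
    by (rule has_derivative_transform_within_open[OF has_derivative_scaleR_right[OF d] assms(1,2)])
      (simp add: linear_cmul[OF assms(3)])
  then show "dd (\<lambda>y. f y (r *\<^sub>R u)) x z = r *\<^sub>R dd (\<lambda>y. f y u) x z" by (rule dd_eq)
qed

lemma linear_inv_bij:
  assumes "linear f" "bij f" shows "linear (inv f)"
proof (rule linearI)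
  have f: "f (inv f y) = y" "inv f (f x) = x" for x y
    using assms(2) by (simp_all add: bij_is_surj surj_f_inv_f bij_is_inj)
  show "inv f (x + y) = inv f x + inv f y" for x y
    by (metis f linear_add[OF assms(1)])
  show "inv f (r *\<^sub>R x) = r *\<^sub>R inv f x" for r x
    by (metis f linear_cmul[OF assms(1)])
qed

lemma inj_transversal_unique:
  assumes l: "linear f" and "inj f" "v \<notin> range f" and eq: "f w + r *\<^sub>R v = f w' + r' *\<^sub>R v"
  shows "w = w' \<and> r = r'"
proof -
  have e: "(r' - r) *\<^sub>R v = f (w - w')"
    using eq by (simp add: linear_diff[OF l] algebra_simps)
  have "r = r'"
  proof (rule ccontr)
    assume "r \<noteq> r'"
    then have "v = inverse (r' - r) *\<^sub>R ((r' - r) *\<^sub>R v)" by simp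
    also have "\<dots> = f (inverse (r' - r) *\<^sub>R (w - w'))" unfolding e by (simp add: linear_cmul[OF l])
    finally show False using assms(3) by blast
  qed
  then have "f w = f w'" using eq by simp
  then show ?thesis using \<open>r = r'\<close> assms(2) by (auto dest: injD)
qed

text \<open>Definite descriptions are awkward to differentiate. Here the metric and the two
  connections are given as functions satisfying the defining equations, and the lemmas of the locale
  identify them with the described objects.\<close>

locale gauss_structure =
  fixes U :: "'a::euclidean_space set" and \<sigma> \<xi> :: "'a \<Rightarrow> 'b::euclidean_space"
    and h :: "'a \<Rightarrow> 'a \<Rightarrow> 'a \<Rightarrow> real" and \<Gamma> G :: "'a \<Rightarrow> 'a \<Rightarrow> 'a \<Rightarrow> 'a" and H :: real
  assumes U: "open U"
    and smooth_sigma: "smooth_on U \<sigma>" and smooth_xi: "smooth_on U \<xi>"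
    and immersion: "\<And>x. x \<in> U \<Longrightarrow> inj (dd \<sigma> x)"
    and transversal: "\<And>x. x \<in> U \<Longrightarrow> \<xi> x \<notin> range (dd \<sigma> x)"
    and smooth_h: "\<And>u v. smooth_on U (\<lambda>x. h x u v)"
    and h: "\<And>x. x \<in> U \<Longrightarrow> sym_bilinear (h x)"
    and nondegenerate: "\<And>x u. x \<in> U \<Longrightarrow> (\<And>v. h x u v = 0) \<Longrightarrow> u = 0"
    and \<Gamma>: "\<And>x. x \<in> U \<Longrightarrow> sym_bilinear (\<Gamma> x)"
    and G: "\<And>x. x \<in> U \<Longrightarrow> sym_bilinear (G x)"
    and gauss: "\<And>x u v. x \<in> U \<Longrightarrow> dd (\<lambda>y. dd \<sigma> y v) x u = dd \<sigma> x (\<Gamma> x u v) + h x u v *\<^sub>R \<xi> x"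
    and metric: "\<And>x u v w. x \<in> U \<Longrightarrow> dd (\<lambda>y. h y v w) x u = h x (G x u v) w + h x v (G x u w)"
    and weingarten: "\<And>x u. x \<in> U \<Longrightarrow> dd \<xi> x u = - H *\<^sub>R dd \<sigma> x u"
begin

lemma linear_sigma: "x \<in> U \<Longrightarrow> linear (dd \<sigma> x)"
  using smooth_on_linear_dd[OF smooth_sigma] by simp

lemma tangent_transversal_unique:
  "x \<in> U \<Longrightarrow> dd \<sigma> x w + r *\<^sub>R \<xi> x = dd \<sigma> x w' + r' *\<^sub>R \<xi> x \<Longrightarrow> w = w' \<and> r = r'"
  by (rule inj_transversal_unique[OF linear_sigma immersion transversal])

lemma affine_metric_eq: assumes x: "x \<in> U" shows "affine_metric \<sigma> \<xi> x = h x"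
proof (intro ext)
  fix u v
  show "affine_metric \<sigma> \<xi> x u v = h x u v"
    unfolding affine_metric_def gauss[OF x]
    by (rule the_equality) (use tangent_transversal_unique[OF x] in blast)+
qed

lemma induced_connection_eq: assumes x: "x \<in> U" shows "induced_connection \<sigma> \<xi> x = \<Gamma> x"
proof (intro ext)
  fix u v
  show "induced_connection \<sigma> \<xi> x u v = \<Gamma> x u v"
    unfolding induced_connection_def gauss[OF x]
    by (rule the_equality) (use tangent_transversal_unique[OF x] in blast)+
qed

lemma levi_civita_eq: assumes x: "x \<in> U" shows "levi_civita (affine_metric \<sigma> \<xi>) x = G x"
proof -
  have d: "dd (\<lambda>y. affine_metric \<sigma> \<xi> y v w) x u = dd (\<lambda>y. h y v w) x u" for u v w
    by (rule dd_cong[OF U x, symmetric])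
      (use smooth_on_differentiable[OF smooth_h x] in \<open>simp_all add: affine_metric_eq\<close>)
  show ?thesis
    unfolding levi_civita_def d affine_metric_eq[OF x]
  proof (rule the_equality)
    show "bilinear (G x) \<and> (\<forall>u v. G x u v = G x v u) \<and>
      (\<forall>u v w. dd (\<lambda>y. h y v w) x u = h x (G x u v) w + h x v (G x u w))"
      using G[OF x] metric[OF x] by (simp add: sym_bilinear_def)
  next
    fix G'
    assume G': "bilinear G' \<and> (\<forall>u v. G' u v = G' v u) \<and>
      (\<forall>u v w. dd (\<lambda>y. h y v w) x u = h x (G' u v) w + h x v (G' u w))"
    note hl = sym_bilinearD[OF h[OF x]] and hc = sym_bilinear_commute[OF h[OF x]]
    \<comment> \<open>The difference of two torsion-free metric connections, lowered with h. It is
      symmetric in the first two slots and skew in the last two; six such exchanges return it to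
      itself with the opposite sign.\<close>
    define c where "c u v w = h x (G' u v - G x u v) w" for u v w
    have s: "c u v w = c v u w" for u v w
      using G' sym_bilinear_commute[OF G[OF x]] by (simp add: c_def)
    have a: "c u v w = - c u w v" for u v w
    proof -
      have "h x (G' u v) w + h x v (G' u w) = h x (G x u v) w + h x v (G x u w)"
        using G' metric[OF x, of v w u] by metis
      then show ?thesis
        by (simp add: c_def hl hc[of "G' u w"] hc[of "G x u w"])
    qed
    have "c u v w = 0" for u v w
      using s[of u v w] a[of v u w] s[of v w u] a[of w v u] s[of w u v] a[of u w v] by linarith
    then show "G' = G x"
      using nondegenerate[OF x] unfolding c_def by (intro ext) (metis right_minus_eq)
  qed
qed

lemma difference_tensor_eq:
  assumes "x \<in> U" shows "difference_tensor \<sigma> \<xi> x = (\<lambda>u v. \<Gamma> x u v - G x u v)"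
  using assms by (intro ext) (simp add: difference_tensor_def induced_connection_eq levi_civita_eq)

end

text \<open>\<open>N\<close> is the transformation law of Christoffel symbols. Its inhomogeneous
  second-derivative term is the same for both connections, so their difference transforms as a
  tensor.\<close>

lemma gauss_structure_compose:
  fixes \<theta> :: "'c::euclidean_space \<Rightarrow> 'a::euclidean_space"
  assumes "gauss_structure U \<sigma> \<xi> h \<Gamma> G H"
    and V: "open V" and \<theta>: "smooth_on V \<theta>" "\<theta> ` V \<subseteq> U" "\<And>x. x \<in> V \<Longrightarrow> bij (dd \<theta> x)"
  defines "N \<equiv> \<lambda>A x u v. inv (dd \<theta> x) (A (\<theta> x) (dd \<theta> x u) (dd \<theta> x v) + dd (\<lambda>y. dd \<theta> y v) x u)"
  shows "gauss_structure V (\<lambda>x. \<sigma> (\<theta> x)) (\<lambda>x. \<xi> (\<theta> x)) (\<lambda>x u v. h (\<theta> x) (dd \<theta> x u) (dd \<theta> x v)) (N \<Gamma>) (N G) H"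
proof -
  interpret gauss_structure U \<sigma> \<xi> h \<Gamma> G H by fact
  have \<theta>U: "\<theta> x \<in> U" if "x \<in> V" for x using \<theta>(2) that by auto
  have d\<theta>: "\<theta> differentiable (at x)" if "x \<in> V" for x by (rule smooth_on_differentiable[OF \<theta>(1) that])
  have l\<theta>: "linear (dd \<theta> x)" if "x \<in> V" for x using smooth_on_linear_dd[OF \<theta>(1) that] by simp
  have d\<sigma>: "dd (\<lambda>x. \<sigma> (\<theta> x)) x u = dd \<sigma> (\<theta> x) (dd \<theta> x u)" if "x \<in> V" for x u
    by (rule dd_compose[OF d\<theta>[OF that] smooth_on_differentiable[OF smooth_sigma \<theta>U[OF that]]])
  have d\<xi>: "dd (\<lambda>x. \<xi> (\<theta> x)) x u = dd \<xi> (\<theta> x) (dd \<theta> x u)" if "x \<in> V" for x u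
    by (rule dd_compose[OF d\<theta>[OF that] smooth_on_differentiable[OF smooth_xi \<theta>U[OF that]]])
  have sc: "smooth_on V (\<lambda>x. g (\<theta> x))" if "smooth_on U g" for g :: "'a \<Rightarrow> 'e::euclidean_space"
    by (rule smooth_on_compose[OF V U \<theta>(2,1) that])
  have sdd: "smooth_on V (\<lambda>x. dd \<theta> x u)" for u by (rule smooth_on_dd[OF \<theta>(1)])
  have bil: "bilinear (h x)" if "x \<in> U" for x using h[OF that] by (simp add: sym_bilinear_def)
  have N: "dd \<theta> x (N A x u v) = A (\<theta> x) (dd \<theta> x u) (dd \<theta> x v) + dd (\<lambda>y. dd \<theta> y v) x u"
    if "x \<in> V" for A x u v
    unfolding N_def using \<theta>(3)[OF that] by (simp add: bij_is_surj surj_f_inv_f)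
  have N_sym: "sym_bilinear (N A x)" if "x \<in> V" "\<And>x. x \<in> U \<Longrightarrow> sym_bilinear (A x)" for A x
  proof -
    have cm: "dd (\<lambda>y. dd \<theta> y v) x u = dd (\<lambda>y. dd \<theta> y u) x v" for u v
      by (rule dd_commute[OF V that(1) \<theta>(1)])
    have s: "N A x u v = N A x v u" for u v
      unfolding N_def using sym_bilinear_commute[OF that(2)[OF \<theta>U[OF that(1)]]] cm by metis
    have "linear (\<lambda>u. N A x u v)" for v
    proof -
      have i: "linear (inv (dd \<theta> x))"
        by (rule linear_inv_bij[OF l\<theta>[OF that(1)] \<theta>(3)[OF that(1)]])
      have "linear (\<lambda>u. dd (\<lambda>y. dd \<theta> y v) x u)" by (rule smooth_on_linear_dd[OF sdd that(1)])
      moreover have "linear (\<lambda>u. A (\<theta> x) (dd \<theta> x u) (dd \<theta> x v))"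
        using linear_compose[OF l\<theta>[OF that(1)] sym_bilinear_linear(2)[OF that(2)[OF \<theta>U[OF that(1)]]]]
        by (simp add: o_def)
      ultimately have "linear (\<lambda>u. A (\<theta> x) (dd \<theta> x u) (dd \<theta> x v) + dd (\<lambda>y. dd \<theta> y v) x u)"
        by (intro linear_compose_add)
      from linear_compose[OF this i] show ?thesis by (simp add: N_def o_def)
    qed
    then show ?thesis using s unfolding sym_bilinear_def bilinear_def by simp
  qed
  show ?thesis
  proof
    show "open V" by (rule V)
    show "smooth_on V (\<lambda>x. \<sigma> (\<theta> x))" "smooth_on V (\<lambda>x. \<xi> (\<theta> x))"
      by (rule sc smooth_sigma smooth_xi)+
    show "smooth_on V (\<lambda>x. h (\<theta> x) (dd \<theta> x u) (dd \<theta> x v))" for u v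
      by (rule smooth_on_family2[OF V _ _ sdd sdd]) (auto intro: bil \<theta>U sc smooth_h)
    fix x assume x: "x \<in> V"
    note lx = l\<theta>[OF x] and hl = sym_bilinearD[OF h[OF \<theta>U[OF x]]]
    have dd\<sigma>: "dd (\<lambda>x. \<sigma> (\<theta> x)) x = (\<lambda>u. dd \<sigma> (\<theta> x) (dd \<theta> x u))" using d\<sigma>[OF x] by blast
    show "inj (dd (\<lambda>x. \<sigma> (\<theta> x)) x)"
      using inj_compose[OF immersion[OF \<theta>U[OF x]] bij_is_inj[OF \<theta>(3)[OF x]]] unfolding dd\<sigma>
      by (simp add: o_def)
    show "\<xi> (\<theta> x) \<notin> range (dd (\<lambda>x. \<sigma> (\<theta> x)) x)"
      using transversal[OF \<theta>U[OF x]] unfolding dd\<sigma> by blast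
    show "sym_bilinear (\<lambda>u v. h (\<theta> x) (dd \<theta> x u) (dd \<theta> x v))"
      unfolding sym_bilinear_def bilinear_def linear_iff
      using sym_bilinear_commute[OF h[OF \<theta>U[OF x]]]
      by (simp add: linear_add[OF lx] linear_cmul[OF lx] hl)
    show "sym_bilinear (N \<Gamma> x)" "sym_bilinear (N G x)" using N_sym[OF x] \<Gamma> G by blast+
    show "u = 0" if "\<And>v. h (\<theta> x) (dd \<theta> x u) (dd \<theta> x v) = 0" for u
    proof -
      have "h (\<theta> x) (dd \<theta> x u) v = 0" for v
        using that \<theta>(3)[OF x] by (metis bij_pointE)
      then have "dd \<theta> x u = dd \<theta> x 0" using nondegenerate[OF \<theta>U[OF x]] by (simp add: linear_0[OF lx])
      then show ?thesis using bij_is_inj[OF \<theta>(3)[OF x]] by (auto dest: injD)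
    qed
    show "dd (\<lambda>x. \<xi> (\<theta> x)) x u = - H *\<^sub>R dd (\<lambda>x. \<sigma> (\<theta> x)) x u" for u
      by (simp add: d\<sigma> d\<xi> x weingarten \<theta>U)
    fix u v
    have "dd (\<lambda>y. dd (\<lambda>x. \<sigma> (\<theta> x)) y v) x u = dd (\<lambda>y. dd \<sigma> (\<theta> y) (dd \<theta> y v)) x u"
      by (rule dd_cong[OF V x]) (auto intro: smooth_on_differentiable[OF _ x] smooth_on_dd sc smooth_sigma d\<sigma>)
    also have "\<dots> = dd (\<lambda>y. dd \<sigma> (\<theta> y) (dd \<theta> x v)) x u + dd \<sigma> (\<theta> x) (dd (\<lambda>y. dd \<theta> y v) x u)"
      by (rule dd_family[OF V x linear_sigma[OF \<theta>U] sc[OF smooth_on_dd[OF smooth_sigma]] sdd])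
    also have "dd (\<lambda>y. dd \<sigma> (\<theta> y) (dd \<theta> x v)) x u = dd (\<lambda>y. dd \<sigma> y (dd \<theta> x v)) (\<theta> x) (dd \<theta> x u)"
      by (rule dd_compose[OF d\<theta>[OF x] smooth_on_differentiable[OF smooth_on_dd[OF smooth_sigma] \<theta>U[OF x]]])
    finally show "dd (\<lambda>y. dd (\<lambda>x. \<sigma> (\<theta> x)) y v) x u =
      dd (\<lambda>x. \<sigma> (\<theta> x)) x (N \<Gamma> x u v) + h (\<theta> x) (dd \<theta> x u) (dd \<theta> x v) *\<^sub>R \<xi> (\<theta> x)"
      by (simp add: gauss[OF \<theta>U[OF x]] d\<sigma>[OF x] N[OF x] linear_add[OF linear_sigma[OF \<theta>U[OF x]]])
    fix w
    have "dd (\<lambda>y. h (\<theta> y) (dd \<theta> y v) (dd \<theta> y w)) x u =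
      dd (\<lambda>y. h (\<theta> y) (dd \<theta> x v) (dd \<theta> x w)) x u + h (\<theta> x) (dd (\<lambda>y. dd \<theta> y v) x u) (dd \<theta> x w)
      + h (\<theta> x) (dd \<theta> x v) (dd (\<lambda>y. dd \<theta> y w) x u)"
      by (rule dd_family2[OF V x _ _ sdd sdd]) (auto intro: bil \<theta>U sc smooth_h)
    also have "dd (\<lambda>y. h (\<theta> y) (dd \<theta> x v) (dd \<theta> x w)) x u =
        dd (\<lambda>y. h y (dd \<theta> x v) (dd \<theta> x w)) (\<theta> x) (dd \<theta> x u)"
      by (rule dd_compose[OF d\<theta>[OF x] smooth_on_differentiable[OF smooth_h \<theta>U[OF x]]])
    finally show "dd (\<lambda>y. h (\<theta> y) (dd \<theta> y v) (dd \<theta> y w)) x u =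
      h (\<theta> x) (dd \<theta> x (N G x u v)) (dd \<theta> x w) + h (\<theta> x) (dd \<theta> x v) (dd \<theta> x (N G x u w))"
      by (simp add: metric[OF \<theta>U[OF x]] N[OF x] hl)
  qed
qed

section \<open>Frame and Gram matrices, and the Gauss structure of an affine sphere\<close>

lemma bilinear_linear_compose:
  "bilinear f \<Longrightarrow> linear g \<Longrightarrow> bilinear (\<lambda>u v. g (f u v))"
  by (simp add: bilinear_def linear_iff)

lemma det_nonzeroI:
  fixes A :: "real^'n^'n"
  assumes "\<And>y. A *v y = 0 \<Longrightarrow> y = 0" shows "det A \<noteq> 0"
proof -
  have "inj ((*v) A)"
    unfolding linear_injective_0[OF matrix_vector_mul_linear] using assms by blast
  then show ?thesis
    using det_nz_iff_inj[OF matrix_vector_mul_linear[of A]] by simp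
qed

lemma matrix_inv_vector:
  fixes A :: "real^'n^'n"
  assumes "det A \<noteq> 0" shows "A *v (matrix_inv A *v y) = y"
proof -
  have "\<exists>B. A ** B = mat 1 \<and> B ** A = mat 1"
    using assms invertible_det_nz[of A] by (simp add: invertible_def)
  then have "A ** matrix_inv A = mat 1" unfolding matrix_inv_def by (rule someI2_ex) blast
  then show ?thesis by (simp add: matrix_vector_mul_assoc)
qed

lemma linear_axis_expand:
  fixes f :: "real^'n \<Rightarrow> 'b::real_vector"
  assumes "linear f" shows "f z = (\<Sum>k\<in>UNIV. z $ k *\<^sub>R f (axis k 1))"
proof -
  have "f z = f (\<Sum>k\<in>UNIV. z $ k *\<^sub>R axis k 1)"
    using basis_expansion[of z] by (simp add: scalar_mult_eq_scaleR)
  then show ?thesis using assms by (simp add: linear_sum linear_cmul)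
qed

text \<open>Multiplication by the frame matrix assembles a vector from its tangential and
  transversal coordinates, so inverting the matrix yields the Gauss decomposition.\<close>

lemma frame_matrix_mult:
  fixes \<sigma> :: "real^'n \<Rightarrow> real^'k"
  assumes "bij b" "linear (dd \<sigma> x)"
  shows "frame_matrix b \<sigma> \<xi> x *v y =
    dd \<sigma> x (\<chi> k. y $ inv b (Some k)) + y $ inv b None *\<^sub>R \<xi> x"
proof -
  let ?g = "\<lambda>m. case m of None \<Rightarrow> \<xi> x | Some k \<Rightarrow> dd \<sigma> x (axis k 1)"
  have e2: "frame_matrix b \<sigma> \<xi> x *v y = (\<Sum>j\<in>UNIV. y $ j *\<^sub>R ?g (b j))"
    by (auto simp: vec_eq_iff matrix_vector_mult_def frame_matrix_def mult.commute
        intro!: sum.cong split: option.split)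
  have e3: "(\<Sum>j\<in>UNIV. y $ j *\<^sub>R ?g (b j)) = (\<Sum>m\<in>UNIV. y $ inv b m *\<^sub>R ?g m)"
    by (rule sum.reindex_bij_witness[of _ "inv b" b])
      (use assms(1) in \<open>auto simp: bij_is_surj surj_f_inv_f bij_is_inj\<close>)
  have e4: "(\<Sum>m\<in>UNIV. f m) = f None + (\<Sum>k\<in>UNIV. f (Some k))" for f :: "'n option \<Rightarrow> real^'k"
  proof -
    have "(\<Sum>m\<in>UNIV. f m) = f None + (\<Sum>m\<in>range Some. f m)"
      unfolding UNIV_option_conv by (rule sum.insert) auto
    then show ?thesis by (simp add: sum.reindex)
  qed
  show ?thesis
    unfolding e2 e3 e4 linear_axis_expand[OF assms(2), of "\<chi> k. y $ inv b (Some k)"] by (simp add: add.commute)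
qed

lemma frame_matrix_det:
  assumes "bij b" and l: "linear (dd \<sigma> x)" and "inj (dd \<sigma> x)" "\<xi> x \<notin> range (dd \<sigma> x)"
  shows "det (frame_matrix b \<sigma> \<xi> x) \<noteq> 0"
proof -
  have "y = 0" if "frame_matrix b \<sigma> \<xi> x *v y = 0" for y
  proof -
    let ?w = "\<chi> k. y $ inv b (Some k)" and ?r = "y $ inv b None"
    have e: "dd \<sigma> x ?w + ?r *\<^sub>R \<xi> x = 0" using that frame_matrix_mult[OF assms(1) l] by simp
    have r: "?r = 0"
    proof (rule ccontr)
      assume r: "?r \<noteq> 0"
      have "\<xi> x = inverse ?r *\<^sub>R (?r *\<^sub>R \<xi> x)" using r by simp
      also have "?r *\<^sub>R \<xi> x = - dd \<sigma> x ?w" using e by (metis add_eq_0_iff)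
      also have "inverse ?r *\<^sub>R (- dd \<sigma> x ?w) = dd \<sigma> x (inverse ?r *\<^sub>R (- ?w))"
        by (simp only: linear_neg[OF l] linear_cmul[OF l])
      finally show False using assms(4) by blast
    qed
    then have "dd \<sigma> x ?w = dd \<sigma> x 0" using e by (simp add: linear_0[OF l])
    then have w: "?w = 0" by (simp add: inj_eq[OF assms(3)])
    show "y = 0"
    proof (rule vec_eq_iff[THEN iffD2], rule allI)
      fix j
      show "y $ j = 0 $ j"
      proof (cases "b j")
        case None
        then have "inv b None = j" using assms(1) by (metis bij_inv_eq_iff)
        then show ?thesis using r by simp
      next
        case (Some k)
        then have "inv b (Some k) = j" using assms(1) by (metis bij_inv_eq_iff)
        then show ?thesis using w by (metis vec_lambda_beta zero_index)
      qed
    qed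
  qed
  then show ?thesis by (rule det_nonzeroI)
qed

lemma sym_bilinear_expand:
  fixes h :: "real^'n \<Rightarrow> real^'n \<Rightarrow> real"
  assumes "sym_bilinear h" shows "h v z = (\<Sum>k\<in>UNIV. v $ k * h (axis k 1) z)"
  using linear_axis_expand[OF sym_bilinear_linear(2)[OF assms, of z], of v] by simp

lemma gram_matrix_mult:
  assumes h: "sym_bilinear h" shows "(gram_matrix h *v z) $ k = h (axis k 1) z"
  unfolding sym_bilinear_commute[OF h, of _ z] sym_bilinear_expand[OF h, of z]
  by (simp add: gram_matrix_def matrix_vector_mult_def mult.commute sym_bilinear_commute[OF h, of "axis k 1"])

lemma gram_matrix_det:
  assumes h: "sym_bilinear h" and nd: "\<And>u. (\<And>v. h u v = 0) \<Longrightarrow> u = 0"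
  shows "det (gram_matrix h) \<noteq> 0"
proof (rule det_nonzeroI)
  fix z assume z: "gram_matrix h *v z = 0"
  show "z = 0"
  proof (rule nd)
    fix v
    have "h (axis k 1) z = 0" for k using gram_matrix_mult[OF h, of z k] z by simp
    then show "h z v = 0"
      unfolding sym_bilinear_commute[OF h, of z] sym_bilinear_expand[OF h, of v] by simp
  qed
qed

text \<open>The Gauss formula is a linear system for the frame matrix, the Koszul formula one for
  the Gram matrix. Both matrices are smooth and invertible, so Cramer's rule makes all coefficients
  smooth.\<close>

lemma affine_sphere_on_gauss_structure:
  fixes \<sigma> :: "real^'n \<Rightarrow> real^'k"
  assumes as: "affine_sphere_on D \<sigma> \<xi> H" and D: "open D"
  obtains h \<Gamma> G where "gauss_structure D \<sigma> \<xi> h \<Gamma> G H"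
    "\<And>u v. smooth_on D (\<lambda>x. \<Gamma> x u v)" "\<And>u v. smooth_on D (\<lambda>x. G x u v)"
proof (cases "D = {}")
  \<comment> \<open>A numbering of the columns, and with it the relation between the two dimensions,
    is available only at a point of the domain. On the empty domain the zero tensors serve.\<close>
  case True
  show thesis
    by (rule that[of "\<lambda>_ _ _. 0" "\<lambda>_ _ _. 0" "\<lambda>_ _ _. 0"], unfold_locales)
      (auto simp: True smooth_on_def intro!: C_k_on_subset[OF C_k_on_const[OF open_UNIV]]
        C_k_on_local)
next
  case False
  have bl: "blaschke_immersion D \<sigma> \<xi>" using as by (simp add: affine_sphere_on_def)
  then have sm: "smooth_on D \<sigma>" "smooth_on D \<xi>"
    and inj: "\<And>x. x \<in> D \<Longrightarrow> inj (dd \<sigma> x)" and tr: "\<And>x. x \<in> D \<Longrightarrow> \<xi> x \<notin> range (dd \<sigma> x)"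
    and nd: "\<And>x u. x \<in> D \<Longrightarrow> u \<noteq> 0 \<Longrightarrow> \<exists>v. affine_metric \<sigma> \<xi> x u v \<noteq> 0"
    and rg: "\<And>x. x \<in> D \<Longrightarrow> range (dd \<xi> x) \<subseteq> range (dd \<sigma> x)"
    by (auto simp: blaschke_immersion_def)
  obtain b :: "'k \<Rightarrow> 'n option" where b: "bij b"
    using bl False unfolding blaschke_immersion_def by blast
  have lin: "linear (dd \<sigma> x)" if "x \<in> D" for x using smooth_on_linear_dd[OF sm(1) that] by simp
  define F where "F x = frame_matrix b \<sigma> \<xi> x" for x
  have Fm: "F x *v y = dd \<sigma> x (\<chi> k. y $ inv b (Some k)) + y $ inv b None *\<^sub>R \<xi> x" if "x \<in> D" for x y
    unfolding F_def by (rule frame_matrix_mult[OF b lin[OF that]])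
  have Fdet: "det (F x) \<noteq> 0" if "x \<in> D" for x
    unfolding F_def by (intro frame_matrix_det b lin inj tr that)
  have Fs: "smooth_on D (\<lambda>x. F x $ i $ j)" for i j
    unfolding F_def frame_matrix_def
    by (cases "b j") (simp_all add: smooth_on_nth[OF D sm(2)] smooth_on_nth[OF D smooth_on_dd[OF sm(1)]])
  \<comment> \<open>Coordinates of the second derivative in the moving frame: the entry at
    \<open>None\<close> becomes h, the others become \<Gamma>.\<close>
  define Y where "Y x u v = matrix_inv (F x) *v dd (\<lambda>y. dd \<sigma> y v) x u" for x u v
  have FY: "F x *v Y x u v = dd (\<lambda>y. dd \<sigma> y v) x u" if "x \<in> D" for x u v
    using Fdet[OF that] unfolding Y_def
    by (simp add: matrix_inv_vector)
  have Ys: "smooth_on D (\<lambda>x. Y x u v)" for u v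
    by (rule smooth_on_solve[OF D Fs smooth_on_dd[OF smooth_on_dd[OF sm(1)]] Fdet FY])
  have Ysym: "sym_bilinear (Y x)" if x: "x \<in> D" for x
  proof -
    have c: "dd (\<lambda>y. dd \<sigma> y v) x u = dd (\<lambda>y. dd \<sigma> y u) x v" for u v by (rule dd_commute[OF D x sm(1)])
    have l: "linear (\<lambda>u. dd (\<lambda>y. dd \<sigma> y v) x u)" for v
      by (rule smooth_on_linear_dd[OF smooth_on_dd[OF sm(1)] x])
    have "(\<lambda>v. dd (\<lambda>y. dd \<sigma> y v) x u) = (\<lambda>v. dd (\<lambda>y. dd \<sigma> y u) x v)" for u
      by (rule ext) (rule c)
    then have "bilinear (\<lambda>u v. dd (\<lambda>y. dd \<sigma> y v) x u)"
      unfolding bilinear_def using l by simp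
    from bilinear_linear_compose[OF this matrix_vector_mul_linear[of "matrix_inv (F x)"]]
    have "bilinear (Y x)" by (simp add: Y_def[abs_def])
    moreover have "Y x u v = Y x v u" for u v unfolding Y_def c[of v u] ..
    ultimately show ?thesis unfolding sym_bilinear_def by blast
  qed
  define h where "h x u v = Y x u v $ inv b None" for x u v
  define \<Gamma> where "\<Gamma> x u v = (\<chi> k. Y x u v $ inv b (Some k))" for x u v
  have hsb: "sym_bilinear (h x)" if x: "x \<in> D" for x
  proof -
    have "bilinear (h x)"
      using bilinear_linear_compose[of "Y x" "\<lambda>y. y $ inv b None"] Ysym[OF x]
      unfolding h_def sym_bilinear_def by (simp add: linear_iff)
    then show ?thesis using sym_bilinear_commute[OF Ysym[OF x]] by (simp add: sym_bilinear_def h_def)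
  qed
  have \<Gamma>sb: "sym_bilinear (\<Gamma> x)" if x: "x \<in> D" for x
  proof -
    have "bilinear (\<Gamma> x)"
      using bilinear_linear_compose[of "Y x" "\<lambda>y. \<chi> k. y $ inv b (Some k)"] Ysym[OF x]
      unfolding \<Gamma>_def sym_bilinear_def by (simp add: linear_iff vec_eq_iff)
    then show ?thesis using sym_bilinear_commute[OF Ysym[OF x]] by (simp add: sym_bilinear_def \<Gamma>_def)
  qed
  have hs: "smooth_on D (\<lambda>x. h x u v)" for u v
    unfolding h_def by (rule smooth_on_nth[OF D Ys])
  have \<Gamma>s: "smooth_on D (\<lambda>x. \<Gamma> x u v)" for u v
    unfolding \<Gamma>_def by (rule smooth_on_vec[OF D]) (simp add: smooth_on_nth[OF D Ys])
  have gauss: "dd (\<lambda>y. dd \<sigma> y v) x u = dd \<sigma> x (\<Gamma> x u v) + h x u v *\<^sub>R \<xi> x" if "x \<in> D" for x u v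
    unfolding h_def \<Gamma>_def using FY[OF that, of u v] Fm[OF that, of "Y x u v"] by simp
  have uniq: "w = w' \<and> r = r'"
    if "x \<in> D" "dd \<sigma> x w + r *\<^sub>R \<xi> x = dd \<sigma> x w' + r' *\<^sub>R \<xi> x" for x w w' r r'
    using inj_transversal_unique[OF lin[OF that(1)] inj[OF that(1)] tr[OF that(1)] that(2)] .
  have am: "affine_metric \<sigma> \<xi> x u v = h x u v" if x: "x \<in> D" for x u v
    unfolding affine_metric_def gauss[OF x]
    by (rule the_equality) (use uniq[OF x] in blast)+
  have nondeg: "u = 0" if "x \<in> D" "\<And>v. h x u v = 0" for x u
    using nd[OF that(1), of u] that am[OF that(1)] by auto
  have wein: "dd \<xi> x u = - H *\<^sub>R dd \<sigma> x u" if x: "x \<in> D" for x u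
  proof -
    obtain w where "dd \<xi> x u = dd \<sigma> x w" using rg[OF x] by blast
    then have w: "dd \<xi> x u = - dd \<sigma> x (- w)" by (simp add: linear_neg[OF lin[OF x]])
    have "shape_operator \<sigma> \<xi> x u = - w"
      unfolding shape_operator_def w
      by (rule the_equality) (use inj[OF x] in \<open>auto dest: injD\<close>)
    then have "- w = H *\<^sub>R u" using as x by (simp add: affine_sphere_on_def)
    then show ?thesis using w by (simp add: linear_cmul[OF lin[OF x]])
  qed
  define gm where "gm x = gram_matrix (h x)" for x
  have gmm: "(gm x *v z) $ k = h x (axis k 1) z" if x: "x \<in> D" for x z k
    unfolding gm_def by (rule gram_matrix_mult[OF hsb[OF x]])
  have gdet: "det (gm x) \<noteq> 0" if x: "x \<in> D" for x
    unfolding gm_def by (rule gram_matrix_det[OF hsb[OF x] nondeg[OF x]])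
  \<comment> \<open>The Koszul formula for constant fields, whose brackets vanish.\<close>
  define koszul where "koszul x u v w =
    (dd (\<lambda>y. h y v w) x u + dd (\<lambda>y. h y u w) x v - dd (\<lambda>y. h y u v) x w) / 2" for x u v w
  define G where "G x u v = matrix_inv (gm x) *v (\<chi> k. koszul x u v (axis k 1))" for x u v
  have gG: "gm x *v G x u v = (\<chi> k. koszul x u v (axis k 1))" if "x \<in> D" for x u v
    using gdet[OF that] unfolding G_def
    by (simp add: matrix_inv_vector)
  have koszul_s: "smooth_on D (\<lambda>x. koszul x u v w)" for u v w
    unfolding koszul_def
    using smooth_on_mult[OF D smooth_on_const[OF D, of "1/2"] smooth_on_diff[OF D smooth_on_add[OF D
            smooth_on_dd[OF hs] smooth_on_dd[OF hs]] smooth_on_dd[OF hs]]]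
    by simp
  have Gs: "smooth_on D (\<lambda>x. G x u v)" for u v
  proof (rule smooth_on_solve[OF D _ _ gdet gG])
    show "smooth_on D (\<lambda>x. gm x $ i $ j)" for i j by (simp add: gm_def gram_matrix_def hs)
    show "smooth_on D (\<lambda>x. \<chi> k. koszul x u v (axis k 1))" by (rule smooth_on_vec[OF D]) (simp add: koszul_s)
  qed
  have dhl: "linear (\<lambda>v. dd (\<lambda>y. h y v w) x u)" "linear (\<lambda>v. dd (\<lambda>y. h y w v) x u)"
    "linear (\<lambda>u. dd (\<lambda>y. h y v w) x u)" if x: "x \<in> D" for x u v w
    by (rule linear_dd_family[OF D x _ hs] smooth_on_linear_dd[OF hs x],
        (erule sym_bilinear_linear[OF hsb])?)+
  have dhs: "dd (\<lambda>y. h y v w) x u = dd (\<lambda>y. h y w v) x u" if x: "x \<in> D" for x u v w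
    by (rule dd_cong[OF D x smooth_on_differentiable[OF hs x]]) (rule sym_bilinear_commute[OF hsb])
  have kl: "linear (koszul x u v)" "linear (\<lambda>u. koszul x u v w)" "koszul x u v w = koszul x v u w"
    if x: "x \<in> D" for x u v w
    using dhl[OF x] dhs[OF x]
    by (auto simp: koszul_def linear_iff field_simps)
  have hG: "h x (G x u v) w = koszul x u v w" if x: "x \<in> D" for x u v w
  proof -
    have k: "h x (axis k 1) (G x u v) = koszul x u v (axis k 1)" for k
      using gmm[OF x, of "G x u v" k] gG[OF x] by simp
    have "h x w (G x u v) = (\<Sum>j\<in>UNIV. w $ j * koszul x u v (axis j 1))"
      unfolding sym_bilinear_expand[OF hsb[OF x], of w] k ..
    also have "\<dots> = koszul x u v (\<Sum>j\<in>UNIV. w $ j *\<^sub>R axis j 1)"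
      using kl(1)[OF x, of u v] by (simp add: linear_sum linear_cmul)
    also have "\<dots> = koszul x u v w"
      using basis_expansion[of w] by (simp add: scalar_mult_eq_scaleR)
    finally show ?thesis using sym_bilinear_commute[OF hsb[OF x]] by simp
  qed
  have Gsb: "sym_bilinear (G x)" if x: "x \<in> D" for x
  proof -
    have s: "G x u v = G x v u" for u v unfolding G_def using kl(3)[OF x] by simp
    have "linear (\<lambda>u. (\<chi> k. koszul x u v (axis k 1)))" for v
      using kl(2)[OF x] by (simp add: linear_iff vec_eq_iff)
    from linear_compose[OF this matrix_vector_mul_linear[of "matrix_inv (gm x)"]]
    have "linear (\<lambda>u. G x u v)" for v by (simp add: G_def o_def)
    then show ?thesis unfolding sym_bilinear_def bilinear_def using s by simp
  qed
  show thesis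
  proof (rule that[of h \<Gamma> G])
    show "gauss_structure D \<sigma> \<xi> h \<Gamma> G H"
    proof
      show "dd (\<lambda>y. h y v w) x u = h x (G x u v) w + h x v (G x u w)" if x: "x \<in> D" for x u v w
        unfolding hG[OF x] sym_bilinear_commute[OF hsb[OF x], of v] koszul_def
        using dhs[OF x, of v w u] dhs[OF x, of u w v] dhs[OF x, of u v w] by (simp add: field_simps)
    qed (use D sm inj tr hs hsb nondeg \<Gamma>sb Gsb gauss wein in blast)+
  qed (rule \<Gamma>s Gs)+
qed

section \<open>Affine spheres with pointwise symmetry\<close>

lemma canonical_frame_K_T:
  fixes h :: "'a::euclidean_space \<Rightarrow> 'a \<Rightarrow> real"
  assumes h: "sym_bilinear h" and K: "sym_bilinear K" and c: "canonical_frame h K b a6 T V W"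
    and d: "DIM('a) = 3"
  shows "K T u = b *\<^sub>R u + (3 * b * h T u) *\<^sub>R T"
proof -
  note fr = canonical_frame_lorentz[OF c]
  have k: "K T T = (- 2 * b) *\<^sub>R T" "K T V = b *\<^sub>R V" "K T W = b *\<^sub>R W"
    and f: "h T T = -1" "h T V = 0" "h T W = 0"
    using c unfolding canonical_frame_def by auto
  obtain u0 u1 u2 where u: "u = u0 *\<^sub>R T + u1 *\<^sub>R V + u2 *\<^sub>R W"
    by (rule that[OF lorentz_frame_expand[OF h fr d]])
  show ?thesis
    unfolding u sym_bilinearD[OF K] k sym_bilinearD[OF h] f
    by (simp add: algebra_simps) (simp flip: scaleR_add_left)
qed

text \<open>The total symmetry of the cubic form is already visible in the canonical form, so it
  does not have to be derived from a Codazzi equation for h.\<close>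

lemma canonical_frame_cubic_symmetric:
  fixes h :: "'a::euclidean_space \<Rightarrow> 'a \<Rightarrow> real"
  assumes h: "sym_bilinear h" and K: "sym_bilinear K" and c: "canonical_frame h K b a6 T V W"
    and d: "DIM('a) = 3"
  shows "h (K u v) w = h (K u w) v"
proof -
  note fr = canonical_frame_lorentz[OF c]
  have f: "h T T = -1" "h V V = 1" "h W W = 1" "h T V = 0" "h T W = 0" "h V W = 0"
    "h V T = 0" "h W T = 0" "h W V = 0"
    using fr sym_bilinear_commute[OF h] unfolding lorentz_frame_def by metis+
  have k: "K T T = (- 2 * b) *\<^sub>R T" "K T V = b *\<^sub>R V" "K T W = b *\<^sub>R W" "K V T = b *\<^sub>R V" "K W T = b *\<^sub>R W"
     "K V V = (- b) *\<^sub>R T + a6 *\<^sub>R V" "K V W = (- a6) *\<^sub>R W" "K W V = (- a6) *\<^sub>R W"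
     "K W W = (- b) *\<^sub>R T - a6 *\<^sub>R V"
    using c sym_bilinear_commute[OF K] unfolding canonical_frame_def by metis+
  obtain u0 u1 u2 where u: "u = u0 *\<^sub>R T + u1 *\<^sub>R V + u2 *\<^sub>R W"
    by (rule that[OF lorentz_frame_expand[OF h fr d]])
  obtain v0 v1 v2 where v: "v = v0 *\<^sub>R T + v1 *\<^sub>R V + v2 *\<^sub>R W"
    by (rule that[OF lorentz_frame_expand[OF h fr d]])
  obtain w0 w1 w2 where w: "w = w0 *\<^sub>R T + w1 *\<^sub>R V + w2 *\<^sub>R W"
    by (rule that[OF lorentz_frame_expand[OF h fr d]])
  show ?thesis
    unfolding u v w sym_bilinearD[OF K] k sym_bilinearD[OF h] f by (simp add: algebra_simps)
qed

text \<open>The symmetry types form a disjunction over the whole domain, not pointwise: the proof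
  that b is stationary orthogonal to T differs for the two, and in the second type it argues on an
  open set.\<close>

locale symmetric_sphere = gauss_structure U \<sigma> \<xi> h \<Gamma> G H
  for U :: "(real^3) set" and \<sigma> \<xi> :: "real^3 \<Rightarrow> real^4"
    and h :: "real^3 \<Rightarrow> real^3 \<Rightarrow> real^3 \<Rightarrow> real" and \<Gamma> G :: "real^3 \<Rightarrow> real^3 \<Rightarrow> real^3 \<Rightarrow> real^3" and H :: real +
  assumes smooth_Gamma: "\<And>u v. smooth_on U (\<lambda>x. \<Gamma> x u v)"
    and smooth_G: "\<And>u v. smooth_on U (\<lambda>x. G x u v)"
    and H: "H \<noteq> 0"
    and symmetry: "(\<forall>x\<in>U. \<exists>T V W a4 a6. a4 > 0 \<and> a6 > 0 \<and>
        canonical_frame (affine_metric \<sigma> \<xi> x) (difference_tensor \<sigma> \<xi> x) a4 a6 T V W)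
      \<or> (\<forall>x\<in>U. \<exists>T V W a4 a6. a4 > 0 \<and> a6 = 0 \<and>
        canonical_frame (affine_metric \<sigma> \<xi> x) (difference_tensor \<sigma> \<xi> x) a4 a6 T V W)"
    and H_eq: "\<And>x. x \<in> U \<Longrightarrow> H = (coeff_a22 \<sigma> \<xi> x)\<^sup>2 - (coeff_a4 \<sigma> \<xi> x)\<^sup>2"
begin

definition K :: "real^3 \<Rightarrow> real^3 \<Rightarrow> real^3 \<Rightarrow> real^3" where "K x u v = \<Gamma> x u v - G x u v"

abbreviation "T \<equiv> field_T \<sigma> \<xi>"
abbreviation "b \<equiv> coeff_a4 \<sigma> \<xi>"
abbreviation "\<tau> x v \<equiv> h x (T x) v"

lemma K_eq: "x \<in> U \<Longrightarrow> difference_tensor \<sigma> \<xi> x = K x"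
  by (intro ext) (simp add: difference_tensor_eq K_def)

lemma K: "x \<in> U \<Longrightarrow> sym_bilinear (K x)"
proof -
  assume x: "x \<in> U"
  show ?thesis
    using sym_bilinear_commute[OF \<Gamma>[OF x]] sym_bilinear_commute[OF G[OF x]]
    unfolding sym_bilinear_def bilinear_def linear_iff K_def
    by (simp add: sym_bilinearD[OF \<Gamma>[OF x]] sym_bilinearD[OF G[OF x]] algebra_simps)
qed

lemma smooth_K: "smooth_on U (\<lambda>x. K x u v)"
  unfolding K_def by (rule smooth_on_diff[OF U smooth_Gamma smooth_G])

lemma symmetry': "x \<in> U \<Longrightarrow> \<exists>T V W a4 a6. a4 > 0 \<and> a6 \<ge> 0 \<and> canonical_frame (h x) (K x) a4 a6 T V W"
  using symmetry by (auto simp: affine_metric_eq K_eq) (metis less_imp_le, metis order_refl)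

text \<open>By uniqueness both descriptions can be evaluated on any canonical frame at hand.\<close>

lemma canonical_T:
  assumes x: "x \<in> U" and c: "canonical_frame (h x) (K x) a4 a6 t V W" "a4 > 0" "a6 \<ge> 0"
  shows "T x = t" "b x = a4"
  unfolding field_T_def coeff_a4_def affine_metric_eq[OF x] K_eq[OF x]
  using c canonical_unique[OF h[OF x] K[OF x] _ _ _ c]
  by (intro the_equality; blast)+

lemma frame:
  assumes x: "x \<in> U"
  obtains V W a6 where "a6 \<ge> 0" "b x > 0" "canonical_frame (h x) (K x) (b x) a6 (T x) V W"
proof -
  obtain t V W a4 a6 where c: "a4 > 0" "a6 \<ge> 0" "canonical_frame (h x) (K x) a4 a6 t V W"
    using symmetry'[OF x] by blast
  then show thesis using that canonical_T[OF x c(3,1,2)] by blast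
qed

lemma b_pos: "x \<in> U \<Longrightarrow> b x > 0"
  by (rule frame) auto

lemma T_T: "x \<in> U \<Longrightarrow> \<tau> x (T x) = -1"
  by (rule frame[of x]) (auto simp: canonical_frame_def)

lemma K_T: "x \<in> U \<Longrightarrow> K x (T x) u = b x *\<^sub>R u + (3 * b x * \<tau> x u) *\<^sub>R T x"
  by (rule frame[of x], assumption) (rule canonical_frame_K_T[OF h K], auto)

lemma cubic_symmetric: "x \<in> U \<Longrightarrow> h x (K x u v) w = h x (K x u w) v"
  by (rule frame[of x], assumption) (rule canonical_frame_cubic_symmetric[OF h K], auto)

lemma bilinear_h: "x \<in> U \<Longrightarrow> bilinear (h x)"
  using h by (simp add: sym_bilinear_def)

lemma bilinear_K: "x \<in> U \<Longrightarrow> bilinear (K x)"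
  using K by (simp add: sym_bilinear_def)

text \<open>The trace form of \<open>K\<close> is \<open>\<mu> h + \<nu> \<tau> \<otimes> \<tau>\<close>, and \<open>\<mu>\<close>, \<open>\<nu>\<close> are smooth functions of the traces of
  the associated operator and of its square; this makes \<open>a\<^sub>4\<close> and \<open>T\<close> smooth.\<close>

lemma smooth_b: "smooth_on U b" and smooth_T: "smooth_on U T"
proof -
  define gm where "gm x = gram_matrix (h x)" for x
  have gdet: "det (gm x) \<noteq> 0" if x: "x \<in> U" for x
    unfolding gm_def by (rule gram_matrix_det[OF h[OF x] nondegenerate[OF x]])
  have gs: "smooth_on U (\<lambda>x. gm x $ i $ j)" for i j by (simp add: gm_def gram_matrix_def smooth_h)
  let ?c = "\<lambda>x. contraction_form (K x)"
  have lc: "linear (\<lambda>u. ?c x u v)" if x: "x \<in> U" for x v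
  proof -
    have "linear (\<lambda>u. \<Sum>i\<in>UNIV. K x u (K x v (axis i 1)) $ i)"
      by (rule linear_compose_sum) (simp add: linear_iff sym_bilinearD[OF K[OF x]])
    then show ?thesis by (simp add: contraction_form_def trace_def matrix_def)
  qed
  have cs: "smooth_on U (\<lambda>x. ?c x u v)" for u v
  proof -
    have "smooth_on U (\<lambda>x. K x u (K x v e))" for e
      by (rule smooth_on_family[OF U _ smooth_K smooth_K]) (rule sym_bilinear_linear[OF K])
    then have "smooth_on U (\<lambda>x. \<Sum>i\<in>UNIV. K x u (K x v (axis i 1)) $ i)"
      by (intro smooth_on_sum smooth_on_nth U)
    then show ?thesis by (simp add: contraction_form_def trace_def matrix_def)
  qed
  define P where "P x u = matrix_inv (gm x) *v (\<chi> k. ?c x u (axis k 1))" for x u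
  have gP: "gm x *v P x u = (\<chi> k. ?c x u (axis k 1))" if "x \<in> U" for x u
    unfolding P_def by (rule matrix_inv_vector[OF gdet[OF that]])
  have Ps: "smooth_on U (\<lambda>x. P x u)" for u
    by (rule smooth_on_solve[OF U gs _ gdet gP]) (rule smooth_on_vec[OF U], simp add: cs)
  have Pl: "linear (P x)" if x: "x \<in> U" for x
  proof -
    have "linear (\<lambda>u. \<chi> k. ?c x u (axis k 1))"
      using lc[OF x] by (simp add: linear_iff vec_eq_iff)
    from linear_compose[OF this matrix_vector_mul_linear[of "matrix_inv (gm x)"]]
    show ?thesis by (simp add: P_def[abs_def] o_def)
  qed
  have hP: "h x (P x u) v = ?c x u v" if x: "x \<in> U" for x u v
  proof -
    have k: "h x (axis k 1) (P x u) = ?c x u (axis k 1)" for k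
      using gram_matrix_mult[OF h[OF x], of "P x u" k] gP[OF x] by (simp add: gm_def)
    obtain V W a6 where c: "canonical_frame (h x) (K x) (b x) a6 (T x) V W" by (rule frame[OF x])
    have sym: "?c x u v = ?c x v u" for u v
      unfolding contraction_form_canonical[OF h[OF x] K[OF x] c] sym_bilinear_commute[OF h[OF x], of u v]
      by simp
    have "h x v (P x u) = (\<Sum>k\<in>UNIV. v $ k * ?c x (axis k 1) u)"
      unfolding sym_bilinear_expand[OF h[OF x], of v] k sym[of u] ..
    also have "\<dots> = ?c x (\<Sum>k\<in>UNIV. v $ k *\<^sub>R axis k 1) u"
      using lc[OF x, of u] by (simp add: linear_sum[where f = "\<lambda>v. ?c x v u"] linear_iff)
    also have "\<dots> = ?c x v u"
      using basis_expansion[of v] by (simp add: scalar_mult_eq_scaleR)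
    finally show ?thesis using sym sym_bilinear_commute[OF h[OF x]] by metis
  qed
  define N where "N x = sqrt (3/2 * (trace (matrix (\<lambda>u. P x (P x u))) - (trace (matrix (P x)))\<^sup>2 / 3))" for x
  define m where "m x = (trace (matrix (P x)) + N x) / 3" for x
  have inv: "N x = 4 * (b x)\<^sup>2 + 2 * a6\<^sup>2" "m x = 2 * a6\<^sup>2 - 2 * (b x)\<^sup>2"
    if "x \<in> U" "canonical_frame (h x) (K x) (b x) a6 (T x) V W" for x V W a6
    unfolding m_def N_def
    using canonical_invariants[OF h[OF that(1)] K[OF that(1)] that(2) Pl[OF that(1)] hP[OF that(1)]] by auto
  have N_pos: "N x > 0" if x: "x \<in> U" for x
    by (rule frame[OF x]) (simp add: inv[OF x] add_pos_nonneg)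
  have tr1: "smooth_on U (\<lambda>x. trace (matrix (P x)))"
    unfolding trace_def matrix_def using smooth_on_sum[OF U smooth_on_nth[OF U Ps]] by simp
  have tr2: "smooth_on U (\<lambda>x. trace (matrix (\<lambda>u. P x (P x u))))"
    unfolding trace_def matrix_def
    using smooth_on_sum[OF U smooth_on_nth[OF U smooth_on_family[OF U Pl Ps Ps]]] by simp
  have Ns: "smooth_on U N"
    unfolding N_def[abs_def]
  proof (rule smooth_on_sqrt[OF U])
    have "smooth_on U (\<lambda>x. (3/2) * (trace (matrix (\<lambda>u. P x (P x u)))
      + (-1/3) * (trace (matrix (P x)) * trace (matrix (P x)))))"
      by (intro smooth_on_mult smooth_on_add smooth_on_const U tr1 tr2)
    then show "smooth_on U (\<lambda>x. 3/2 * (trace (matrix (\<lambda>u. P x (P x u))) - (trace (matrix (P x)))\<^sup>2 / 3))"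
      by (simp add: power2_eq_square)
    show "3/2 * (trace (matrix (\<lambda>u. P x (P x u))) - (trace (matrix (P x)))\<^sup>2 / 3) > 0" if "x \<in> U" for x
      using N_pos[OF that] unfolding N_def by simp
  qed
  have ms: "smooth_on U m"
    unfolding m_def[abs_def]
    using smooth_on_mult[OF U smooth_on_const[OF U, of "1/3"] smooth_on_add[OF U tr1 Ns]] by simp
  \<comment> \<open>The combination that eliminates a6: (4 b^2 + 2 a6^2) - (2 a6^2 - 2 b^2) = 6
    b^2.\<close>
  have bsq: "(N x - m x) / 6 = (b x)\<^sup>2" if x: "x \<in> U" for x
    by (rule frame[OF x]) (simp add: inv[OF x])
  have bs: "smooth_on U (\<lambda>x. sqrt ((N x - m x) / 6))"
  proof (rule smooth_on_sqrt[OF U])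
    show "smooth_on U (\<lambda>x. (N x - m x) / 6)"
      using smooth_on_mult[OF U smooth_on_const[OF U, of "1/6"] smooth_on_diff[OF U Ns ms]] by simp
    show "(N x - m x) / 6 > 0" if "x \<in> U" for x
      unfolding bsq[OF that] using b_pos[OF that] by simp
  qed
  show sb: "smooth_on U b"
    by (rule smooth_on_cong[OF bs U]) (simp only: bsq, simp add: b_pos less_imp_le)
  \<comment> \<open>Isolates \<tau>(u) \<tau>(v), a smooth quantity that still determines T only up
    to sign.\<close>
  define R where "R x u v = (?c x u v - m x * h x u v) / N x" for x u v
  have R: "R x u v = \<tau> x u * \<tau> x v" if x: "x \<in> U" for x u v
  proof -
    obtain V W a6 where c: "canonical_frame (h x) (K x) (b x) a6 (T x) V W" by (rule frame[OF x])
    show ?thesis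
      unfolding R_def contraction_form_canonical[OF h[OF x] K[OF x] c] inv[OF x c]
      using N_pos[OF x] unfolding inv[OF x c] by simp
  qed
  have Rs: "smooth_on U (\<lambda>x. R x u v)" for u v
    unfolding R_def
    by (intro smooth_on_divide smooth_on_diff smooth_on_mult U cs ms smooth_h Ns)
      (simp add: N_pos less_imp_neq[symmetric])
  have Xs: "smooth_on U (\<lambda>x. \<tau> x u *\<^sub>R T x)" for u
  proof (rule smooth_on_solve[OF U gs _ gdet])
    show "smooth_on U (\<lambda>x. \<chi> k. R x u (axis k 1))" by (rule smooth_on_vec[OF U]) (simp add: Rs)
    show "gm x *v (\<tau> x u *\<^sub>R T x) = (\<chi> k. R x u (axis k 1))" if x: "x \<in> U" for x
      unfolding vec_eq_iff gm_def
      by (simp add: gram_matrix_mult[OF h[OF x]] sym_bilinearD[OF h[OF x]] R[OF x]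
          sym_bilinear_commute[OF h[OF x], of "axis _ _"])
  qed
  show "smooth_on U T"
  proof (rule smooth_on_local)
    fix x0 assume x0: "x0 \<in> U"
    define u where "u = T x0"
    define O' where "O' = {x \<in> U. R x u u \<noteq> 0}"
    have O: "open O'"
      unfolding O'_def using continuous_open_preimage[OF smooth_on_continuous[OF Rs] U, of "-{0}" u u]
      by (simp add: vimage_def Int_def open_Compl)
    have OU: "O' \<subseteq> U" by (auto simp: O'_def)
    have x0O: "x0 \<in> O'" using x0 R[OF x0] T_T[OF x0] by (simp add: O'_def u_def)
    have KX: "smooth_on O' (\<lambda>x. K x (\<tau> x u *\<^sub>R T x) (\<tau> x u *\<^sub>R T x))"
      by (rule smooth_on_subset[OF smooth_on_family2[OF U bilinear_K smooth_K Xs Xs] OU])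
    \<comment> \<open>For X = \<tau>(u) T one has K(X, X) = -2 b \<tau>(u)^2 T, in which the sign of
      T is no longer ambiguous. Since u is the value of T at \<open>x0\<close>, the denominator does
      not vanish on the neighbourhood \<open>O'\<close>.\<close>
    have "smooth_on O' (\<lambda>x. (1 / ((-2) * b x * R x u u)) *\<^sub>R K x (\<tau> x u *\<^sub>R T x) (\<tau> x u *\<^sub>R T x))"
    proof (intro smooth_on_scaleR smooth_on_divide O KX smooth_on_const)
      show "smooth_on O' (\<lambda>x. -2 * b x * R x u u)"
        by (intro smooth_on_mult smooth_on_const O smooth_on_subset[OF sb OU] smooth_on_subset[OF Rs OU])
      show "-2 * b x * R x u u \<noteq> 0" if "x \<in> O'" for x
        using that b_pos[of x] by (simp add: O'_def)
    qed
    moreover have "(1 / ((-2) * b x * R x u u)) *\<^sub>R K x (\<tau> x u *\<^sub>R T x) (\<tau> x u *\<^sub>R T x) = T x" if x: "x \<in> O'" for x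
    proof -
      have xU: "x \<in> U" using x OU by auto
      have "K x (\<tau> x u *\<^sub>R T x) (\<tau> x u *\<^sub>R T x) = (R x u u * (-2 * b x)) *\<^sub>R T x"
        unfolding sym_bilinearD[OF K[OF xU]] K_T[OF xU] T_T[OF xU] R[OF xU]
        by (simp add: algebra_simps) (simp flip: scaleR_add_left)
      then show ?thesis using x b_pos[OF xU] by (simp add: O'_def)
    qed
    ultimately have "smooth_on O' T" using smooth_on_cong[OF _ O] by blast
    then show "\<exists>V. open V \<and> x0 \<in> V \<and> smooth_on V T" using O x0O by blast
  qed
qed

end

section \<open>Gauss and Codazzi equations\<close>

context symmetric_sphere
begin

abbreviation "dh x z v w \<equiv> dd (\<lambda>y. h y v w) x z"
abbreviation "d\<Gamma> x z v w \<equiv> dd (\<lambda>y. \<Gamma> y v w) x z"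

lemma smooth_tau: "smooth_on U (\<lambda>x. \<tau> x v)"
  by (rule smooth_on_family2[OF U bilinear_h smooth_h smooth_T smooth_on_const[OF U]])

text \<open>The tangential part of the symmetry of second derivatives, applied to the image of w. It
  is the Gauss equation R(z, v) w = H (h(v, w) z - h(z, w) v), written out for constant
  fields.\<close>

lemma ricci_identity:
  assumes x: "x \<in> U"
  shows "\<Gamma> x z (\<Gamma> x v w) + d\<Gamma> x z v w - (H * h x v w) *\<^sub>R z =
    \<Gamma> x v (\<Gamma> x z w) + d\<Gamma> x v z w - (H * h x z w) *\<^sub>R v"
proof -
  note l = linear_sigma[OF x]
  let ?f = "\<lambda>y. dd \<sigma> y w"
  have f: "smooth_on U ?f" by (rule smooth_on_dd[OF smooth_sigma])
  have e: "dd (\<lambda>y. dd ?f y v) x z =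
    dd \<sigma> x (\<Gamma> x z (\<Gamma> x v w) + d\<Gamma> x z v w - (H * h x v w) *\<^sub>R z)
      + (h x z (\<Gamma> x v w) + dh x z v w) *\<^sub>R \<xi> x" for v z
  proof -
    have s1: "smooth_on U (\<lambda>y. dd \<sigma> y (\<Gamma> y v w))"
      by (rule smooth_on_family[OF U linear_sigma smooth_on_dd[OF smooth_sigma] smooth_Gamma])
    have s2: "smooth_on U (\<lambda>y. h y v w *\<^sub>R \<xi> y)"
      by (rule smooth_on_scaleR[OF U smooth_h smooth_xi])
    have "dd (\<lambda>y. dd ?f y v) x z = dd (\<lambda>y. dd \<sigma> y (\<Gamma> y v w) + h y v w *\<^sub>R \<xi> y) x z"
      by (rule dd_cong[OF U x smooth_on_differentiable[OF smooth_on_dd[OF f] x]]) (rule gauss)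
    also have "\<dots> = dd (\<lambda>y. dd \<sigma> y (\<Gamma> y v w)) x z + dd (\<lambda>y. h y v w *\<^sub>R \<xi> y) x z"
      by (rule dd_eq[OF has_derivative_add[OF smooth_on_has_derivative[OF s1 x]
              smooth_on_has_derivative[OF s2 x]]])
    also have "dd (\<lambda>y. dd \<sigma> y (\<Gamma> y v w)) x z = dd (\<lambda>y. dd \<sigma> y (\<Gamma> x v w)) x z + dd \<sigma> x (d\<Gamma> x z v w)"
      by (rule dd_family[OF U x linear_sigma smooth_on_dd[OF smooth_sigma] smooth_Gamma])
    also have "dd (\<lambda>y. h y v w *\<^sub>R \<xi> y) x z = h x v w *\<^sub>R dd \<xi> x z + dh x z v w *\<^sub>R \<xi> x"
      by (rule dd_eq[OF has_derivative_scaleR[OF smooth_on_has_derivative[OF smooth_h x]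
              smooth_on_has_derivative[OF smooth_xi x]]])
    finally show ?thesis
      by (simp add: gauss[OF x] weingarten[OF x] linear_add[OF l] linear_diff[OF l] linear_cmul[OF l]
          algebra_simps)
  qed
  have "dd (\<lambda>y. dd ?f y v) x z = dd (\<lambda>y. dd ?f y z) x v" by (rule dd_commute[OF U x f])
  from tangent_transversal_unique[OF x this[unfolded e]] show ?thesis by blast
qed

text \<open>The cubic form \<open>C = \<nabla>h\<close>.\<close>

definition C :: "real^3 \<Rightarrow> real^3 \<Rightarrow> real^3 \<Rightarrow> real^3 \<Rightarrow> real" where
  "C x u v w = dh x u v w - h x (\<Gamma> x u v) w - h x v (\<Gamma> x u w)"

lemma C_eq: assumes x: "x \<in> U" shows "C x u v w = -2 * h x (K x u v) w"
  using cubic_symmetric[OF x, of u v w]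
  unfolding C_def metric[OF x] K_def sym_bilinearD[OF h[OF x]]
  using sym_bilinear_commute[OF h[OF x], of v] by simp

lemma smooth_C: "smooth_on U (\<lambda>x. C x u v w)"
  unfolding C_def
  by (intro smooth_on_diff U smooth_on_dd smooth_h smooth_on_family2[OF U bilinear_h smooth_h]
      smooth_Gamma smooth_on_const)

text \<open>Commuting the second derivatives of h leaves the curvature acting on h, namely h(R(z, u)
  v, w) + h(v, R(z, u) w), and for S = H Id this vanishes by the Gauss equation. The terms
  C(\<Gamma>(z, u), v, w) agree on both sides of the covariant equation and are left out.\<close>

lemma codazzi:
  assumes x: "x \<in> U"
  shows "dd (\<lambda>y. C y u v w) x z - C x u (\<Gamma> x z v) w - C x u v (\<Gamma> x z w) =
    dd (\<lambda>y. C y z v w) x u - C x z (\<Gamma> x u v) w - C x z v (\<Gamma> x u w)"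
proof -
  note hl = sym_bilinearD[OF h[OF x]] and hc = sym_bilinear_commute[OF h[OF x]]
  have d: "dd (\<lambda>y. C y u v w) x z = dd (\<lambda>y. dh y u v w) x z
    - (dh x z (\<Gamma> x u v) w + h x (d\<Gamma> x z u v) w) - (dh x z v (\<Gamma> x u w) + h x v (d\<Gamma> x z u w))" for u z
  proof -
    have s1: "smooth_on U (\<lambda>y. dh y u v w)" by (rule smooth_on_dd[OF smooth_h])
    have s2: "smooth_on U (\<lambda>y. h y (\<Gamma> y u v) w)"
      by (rule smooth_on_family2[OF U bilinear_h smooth_h smooth_Gamma smooth_on_const[OF U]])
    have s3: "smooth_on U (\<lambda>y. h y v (\<Gamma> y u w))"
      by (rule smooth_on_family2[OF U bilinear_h smooth_h smooth_on_const[OF U] smooth_Gamma])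
    have "dd (\<lambda>y. C y u v w) x z =
      dd (\<lambda>y. dh y u v w) x z - dd (\<lambda>y. h y (\<Gamma> y u v) w) x z - dd (\<lambda>y. h y v (\<Gamma> y u w)) x z"
      unfolding C_def
      by (rule dd_eq[OF has_derivative_diff[OF has_derivative_diff[OF smooth_on_has_derivative[OF s1 x]
                smooth_on_has_derivative[OF s2 x]] smooth_on_has_derivative[OF s3 x]]])
    moreover have "dd (\<lambda>y. h y (\<Gamma> y u v) w) x z = dh x z (\<Gamma> x u v) w + h x (d\<Gamma> x z u v) w"
      by (rule dd_family[where f = "\<lambda>y u. h y u w", OF U x _ smooth_h smooth_Gamma])
        (rule sym_bilinear_linear[OF h])
    moreover have "dd (\<lambda>y. h y v (\<Gamma> y u w)) x z = dh x z v (\<Gamma> x u w) + h x v (d\<Gamma> x z u w)"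
      by (rule dd_family[where f = "\<lambda>y. h y v", OF U x _ smooth_h smooth_Gamma])
        (rule sym_bilinear_linear[OF h])
    ultimately show ?thesis by simp
  qed
  have c: "dd (\<lambda>y. dh y u v w) x z = dd (\<lambda>y. dh y z v w) x u"
    by (rule dd_commute_real[OF U x smooth_h])
  have "h x (d\<Gamma> x z u v) w + h x (\<Gamma> x z (\<Gamma> x u v)) w - H * h x u v * h x z w =
    h x (d\<Gamma> x u z v) w + h x (\<Gamma> x u (\<Gamma> x z v)) w - H * h x z v * h x u w"
    using arg_cong[OF ricci_identity[OF x, of z u v], of "\<lambda>y. h x y w"] unfolding hl by simp
  moreover have "h x v (d\<Gamma> x z u w) + h x v (\<Gamma> x z (\<Gamma> x u w)) - H * h x z v * h x u w =
    h x v (d\<Gamma> x u z w) + h x v (\<Gamma> x u (\<Gamma> x z w)) - H * h x u v * h x z w"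
    using arg_cong[OF ricci_identity[OF x, of z u w], of "\<lambda>y. h x v y"]
    unfolding hl hc[of z v] hc[of u v] by (simp add: algebra_simps)
  moreover note hc[of "\<Gamma> x z v" "\<Gamma> x u w"] hc[of "\<Gamma> x u v" "\<Gamma> x z w"]
  ultimately show ?thesis unfolding d c unfolding C_def by linarith
qed

text \<open>\<open>A x z\<close> is the Levi-Civita derivative of \<open>T\<close> in direction \<open>z\<close>.\<close>

definition A :: "real^3 \<Rightarrow> real^3 \<Rightarrow> real^3" where "A x z = dd T x z + G x z (T x)"

lemma A_eq: "levi_civita_deriv (affine_metric \<sigma> \<xi>) x z T = A x z" if "x \<in> U"
  by (simp add: levi_civita_deriv_def levi_civita_eq[OF that] A_def)

lemma dd_T: "x \<in> U \<Longrightarrow> dd T x z = A x z + K x z (T x) - \<Gamma> x z (T x)"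
  by (simp add: A_def K_def)

lemma linear_A: "x \<in> U \<Longrightarrow> linear (A x)"
  unfolding A_def[abs_def]
  by (intro linear_compose_add smooth_on_linear_dd[OF smooth_T] sym_bilinear_linear(2)[OF G])

text \<open>The induced connection is not metric: the derivative of h is C = -2 h(K, .), and the
  derivative of T is A z + K(z, T). Hence the covariant derivative of \<tau> is h(A z - K(z, T),
  v).\<close>

lemma dd_tau:
  assumes x: "x \<in> U"
  shows "dd (\<lambda>y. \<tau> y v) x z = \<tau> x (\<Gamma> x z v) + h x (A x z) v
    - b x * h x z v - 3 * b x * \<tau> x z * \<tau> x v"
proof -
  note hl = sym_bilinearD[OF h[OF x]] and hc = sym_bilinear_commute[OF h[OF x]]
  have "dd (\<lambda>y. \<tau> y v) x z = dh x z (T x) v + h x (dd T x z) v"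
    by (rule dd_family[where f = "\<lambda>y u. h y u v", OF U x _ smooth_h smooth_T])
      (rule sym_bilinear_linear[OF h])
  moreover have "dh x z (T x) v = C x z (T x) v + h x (\<Gamma> x z (T x)) v + \<tau> x (\<Gamma> x z v)"
    by (simp add: C_def)
  moreover have "C x z (T x) v = - 2 * (b x * h x z v + 3 * b x * \<tau> x z * \<tau> x v)"
    unfolding C_eq[OF x] sym_bilinear_commute[OF K[OF x], of z] K_T[OF x] hl by simp
  moreover have "h x (K x z (T x)) v = b x * h x z v + 3 * b x * \<tau> x z * \<tau> x v"
    unfolding sym_bilinear_commute[OF K[OF x], of z] K_T[OF x] hl by simp
  ultimately show ?thesis unfolding dd_T[OF x] hl by (simp add: algebra_simps)
qed

lemma A_T: assumes x: "x \<in> U" shows "h x (A x z) (T x) = 0"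
proof -
  note hl = sym_bilinearD[OF h[OF x]] and hc = sym_bilinear_commute[OF h[OF x]]
  have "dd (\<lambda>y. \<tau> y (T y)) x z = dd (\<lambda>y. -1) x z"
    by (rule dd_cong[OF U x _ T_T])
      (rule smooth_on_differentiable[OF smooth_on_family2[OF U bilinear_h smooth_h smooth_T smooth_T] x])
  also have "\<dots> = 0" by (rule dd_eq[OF has_derivative_const])
  finally have 0: "dd (\<lambda>y. \<tau> y (T y)) x z = 0" .
  have "dd (\<lambda>y. \<tau> y (T y)) x z = dd (\<lambda>y. \<tau> y (T x)) x z + \<tau> x (dd T x z)"
    by (rule dd_family[OF U x _ smooth_tau smooth_T]) (rule sym_bilinear_linear[OF h])
  also have "\<tau> x (dd T x z) = \<tau> x (A x z) + \<tau> x (K x z (T x)) - \<tau> x (\<Gamma> x z (T x))"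
    unfolding dd_T[OF x] hl ..
  also have "\<tau> x (K x z (T x)) = -2 * b x * \<tau> x z"
    unfolding sym_bilinear_commute[OF K[OF x], of z] K_T[OF x] hl T_T[OF x] by simp
  finally show ?thesis
    unfolding 0 dd_tau[OF x] T_T[OF x] hc[of z] using hc[of "T x" "A x z"] by simp
qed

lemma K_K_T:
  assumes x: "x \<in> U" shows "h x (K x u v) (T x) = b x * h x u v + 3 * b x * \<tau> x u * \<tau> x v"
  unfolding cubic_symmetric[OF x, of u v "T x"] sym_bilinear_commute[OF K[OF x], of u "T x"] K_T[OF x]
    sym_bilinearD[OF h[OF x]] by simp

text \<open>With D the Levi-Civita connection this is (D_z C)(u, v, T), expanded by means of C(u, v,
  T) = -2 b h(u, v) - 6 b \<tau>(u) \<tau>(v).\<close>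

definition E :: "real^3 \<Rightarrow> real^3 \<Rightarrow> real^3 \<Rightarrow> real^3 \<Rightarrow> real" where
  "E x z u v = - 2 * dd b x z * h x u v - 6 * dd b x z * \<tau> x u * \<tau> x v
    - 6 * b x * h x (A x z) u * \<tau> x v - 6 * b x * \<tau> x u * h x (A x z) v + 2 * h x (K x u v) (A x z)"

text \<open>The Codazzi equation for \<open>K\<close> with \<open>T\<close> in the last slot.\<close>

lemma codazzi_T: assumes x: "x \<in> U" shows "E x z u v = E x u z v"
proof -
  note hl = sym_bilinearD[OF h[OF x]] and hc = sym_bilinear_commute[OF h[OF x]]
  note kc = sym_bilinear_commute[OF K[OF x]] and gc = sym_bilinear_commute[OF \<Gamma>[OF x]]
  have CT: "C y u v (T y) = - 2 * (b y * h y u v) - 6 * (b y * (\<tau> y u * \<tau> y v))" if y: "y \<in> U" for y u v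
    unfolding C_eq[OF y] K_K_T[OF y] by simp
  have lC: "linear (C y u v)" if y: "y \<in> U" for y u v
    unfolding C_eq[OF y, abs_def] linear_iff sym_bilinearD[OF h[OF y]] by (simp add: algebra_simps)
  have dC: "dd (\<lambda>y. C y u v (T x)) x z + C x u v (dd T x z) =
     - 2 * (b x * dh x z u v + dd b x z * h x u v)
     - 6 * (b x * (\<tau> x u * dd (\<lambda>y. \<tau> y v) x z + dd (\<lambda>y. \<tau> y u) x z * \<tau> x v)
         + dd b x z * (\<tau> x u * \<tau> x v))" for u v z
  proof -
    have sC: "smooth_on U (\<lambda>y. C y u v (T y))"
      by (rule smooth_on_family[OF U lC smooth_C smooth_T])
    note hd = smooth_on_has_derivative[OF smooth_b x] smooth_on_has_derivative[OF smooth_h x]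
      smooth_on_has_derivative[OF smooth_tau x]
    have "dd (\<lambda>y. C y u v (T x)) x z + C x u v (dd T x z) = dd (\<lambda>y. C y u v (T y)) x z"
      by (rule dd_family[OF U x lC smooth_C smooth_T, symmetric])
    also have "\<dots> = dd (\<lambda>y. - 2 * (b y * h y u v) - 6 * (b y * (\<tau> y u * \<tau> y v))) x z"
      by (rule dd_cong[OF U x smooth_on_differentiable[OF sC x] CT])
    also have "\<dots> = - 2 * (b x * dh x z u v + dd b x z * h x u v)
     - 6 * (b x * (\<tau> x u * dd (\<lambda>y. \<tau> y v) x z + dd (\<lambda>y. \<tau> y u) x z * \<tau> x v)
         + dd b x z * (\<tau> x u * \<tau> x v))"
      by (rule dd_eq) (intro has_derivative_diff has_derivative_mult_right has_derivative_mult hd)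
    finally show ?thesis .
  qed
  have Kz: "h x (K x u v) (K x z (T x)) = b x * h x (K x u v) z
      + 3 * b x * \<tau> x z * (b x * h x u v + 3 * b x * \<tau> x u * \<tau> x v)" for u v z
    unfolding kc[of z] K_T[OF x] hl K_K_T[OF x] by simp
  have CA: "C x u v (dd T x z) + C x u v (\<Gamma> x z (T x)) = - 2 * h x (K x u v) (A x z)
     - 2 * (b x * h x (K x u v) z
      + 3 * b x * \<tau> x z * (b x * h x u v + 3 * b x * \<tau> x u * \<tau> x v))" for u v z
    unfolding C_eq[OF x] dd_T[OF x] hl Kz by simp
  have dhz: "dh x z u v = -2 * h x (K x u v) z + h x (\<Gamma> x z u) v + h x u (\<Gamma> x z v)" for u v z
    using C_eq[OF x, of z u v] cubic_symmetric[OF x, of u z v] unfolding C_def kc[of z u] by simp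
  \<comment> \<open>Besides \<open>E\<close> there remain terms quadratic in K and terms in
    \<Gamma>(z, u). Both groups are symmetric in z and u, the former by the total symmetry of the
    cubic form, so they cancel in the Codazzi equation.\<close>
  have F: "dd (\<lambda>y. C y u v (T x)) x z - C x u (\<Gamma> x z v) (T x) - C x u v (\<Gamma> x z (T x)) = 
    E x z u v + (- 2 * b x * (- 2 * h x (K x u v) z + h x (\<Gamma> x z u) v)
    - 6 * b x * (\<tau> x u * (- b x * h x z v - 3 * b x * \<tau> x z * \<tau> x v)
       + (\<tau> x (\<Gamma> x z u) - b x * h x z u - 3 * b x * \<tau> x z * \<tau> x u) * \<tau> x v)
    + 2 * (b x * h x (K x u v) z)
    + 6 * b x * \<tau> x z * (b x * h x u v + 3 * b x * \<tau> x u * \<tau> x v))" for z u v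
    using dC[of u v z] CA[of u v z]
    unfolding CT[OF x] dd_tau[OF x] dhz E_def by (simp add: algebra_simps)
  have "h x (K x u v) z = h x (K x z v) u"
    using cubic_symmetric[OF x, of v u z] kc by metis
  then show ?thesis
    using codazzi[OF x, of u v "T x" z]
    unfolding F gc[of u z] hc[of u z] by (simp add: algebra_simps)
qed

end

section \<open>Solving the Codazzi equations: the closed system for a, b, \<tau> and t\<close>

context symmetric_sphere
begin

definition a22_value :: "real^3 \<Rightarrow> real \<Rightarrow> bool" where
  "a22_value x r \<longleftrightarrow> (\<forall>v. h x v v = 1 \<and> \<tau> x v = 0 \<longrightarrow> h x (A x v) v = r)"

lemma coeff_a22_eq: "x \<in> U \<Longrightarrow> coeff_a22 \<sigma> \<xi> x = The (a22_value x)"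
  unfolding coeff_a22_def a22_value_def by (simp add: affine_metric_eq A_eq)

text \<open>Each equation is the Codazzi equation at one triple of frame vectors. For a6 = 0 the
  triples (V, W, W) and (V, W, V) make b stationary along V and W. For a6 > 0 these triples,
  combined with the other equations, give only (4 b^2 - a6^2) h(A T, V) = 0 and likewise for W,
  which leaves the case a6 = 2 b open.\<close>

lemma A_frame:
  assumes x: "x \<in> U" and c: "canonical_frame (h x) (K x) (b x) a6 (T x) V W"
  shows "dd b x V = - 2 * b x * h x (A x (T x)) V" "dd b x W = - 2 * b x * h x (A x (T x)) W"
    "4 * b x * h x (A x V) V = - dd b x (T x) + a6 * h x (A x (T x)) V"
    "4 * b x * h x (A x W) W = - dd b x (T x) - a6 * h x (A x (T x)) V"
    "4 * b x * h x (A x V) W = - a6 * h x (A x (T x)) W"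
    "4 * b x * h x (A x W) V = - a6 * h x (A x (T x)) W"
    "a6 = 0 \<Longrightarrow> dd b x V = 0" "a6 = 0 \<Longrightarrow> dd b x W = 0"
proof -
  note hl = sym_bilinearD[OF h[OF x]] and hc = sym_bilinear_commute[OF h[OF x]]
  note fr = canonical_frame_lorentz[OF c]
  have f: "\<tau> x (T x) = -1" "h x V V = 1" "h x W W = 1" "\<tau> x V = 0" "\<tau> x W = 0" "h x V W = 0"
    "h x V (T x) = 0" "h x W (T x) = 0" "h x W V = 0"
    using fr sym_bilinear_commute[OF h[OF x]] unfolding lorentz_frame_def by metis+
  have k: "K x V (T x) = b x *\<^sub>R V" "K x W (T x) = b x *\<^sub>R W" "K x (T x) (T x) = (- 2 * b x) *\<^sub>R T x"
     "K x V V = (- b x) *\<^sub>R T x + a6 *\<^sub>R V" "K x V W = (- a6) *\<^sub>R W" "K x W V = (- a6) *\<^sub>R W"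
     "K x W W = (- b x) *\<^sub>R T x - a6 *\<^sub>R V" "K x (T x) V = b x *\<^sub>R V" "K x (T x) W = b x *\<^sub>R W"
    using c sym_bilinear_commute[OF K[OF x]] unfolding canonical_frame_def by metis+
  have AT: "h x (T x) (A x z) = 0" for z using A_T[OF x] hc by metis
  note e = E_def f k hl AT A_T[OF x] hc[of V "A x _"] hc[of W "A x _"]
  show "dd b x V = - 2 * b x * h x (A x (T x)) V"
    using codazzi_T[OF x, of "T x" V "T x"] unfolding e by simp
  show "dd b x W = - 2 * b x * h x (A x (T x)) W"
    using codazzi_T[OF x, of "T x" W "T x"] unfolding e by simp
  show "4 * b x * h x (A x V) V = - dd b x (T x) + a6 * h x (A x (T x)) V"
    using codazzi_T[OF x, of "T x" V V] unfolding e by simp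
  show "4 * b x * h x (A x W) W = - dd b x (T x) - a6 * h x (A x (T x)) V"
    using codazzi_T[OF x, of "T x" W W] unfolding e by simp
  show "4 * b x * h x (A x V) W = - a6 * h x (A x (T x)) W"
    using codazzi_T[OF x, of "T x" V W] unfolding e by simp
  show "4 * b x * h x (A x W) V = - a6 * h x (A x (T x)) W"
    using codazzi_T[OF x, of "T x" W V] unfolding e by simp
  show "dd b x V = 0" if "a6 = 0"
    using codazzi_T[OF x, of V W W] that unfolding e by simp
  show "dd b x W = 0" if "a6 = 0"
    using codazzi_T[OF x, of V W V] that unfolding e by simp
qed

text \<open>If h(A v, v) has the same value at all unit vectors orthogonal to T, the symmetric part
  of A is a multiple of h there. Testing V, W and (V + W) / sqrt 2 kills its trace-free part, which
  by \<open>A_frame\<close> is proportional to a6 h(A T, V) and a6 h(A T, W). As a6 > 0, these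
  vanish, and so do the derivatives of b.\<close>

lemma a22_value_imp_flat:
  assumes x: "x \<in> U" and c: "canonical_frame (h x) (K x) (b x) a6 (T x) V W" "a6 > 0"
    and r: "a22_value x r"
  shows "dd b x V = 0" "dd b x W = 0"
proof -
  note hl = sym_bilinearD[OF h[OF x]] and hc = sym_bilinear_commute[OF h[OF x]]
  note fr = canonical_frame_lorentz[OF c(1)]
  have f: "h x V V = 1" "h x W W = 1" "\<tau> x V = 0" "\<tau> x W = 0" "h x V W = 0" "h x W V = 0"
    using fr sym_bilinear_commute[OF h[OF x]] unfolding lorentz_frame_def by metis+
  note A = A_frame[OF x c(1)]
  note lA = linear_A[OF x]
  have v: "h x (A x V) V = r" "h x (A x W) W = r" using r f unfolding a22_value_def by blast+
  define q where "q = 1 / sqrt 2"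
  have q: "q * q = 1 / 2" by (simp add: q_def)
  let ?z = "q *\<^sub>R V + q *\<^sub>R W"
  have "h x ?z ?z = 1" "\<tau> x ?z = 0" unfolding hl f using q by simp_all
  then have "h x (A x ?z) ?z = r" using r unfolding a22_value_def by blast
  then have "(q * q) * (h x (A x V) V + h x (A x V) W + h x (A x W) V + h x (A x W) W) = r"
    unfolding linear_add[OF lA] linear_cmul[OF lA] hl by (simp add: algebra_simps)
  then have s: "h x (A x V) W + h x (A x W) V = 0" unfolding q v by simp
  have "4 * b x * (h x (A x V) W + h x (A x W) V) = - 2 * a6 * h x (A x (T x)) W"
    using A(5,6) by (simp add: distrib_left)
  then have 1: "h x (A x (T x)) W = 0" unfolding s using c(2) by simp
  have 2: "h x (A x (T x)) V = 0" using A(3,4) c(2) unfolding v by simp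
  show "dd b x V = 0" "dd b x W = 0" using A(1,2) 1 2 by simp_all
qed

text \<open>Where the derivative of \<open>a\<^sub>4\<close> along the orthogonal complement of \<open>T\<close> does not vanish, no value is
  admissible for \<open>a\<^sub>2\<^sub>2\<close> in the \<open>\<int>\<^sub>3\<close> case, so that the description defining \<open>a\<^sub>2\<^sub>2\<close> yields a fixed
  number on an open set. There \<open>H = a\<^sub>2\<^sub>2\<^sup>2 - a\<^sub>4\<^sup>2\<close> makes \<open>a\<^sub>4\<close> constant, a contradiction.\<close>

lemma dd_b: assumes x0: "x0 \<in> U" shows "dd b x0 z = - \<tau> x0 z * dd b x0 (T x0)"
proof -
  \<comment> \<open>The derivative of b along z + \<tau>(z) T, the part of z orthogonal to
    T.\<close>
  define Q where "Q x z = dd b x z + \<tau> x z * dd b x (T x)" for x z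
  have Q_frame: "Q x z = 0" if x: "x \<in> U" and c: "canonical_frame (h x) (K x) (b x) a6 (T x) V W"
    and z: "dd b x V = 0" "dd b x W = 0" for x z a6 V W
  proof -
    have l: "linear (dd b x)" using smooth_on_linear_dd[OF smooth_b x] by simp
    have "dd b x z = dd b x ((- \<tau> x z) *\<^sub>R T x + h x V z *\<^sub>R V + h x W z *\<^sub>R W)"
      using lorentz_frame_expand[OF h[OF x] canonical_frame_lorentz[OF c], of z] by simp
    then show ?thesis unfolding Q_def linear_add[OF l] linear_cmul[OF l] z by simp
  qed
  show ?thesis
    using symmetry
  proof
    assume "\<forall>x\<in>U. \<exists>T V W a4 a6. a4 > 0 \<and> a6 = 0 \<and>
        canonical_frame (affine_metric \<sigma> \<xi> x) (difference_tensor \<sigma> \<xi> x) a4 a6 T V W"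
    then obtain t V W a4 where c: "a4 > 0" "canonical_frame (h x0) (K x0) a4 0 t V W"
      using x0 by (auto simp: affine_metric_eq K_eq)
    with canonical_T[OF x0 c(2,1)] have c: "canonical_frame (h x0) (K x0) (b x0) 0 (T x0) V W" by simp
    have "Q x0 z = 0" by (rule Q_frame[OF x0 c]) (use A_frame[OF x0 c] in auto)
    then show ?thesis by (simp add: Q_def)
  next
    assume Z3: "\<forall>x\<in>U. \<exists>T V W a4 a6. a4 > 0 \<and> a6 > 0 \<and>
        canonical_frame (affine_metric \<sigma> \<xi> x) (difference_tensor \<sigma> \<xi> x) a4 a6 T V W"
    show ?thesis
    proof (rule ccontr)
      assume "\<not> ?thesis"
      then have Q0: "Q x0 z \<noteq> 0" by (simp add: Q_def)
      define O' where "O' = {x \<in> U. Q x z \<noteq> 0}"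
      have sQ: "smooth_on U (\<lambda>x. Q x z)"
        unfolding Q_def
        by (intro smooth_on_add smooth_on_mult U smooth_tau smooth_on_dd[OF smooth_b]
            smooth_on_family[OF U smooth_on_linear_dd[OF smooth_b] smooth_on_dd[OF smooth_b] smooth_T])
      have O: "open O'"
        unfolding O'_def using continuous_open_preimage[OF smooth_on_continuous[OF sQ] U, of "-{0}"]
        by (simp add: vimage_def Int_def open_Compl)
      have xO: "x0 \<in> O'" using x0 Q0 by (simp add: O'_def)
      have no: "a22_value x = (\<lambda>r. False)" if x: "x \<in> O'" for x
      proof (intro ext iffI)
        have xU: "x \<in> U" and Q: "Q x z \<noteq> 0" using x by (auto simp: O'_def)
        fix r assume r: "a22_value x r"
        obtain t V W a4 a6 where c: "a4 > 0" "a6 > 0" "canonical_frame (h x) (K x) a4 a6 t V W"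
          using Z3 xU by (auto simp: affine_metric_eq K_eq)
        with canonical_T[OF xU c(3,1)] have c': "canonical_frame (h x) (K x) (b x) a6 (T x) V W" by simp
        show False
          using Q Q_frame[OF xU c' a22_value_imp_flat[OF xU c' c(2) r], of z] by simp
      qed simp
      define c0 where "c0 = (THE r::real. False)"
      have bO: "b x = sqrt (c0\<^sup>2 - H)" if x: "x \<in> O'" for x
      proof -
        have xU: "x \<in> U" using x by (auto simp: O'_def)
        have "H = c0\<^sup>2 - (b x)\<^sup>2"
          using H_eq[OF xU] unfolding coeff_a22_eq[OF xU] no[OF x] c0_def .
        then have "c0\<^sup>2 - H = (b x)\<^sup>2" by simp
        then show ?thesis using b_pos[OF xU] by simp
      qed
      have "dd b x0 u = 0" for u
      proof -
        have "dd b x0 u = dd (\<lambda>x. sqrt (c0\<^sup>2 - H)) x0 u"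
          by (rule dd_cong[OF O xO smooth_on_differentiable[OF smooth_b x0] bO])
        then show ?thesis by (simp add: dd_eq[OF has_derivative_const])
      qed
      then show False using Q0 by (simp add: Q_def)
    qed
  qed
qed

text \<open>The value of h(A v, v) at unit vectors orthogonal to T, as the Codazzi equations give it
  once A T = 0. Unlike the description of \<open>coeff_a22\<close>, the quotient is evidently
  smooth.\<close>

definition a :: "real^3 \<Rightarrow> real" where "a x = - dd b x (T x) / (4 * b x)"

lemma b_nonzero: "x \<in> U \<Longrightarrow> b x \<noteq> 0"
  using b_pos[of x] by simp

lemma smooth_a: "smooth_on U a"
proof -
  have "smooth_on U (\<lambda>x. (-1) * dd b x (T x) / (4 * b x))"
    by (intro smooth_on_divide smooth_on_mult smooth_on_const U smooth_b
        smooth_on_family[OF U smooth_on_linear_dd[OF smooth_b] smooth_on_dd[OF smooth_b] smooth_T])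
      (simp_all add: b_nonzero)
  then show ?thesis unfolding a_def[abs_def] by simp
qed

lemma dd_b_eq: "x \<in> U \<Longrightarrow> dd b x z = 4 * a x * b x * \<tau> x z"
  using dd_b[of x z] b_pos[of x] by (simp add: a_def)

text \<open>With b stationary orthogonal to T, the frame equations collapse to A T = 0, A V = a V, A
  W = a W: the integral curves of T are geodesics and its complement is umbilical.\<close>

lemma A_eq_a:
  assumes x: "x \<in> U" shows "A x z = a x *\<^sub>R (z + \<tau> x z *\<^sub>R T x)"
proof -
  obtain V W a6 where c: "canonical_frame (h x) (K x) (b x) a6 (T x) V W" by (rule frame[OF x])
  note hl = sym_bilinearD[OF h[OF x]] and hc = sym_bilinear_commute[OF h[OF x]]
  note fr = canonical_frame_lorentz[OF c]
  have f: "\<tau> x (T x) = -1" "h x V V = 1" "h x W W = 1" "\<tau> x V = 0" "\<tau> x W = 0" "h x V W = 0"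
    "h x V (T x) = 0" "h x W (T x) = 0" "h x W V = 0"
    using fr sym_bilinear_commute[OF h[OF x]] unfolding lorentz_frame_def by metis+
  note A = A_frame[OF x c] and lA = linear_A[OF x] and b = b_pos[OF x]
  have d: "dd b x V = 0" "dd b x W = 0" using dd_b[OF x, of V] dd_b[OF x, of W] f by simp_all
  then have T0: "h x V (A x (T x)) = 0" "h x W (A x (T x)) = 0" using A(1,2) b hc by auto
  have bb: "- dd b x (T x) = 4 * b x * a x" using b by (simp add: a_def)
  have "h x V (A x V) = a x" "h x W (A x W) = a x" "h x W (A x V) = 0" "h x V (A x W) = 0"
    using A(3-6) b T0 unfolding bb hc[of V "A x _"] hc[of W "A x _"] by auto
  moreover have "h x (T x) (A x z) = 0" for z using A_T[OF x] hc by metis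
  ultimately have e: "A x (T x) = 0" "A x V = a x *\<^sub>R V" "A x W = a x *\<^sub>R W"
    using lorentz_frame_expand[OF h[OF x] fr, of "A x (T x)"] lorentz_frame_expand[OF h[OF x] fr, of "A x V"]
      lorentz_frame_expand[OF h[OF x] fr, of "A x W"] T0 by simp_all
  obtain u0 u1 u2 where z: "z = u0 *\<^sub>R T x + u1 *\<^sub>R V + u2 *\<^sub>R W"
    by (rule that[OF lorentz_frame_expand[OF h[OF x] fr]]) simp
  show ?thesis
    unfolding z linear_add[OF lA] linear_cmul[OF lA] e hl f by (simp add: algebra_simps)
qed

text \<open>Umbilicity finally gives the description of \<open>coeff_a22\<close> a value, and V,
  being an admissible test vector, makes it unique.\<close>

lemma H_eq': assumes x: "x \<in> U" shows "H = (a x)\<^sup>2 - (b x)\<^sup>2"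
proof -
  note hl = sym_bilinearD[OF h[OF x]] and hc = sym_bilinear_commute[OF h[OF x]]
  obtain V W a6 where c: "canonical_frame (h x) (K x) (b x) a6 (T x) V W" by (rule frame[OF x])
  have V: "h x V V = 1" "\<tau> x V = 0" using c by (auto simp: canonical_frame_def)
  have "a22_value x (a x)"
    unfolding a22_value_def A_eq_a[OF x] hl by simp
  moreover have "r = a x" if "a22_value x r" for r
    using that V calculation unfolding a22_value_def by metis
  ultimately have "coeff_a22 \<sigma> \<xi> x = a x"
    unfolding coeff_a22_eq[OF x] by (rule the_equality)
  then show ?thesis using H_eq[OF x] by simp
qed

lemma a_plus_b: "x \<in> U \<Longrightarrow> a x + b x \<noteq> 0" and a_minus_b: "x \<in> U \<Longrightarrow> a x - b x \<noteq> 0"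
  using H_eq'[of x] H by (auto simp: power2_eq_square square_diff_square_factored)

lemma H_factor: "x \<in> U \<Longrightarrow> H = (a x - b x) * (a x + b x)"
  using H_eq'[of x] by (simp add: power2_eq_square algebra_simps)

lemma dd_tau_eq:
  assumes x: "x \<in> U"
  shows "dd (\<lambda>y. \<tau> y v) x z = \<tau> x (\<Gamma> x z v) + (a x - b x) * h x z v + (a x - 3 * b x) * \<tau> x z * \<tau> x v"
  unfolding dd_tau[OF x] A_eq_a[OF x] sym_bilinearD[OF h[OF x]] by (simp add: algebra_simps)

lemma dd_tau_commute: "x \<in> U \<Longrightarrow> dd (\<lambda>y. \<tau> y v) x z = dd (\<lambda>y. \<tau> y z) x v"
  using sym_bilinear_commute[OF h, of x z v] sym_bilinear_commute[OF \<Gamma>, of x z v]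
  by (simp add: dd_tau_eq)

definition t :: "real^3 \<Rightarrow> real^4" where "t x = dd \<sigma> x (T x)"

lemma smooth_t: "smooth_on U t"
  unfolding t_def[abs_def] by (rule smooth_on_family[OF U linear_sigma smooth_on_dd[OF smooth_sigma] smooth_T])

lemma dd_t:
  assumes x: "x \<in> U"
  shows "dd t x z = (a x + b x) *\<^sub>R dd \<sigma> x z + \<tau> x z *\<^sub>R ((a x + 3 * b x) *\<^sub>R t x + \<xi> x)"
proof -
  note l = linear_sigma[OF x]
  have "dd t x z = dd (\<lambda>y. dd \<sigma> y (T x)) x z + dd \<sigma> x (dd T x z)"
    unfolding t_def[abs_def]
    by (rule dd_family[OF U x linear_sigma smooth_on_dd[OF smooth_sigma] smooth_T])
  also have "\<dots> = dd \<sigma> x (A x z + K x z (T x)) + h x z (T x) *\<^sub>R \<xi> x"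
    unfolding gauss[OF x] dd_T[OF x] linear_diff[OF l] by (simp add: linear_add[OF l])
  also have "A x z + K x z (T x) = (a x + b x) *\<^sub>R z + (\<tau> x z * (a x + 3 * b x)) *\<^sub>R T x"
    unfolding A_eq_a[OF x] sym_bilinear_commute[OF K[OF x], of z] K_T[OF x] by (simp add: algebra_simps)
  also have "dd \<sigma> x ((a x + b x) *\<^sub>R z + (\<tau> x z * (a x + 3 * b x)) *\<^sub>R T x) =
      (a x + b x) *\<^sub>R dd \<sigma> x z + (\<tau> x z * (a x + 3 * b x)) *\<^sub>R t x"
    by (simp only: linear_add[OF l] linear_cmul[OF l] t_def)
  finally show ?thesis
    unfolding sym_bilinear_commute[OF h[OF x], of z] by (simp add: scaleR_add_right)
qed

text \<open>From db = 4 a b \<tau> and the closedness of \<tau>, the symmetry of the second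
  derivative of b says that d(a b) is a multiple of \<tau>; db already is one.\<close>

lemma dd_a_proportional:
  assumes x: "x \<in> U" shows "dd a x z = - dd a x (T x) * \<tau> x z"
proof -
  have sb: "smooth_on U (\<lambda>y. 4 * a y * b y * \<tau> y v)" for v
    by (intro smooth_on_mult smooth_on_const U smooth_a smooth_b smooth_tau)
  have e: "dd (\<lambda>y. dd b y v) x z = 4 * b x * dd a x z * \<tau> x v + 4 * a x * dd b x z * \<tau> x v
    + 4 * a x * b x * dd (\<lambda>y. \<tau> y v) x z" for v z
  proof -
    note hd = smooth_on_has_derivative[OF smooth_b x] smooth_on_has_derivative[OF smooth_a x]
      smooth_on_has_derivative[OF smooth_tau x]
    have "dd (\<lambda>y. dd b y v) x z = dd (\<lambda>y. 4 * a y * b y * \<tau> y v) x z"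
      by (rule dd_cong[OF U x smooth_on_differentiable[OF smooth_on_dd[OF smooth_b] x] dd_b_eq])
    also have "\<dots> = 4 * a x * b x * dd (\<lambda>y. \<tau> y v) x z +
        (4 * a x * dd b x z + 4 * dd a x z * b x) * \<tau> x v"
      by (rule dd_eq) (intro has_derivative_mult_right has_derivative_mult hd)
    finally show ?thesis by (simp add: algebra_simps)
  qed
  have c: "dd (\<lambda>y. dd b y (T x)) x z = dd (\<lambda>y. dd b y z) x (T x)"
    by (rule dd_commute_real[OF U x smooth_b])
  have d: "4 * a x * dd b x z * \<tau> x (T x) = 4 * a x * dd b x (T x) * \<tau> x z"
    unfolding dd_b_eq[OF x, of z] dd_b_eq[OF x, of "T x"] by simp
  have "4 * b x * dd a x z * \<tau> x (T x) = 4 * b x * dd a x (T x) * \<tau> x z"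
    using trans[OF e[where v = "T x" and z = z, symmetric] trans[OF c e[where v = z and z = "T x"]]]
    by (simp only: d dd_tau_commute[OF x, where v = "T x" and z = z] add_right_cancel)
  then have "4 * b x * (dd a x z * \<tau> x (T x)) = 4 * b x * (dd a x (T x) * \<tau> x z)"
    by (simp only: mult.assoc)
  then have "dd a x z * \<tau> x (T x) = dd a x (T x) * \<tau> x z"
    unfolding mult_cancel_left using b_pos[OF x] by linarith
  then show ?thesis unfolding T_T[OF x] by linarith
qed

text \<open>This is the symmetry of the second derivative of \<open>t\<close> in the directions \<open>T\<close> and \<open>V\<close>.\<close>

lemma dd_a_eq:
  assumes x: "x \<in> U" shows "dd a x z = 4 * (b x)\<^sup>2 * \<tau> x z"
proof -
  obtain V W a6 where c: "canonical_frame (h x) (K x) (b x) a6 (T x) V W" by (rule frame[OF x])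
  have V: "h x V V = 1" "\<tau> x V = 0" using c by (auto simp: canonical_frame_def)
  note l = linear_sigma[OF x] and hd = smooth_on_has_derivative[OF smooth_b x]
    smooth_on_has_derivative[OF smooth_a x] smooth_on_has_derivative[OF smooth_tau x]
    smooth_on_has_derivative[OF smooth_t x] smooth_on_has_derivative[OF smooth_xi x]
    smooth_on_has_derivative[OF smooth_on_dd[OF smooth_sigma] x]
  have e: "dd (\<lambda>y. dd t y u) x z =
    ((a x + b x) *\<^sub>R dd (\<lambda>y. dd \<sigma> y u) x z + (dd a x z + dd b x z) *\<^sub>R dd \<sigma> x u) +
    (\<tau> x u *\<^sub>R (((a x + 3 * b x) *\<^sub>R dd t x z + (dd a x z + 3 * dd b x z) *\<^sub>R t x) + dd \<xi> x z)
     + dd (\<lambda>y. \<tau> y u) x z *\<^sub>R ((a x + 3 * b x) *\<^sub>R t x + \<xi> x))" for u z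
  proof -
    have "dd (\<lambda>y. dd t y u) x z =
      dd (\<lambda>y. (a y + b y) *\<^sub>R dd \<sigma> y u + \<tau> y u *\<^sub>R ((a y + 3 * b y) *\<^sub>R t y + \<xi> y)) x z"
      by (rule dd_cong[OF U x smooth_on_differentiable[OF smooth_on_dd[OF smooth_t] x] dd_t])
    also have "\<dots> = ((a x + b x) *\<^sub>R dd (\<lambda>y. dd \<sigma> y u) x z + (dd a x z + dd b x z) *\<^sub>R dd \<sigma> x u) +
      (\<tau> x u *\<^sub>R (((a x + 3 * b x) *\<^sub>R dd t x z + (dd a x z + 3 * dd b x z) *\<^sub>R t x) + dd \<xi> x z)
       + dd (\<lambda>y. \<tau> y u) x z *\<^sub>R ((a x + 3 * b x) *\<^sub>R t x + \<xi> x))"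
      by (rule dd_eq) (intro has_derivative_add has_derivative_scaleR has_derivative_mult_right hd)
    finally show ?thesis .
  qed
  have s: "dd (\<lambda>y. dd \<sigma> y V) x (T x) = dd (\<lambda>y. dd \<sigma> y (T x)) x V"
    by (rule dd_commute[OF U x smooth_sigma])
  have V0: "dd a x V = 0" "dd b x V = 0" "dd t x V = (a x + b x) *\<^sub>R dd \<sigma> x V" "dd \<xi> x V = - H *\<^sub>R dd \<sigma> x V"
    using dd_a_proportional[OF x, of V] dd_b_eq[OF x, of V] dd_t[OF x, of V] weingarten[OF x, of V] V
    by simp_all
  have "dd (\<lambda>y. dd t y V) x (T x) = dd (\<lambda>y. dd t y (T x)) x V" by (rule dd_commute[OF U x smooth_t])
  \<comment> \<open>Comparison of the coefficients at the image of V; the mixed second derivatives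
    of \<sigma> and the derivatives of \<tau> drop out by symmetry.\<close>
  then have "(dd a x (T x) + dd b x (T x)) *\<^sub>R dd \<sigma> x V =
     - ((a x + 3 * b x) *\<^sub>R ((a x + b x) *\<^sub>R dd \<sigma> x V) + - H *\<^sub>R dd \<sigma> x V)"
    unfolding e s V V0 T_T[OF x] dd_tau_commute[OF x, where v = "T x" and z = V] by simp
  also have "\<dots> = - ((a x + 3 * b x) * (a x + b x) - H) *\<^sub>R dd \<sigma> x V"
    by (simp add: scaleR_diff_left)
  finally have "(dd a x (T x) + dd b x (T x)) *\<^sub>R dd \<sigma> x V =
    - ((a x + 3 * b x) * (a x + b x) - H) *\<^sub>R dd \<sigma> x V" .
  then have "dd \<sigma> x ((dd a x (T x) + dd b x (T x) - - ((a x + 3 * b x) * (a x + b x) - H)) *\<^sub>R V) = dd \<sigma> x 0"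
    by (simp only: linear_diff[OF l] linear_cmul[OF l] linear_0[OF l] scaleR_diff_left[of _ _ V] diff_self)
  then have "(dd a x (T x) + dd b x (T x) - - ((a x + 3 * b x) * (a x + b x) - H)) *\<^sub>R V = 0"
    using immersion[OF x] by (simp only: inj_eq)
  moreover have "V \<noteq> 0" using V sym_bilinearD[OF h[OF x]] by auto
  ultimately have "dd a x (T x) = - dd b x (T x) - (a x + 3 * b x) * (a x + b x) + H" by simp
  also have "\<dots> = - 4 * (b x)\<^sup>2"
    unfolding dd_b_eq[OF x] T_T[OF x] H_factor[OF x] by (simp add: power2_eq_square algebra_simps)
  finally show ?thesis using dd_a_proportional[OF x, of z] by simp
qed

end

section \<open>Constant vectors\<close>

lemma has_derivative_exp_left:
  fixes g :: "'a::real_normed_vector \<Rightarrow> real"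
  assumes "(g has_derivative g') (at x)"
  shows "((\<lambda>x. exp (g x)) has_derivative (\<lambda>z. exp (g x) * g' z)) (at x)"
  using has_derivative_exp[OF assms] by (simp add: mult.commute)

lemma has_derivative_ln_left:
  fixes g :: "'a::real_normed_vector \<Rightarrow> real"
  assumes "(g has_derivative g') (at x)" "g x > 0"
  shows "((\<lambda>x. ln (g x)) has_derivative (\<lambda>z. inverse (g x) * g' z)) (at x)"
  using has_derivative_ln[OF assms(2,1)] by (simp add: mult.commute)

lemma exists_bij_option: "\<exists>\<beta> :: 4 \<Rightarrow> 3 option. bij \<beta>"
proof -
  have "card (UNIV :: 4 set) = card (UNIV :: 3 option set)" by simp
  then show ?thesis using finite_same_card_bij[of "UNIV :: 4 set" "UNIV :: 3 option set"] by auto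
qed

context symmetric_sphere
begin

text \<open>The exponentials of \<open>p\<close> and \<open>q\<close> are the integrating factors: \<open>dp = a \<tau>\<close> and \<open>dq = b \<tau>\<close>.\<close>

definition p :: "real^3 \<Rightarrow> real" where "p x = ln (b x) / 4"
definition q :: "real^3 \<Rightarrow> real" where "q x = ln ((a x + b x)\<^sup>2) / 8"

lemma has_derivative_b: "x \<in> U \<Longrightarrow> (b has_derivative (\<lambda>z. 4 * a x * b x * \<tau> x z)) (at x)"
  using smooth_on_has_derivative[OF smooth_b, of x] by (simp add: dd_b_eq)

lemma has_derivative_a: "x \<in> U \<Longrightarrow> (a has_derivative (\<lambda>z. 4 * (b x)\<^sup>2 * \<tau> x z)) (at x)"
  using smooth_on_has_derivative[OF smooth_a, of x] by (simp add: dd_a_eq)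

lemma has_derivative_p: assumes x: "x \<in> U" shows "(p has_derivative (\<lambda>z. a x * \<tau> x z)) (at x)"
proof -
  have "((\<lambda>x. (1/4) * ln (b x)) has_derivative (\<lambda>z. (1/4) * (inverse (b x) * (4 * a x * b x * \<tau> x z)))) (at x)"
    using b_pos[OF x] by (intro has_derivative_mult_right has_derivative_ln_left has_derivative_b x)
  then show ?thesis using b_pos[OF x] by (simp add: p_def[abs_def] field_simps)
qed

text \<open>Here d(a + b) = 4 b (a + b) \<tau>, so a quarter of ln |a + b| is wanted. The square in
  \<open>q\<close> avoids the unknown sign of a + b.\<close>

lemma has_derivative_q: assumes x: "x \<in> U" shows "(q has_derivative (\<lambda>z. b x * \<tau> x z)) (at x)"
proof -
  let ?u = "a x + b x"
  have u: "?u \<noteq> 0" by (rule a_plus_b[OF x])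
  have "((\<lambda>x. (a x + b x) * (a x + b x)) has_derivative (\<lambda>z. ?u * (4 * (b x)\<^sup>2 * \<tau> x z + 4 * a x * b x * \<tau> x z)
     + (4 * (b x)\<^sup>2 * \<tau> x z + 4 * a x * b x * \<tau> x z) * ?u)) (at x)"
    by (intro has_derivative_mult has_derivative_add has_derivative_a has_derivative_b x)
  from has_derivative_ln_left[OF this]
  have "((\<lambda>x. ln ((a x + b x) * (a x + b x))) has_derivative (\<lambda>z. inverse (?u * ?u) * (?u * (4 * (b x)\<^sup>2 * \<tau> x z + 4 * a x * b x * \<tau> x z)
     + (4 * (b x)\<^sup>2 * \<tau> x z + 4 * a x * b x * \<tau> x z) * ?u))) (at x)"
    using u by (simp add: not_square_less_zero order.strict_iff_order)
  moreover have "inverse (?u * ?u) * (?u * (4 * (b x)\<^sup>2 * \<tau> x z + 4 * a x * b x * \<tau> x z)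
     + (4 * (b x)\<^sup>2 * \<tau> x z + 4 * a x * b x * \<tau> x z) * ?u) = 8 * (b x * \<tau> x z)" for z
  proof -
    have k: "?u * (4 * (b x)\<^sup>2 * \<tau> x z + 4 * a x * b x * \<tau> x z)
     + (4 * (b x)\<^sup>2 * \<tau> x z + 4 * a x * b x * \<tau> x z) * ?u = (?u * ?u) * (8 * (b x * \<tau> x z))"
      by (simp add: power2_eq_square algebra_simps)
    have "inverse m * (m * y) = y" if "m \<noteq> 0" for m y :: real using that by simp
    then show ?thesis unfolding k using u by (metis mult_eq_0_iff)
  qed
  ultimately have "((\<lambda>x. ln ((a x + b x) * (a x + b x))) has_derivative (\<lambda>z. 8 * (b x * \<tau> x z))) (at x)"
    by (simp only:)
  from has_derivative_mult_right[OF this, of "1/8"]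
  show ?thesis by (simp add: q_def[abs_def] power2_eq_square)
qed

definition eta :: "real^3 \<Rightarrow> real^4" where "eta x = \<xi> x + (a x - b x) *\<^sub>R t x"

text \<open>The coefficient a - b is made for this cancellation: -H coming from d\<xi> against (a -
  b)(a + b) coming from dt. What remains is a multiple of \<open>eta\<close>.\<close>

lemma has_derivative_eta:
  assumes x: "x \<in> U" shows "(eta has_derivative (\<lambda>z. ((a x - b x) * \<tau> x z) *\<^sub>R eta x)) (at x)"
proof -
  have hx: "(\<xi> has_derivative (\<lambda>z. - H *\<^sub>R dd \<sigma> x z)) (at x)"
    using smooth_on_has_derivative[OF smooth_xi x] by (simp add: weingarten[OF x])
  have ht: "(t has_derivative (\<lambda>z. (a x + b x) *\<^sub>R dd \<sigma> x z + \<tau> x z *\<^sub>R ((a x + 3 * b x) *\<^sub>R t x + \<xi> x))) (at x)"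
    using smooth_on_has_derivative[OF smooth_t x] by (simp add: dd_t[OF x])
  have "(eta has_derivative (\<lambda>z. - H *\<^sub>R dd \<sigma> x z + ((a x - b x) *\<^sub>R ((a x + b x) *\<^sub>R dd \<sigma> x z + \<tau> x z *\<^sub>R ((a x + 3 * b x) *\<^sub>R t x + \<xi> x))
    + (4 * (b x)\<^sup>2 * \<tau> x z - 4 * a x * b x * \<tau> x z) *\<^sub>R t x))) (at x)"
    unfolding eta_def[abs_def]
    by (intro has_derivative_add has_derivative_scaleR has_derivative_diff has_derivative_a has_derivative_b hx ht x)
  moreover have "- H *\<^sub>R dd \<sigma> x z + ((a x - b x) *\<^sub>R ((a x + b x) *\<^sub>R dd \<sigma> x z + \<tau> x z *\<^sub>R ((a x + 3 * b x) *\<^sub>R t x + \<xi> x))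
    + (4 * (b x)\<^sup>2 * \<tau> x z - 4 * a x * b x * \<tau> x z) *\<^sub>R t x) = ((a x - b x) * \<tau> x z) *\<^sub>R eta x" for z
    unfolding eta_def vec_eq_iff H_factor[OF x] by (simp add: power2_eq_square algebra_simps)
  ultimately show ?thesis by simp
qed

text \<open>The derivative of \<open>eta\<close> is (a - b) \<tau> times \<open>eta\<close>, and (a
  - b) \<tau> = d(p - q), so this factor makes it constant.\<close>

definition ev :: "real^3 \<Rightarrow> real^4" where "ev x = exp (q x - p x) *\<^sub>R eta x"

lemma ev_constant: assumes x: "x \<in> U" shows "(ev has_derivative (\<lambda>z. 0)) (at x)"
proof -
  have "(ev has_derivative (\<lambda>z. exp (q x - p x) *\<^sub>R (((a x - b x) * \<tau> x z) *\<^sub>R eta x)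
      + (exp (q x - p x) * (b x * \<tau> x z - a x * \<tau> x z)) *\<^sub>R eta x)) (at x)"
    unfolding ev_def[abs_def]
    by (intro has_derivative_scaleR has_derivative_exp_left has_derivative_diff has_derivative_p has_derivative_q
        has_derivative_eta x)
  moreover have "exp (q x - p x) *\<^sub>R (((a x - b x) * \<tau> x z) *\<^sub>R eta x)
      + (exp (q x - p x) * (b x * \<tau> x z - a x * \<tau> x z)) *\<^sub>R eta x = 0" for z
    unfolding vec_eq_iff by (simp add: algebra_simps)
  ultimately show ?thesis by simp
qed

text \<open>H times the centre of the proper sphere.\<close>

definition cv :: "real^3 \<Rightarrow> real^4" where "cv x = \<xi> x + H *\<^sub>R \<sigma> x"

lemma cv_constant: assumes x: "x \<in> U" shows "(cv has_derivative (\<lambda>z. 0)) (at x)"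
proof -
  have "(cv has_derivative (\<lambda>z. dd \<xi> x z + H *\<^sub>R dd \<sigma> x z)) (at x)"
    unfolding cv_def[abs_def]
    by (intro has_derivative_add has_derivative_scaleR_right smooth_on_has_derivative[OF _ x] smooth_xi smooth_sigma)
  then show ?thesis by (simp add: weingarten[OF x])
qed

lemma tangent_transversal_span:
  assumes x: "x \<in> U" obtains w r where "y = dd \<sigma> x w + r *\<^sub>R \<xi> x"
proof -
  obtain \<beta> :: "4 \<Rightarrow> 3 option" where \<beta>: "bij \<beta>" using exists_bij_option by blast
  have "det (frame_matrix \<beta> \<sigma> \<xi> x) \<noteq> 0"
    by (intro frame_matrix_det \<beta> linear_sigma immersion transversal x)
  from matrix_inv_vector[OF this, of y] show thesis
    unfolding frame_matrix_mult[OF \<beta> linear_sigma[OF x]] using that by metis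
qed

text \<open>The two prescribed values make the covector vanish on \<open>eta\<close>, because
  \<tau>(T) = -1, and on the images of vectors orthogonal to T. The covector solves the transposed
  frame system, hence its smoothness.\<close>

lemma ell_exists:
  "\<exists>ell. smooth_on U ell \<and> (\<forall>x\<in>U. (\<forall>z. ell x \<bullet> dd \<sigma> x z = \<tau> x z) \<and> ell x \<bullet> \<xi> x = a x - b x)"
proof -
  obtain \<beta> :: "4 \<Rightarrow> 3 option" where \<beta>: "bij \<beta>" using exists_bij_option by blast
  define F where "F x = transpose (frame_matrix \<beta> \<sigma> \<xi> x)" for x
  define r where "r x = (\<chi> j. case \<beta> j of None \<Rightarrow> a x - b x | Some k \<Rightarrow> \<tau> x (axis k 1))" for x
  have Fdet: "det (F x) \<noteq> 0" if "x \<in> U" for x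
    unfolding F_def det_transpose
    by (intro frame_matrix_det \<beta> linear_sigma immersion transversal that)
  have Fs: "smooth_on U (\<lambda>x. F x $ i $ j)" for i j
    unfolding F_def frame_matrix_def transpose_def
    by (cases "\<beta> i") (simp_all add: smooth_on_nth[OF U smooth_xi] smooth_on_nth[OF U smooth_on_dd[OF smooth_sigma]])
  have rs: "smooth_on U r"
    unfolding r_def[abs_def]
  proof (rule smooth_on_vec[OF U])
    fix j
    show "smooth_on U (\<lambda>x. (\<chi> j. case \<beta> j of None \<Rightarrow> a x - b x | Some k \<Rightarrow> \<tau> x (axis k 1)) $ j)"
      by (cases "\<beta> j") (simp_all add: smooth_on_diff[OF U smooth_a smooth_b] smooth_tau)
  qed
  define ell where "ell x = matrix_inv (F x) *v r x" for x
  have Fe: "F x *v ell x = r x" if "x \<in> U" for x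
    unfolding ell_def by (rule matrix_inv_vector[OF Fdet[OF that]])
  have es: "smooth_on U ell" by (rule smooth_on_solve[OF U Fs rs Fdet Fe])
  have comp: "ell x \<bullet> (case \<beta> j of None \<Rightarrow> \<xi> x | Some k \<Rightarrow> dd \<sigma> x (axis k 1)) =
     (case \<beta> j of None \<Rightarrow> a x - b x | Some k \<Rightarrow> \<tau> x (axis k 1))" if x: "x \<in> U" for x j
  proof -
    have "(F x *v ell x) $ j = r x $ j" using Fe[OF x] by simp
    moreover have "(F x *v ell x) $ j = ell x \<bullet> (case \<beta> j of None \<Rightarrow> \<xi> x | Some k \<Rightarrow> dd \<sigma> x (axis k 1))"
      by (cases "\<beta> j") (simp_all add: F_def transpose_def frame_matrix_def matrix_vector_mult_def inner_vec_def mult.commute)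
    ultimately show ?thesis by (simp add: r_def)
  qed
  have "ell x \<bullet> \<xi> x = a x - b x" if x: "x \<in> U" for x
    using comp[OF x, of "inv \<beta> None"] \<beta> by (simp add: bij_is_surj surj_f_inv_f)
  moreover have "ell x \<bullet> dd \<sigma> x z = \<tau> x z" if x: "x \<in> U" for x z
  proof -
    have k: "ell x \<bullet> dd \<sigma> x (axis k 1) = \<tau> x (axis k 1)" for k
      using comp[OF x, of "inv \<beta> (Some k)"] \<beta> by (simp add: bij_is_surj surj_f_inv_f)
    have "ell x \<bullet> dd \<sigma> x z = (\<Sum>k\<in>UNIV. z $ k * \<tau> x (axis k 1))"
      by (subst linear_axis_expand[OF linear_sigma[OF x]]) (simp add: inner_sum_right k)
    also have "\<dots> = \<tau> x z"
      by (subst (2) linear_axis_expand[OF sym_bilinear_linear(1)[OF h[OF x]]]) simp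
    finally show ?thesis .
  qed
  ultimately show ?thesis using es by blast
qed

definition ell :: "real^3 \<Rightarrow> real^4" where
  "ell = (SOME ell. smooth_on U ell \<and> (\<forall>x\<in>U. (\<forall>z. ell x \<bullet> dd \<sigma> x z = \<tau> x z) \<and> ell x \<bullet> \<xi> x = a x - b x))"

lemma smooth_ell: "smooth_on U ell"
  and ell_sigma: "x \<in> U \<Longrightarrow> ell x \<bullet> dd \<sigma> x z = \<tau> x z"
  and ell_xi: "x \<in> U \<Longrightarrow> ell x \<bullet> \<xi> x = a x - b x"
  using someI_ex[OF ell_exists] unfolding ell_def[symmetric] by blast+

text \<open>Tested on tangent vectors and on \<xi>, which span: the former bring in the derivative
  of \<tau>, the latter that of a - b, and both yield the same factor.\<close>

lemma dd_ell:
  assumes x: "x \<in> U" shows "dd ell x z = ((a x - 3 * b x) * \<tau> x z) *\<^sub>R ell x"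
proof -
  note he = smooth_on_has_derivative[OF smooth_ell x]
  have 1: "dd ell x z \<bullet> dd \<sigma> x v = (a x - 3 * b x) * \<tau> x z * \<tau> x v" for v
  proof -
    have "dd (\<lambda>y. \<tau> y v) x z = dd (\<lambda>y. ell y \<bullet> dd \<sigma> y v) x z"
      by (rule dd_cong[OF U x smooth_on_differentiable[OF smooth_tau x]]) (simp add: ell_sigma)
    also have "\<dots> = ell x \<bullet> dd (\<lambda>y. dd \<sigma> y v) x z + dd ell x z \<bullet> dd \<sigma> x v"
      by (rule dd_eq[OF has_derivative_inner[OF he smooth_on_has_derivative[OF smooth_on_dd[OF smooth_sigma] x]]])
    finally show ?thesis
      unfolding dd_tau_eq[OF x] gauss[OF x] inner_add_right inner_scaleR_right ell_sigma[OF x] ell_xi[OF x]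
      by (simp add: mult.commute)
  qed
  have 2: "dd ell x z \<bullet> \<xi> x = (a x - 3 * b x) * \<tau> x z * (a x - b x)"
  proof -
    have "dd (\<lambda>y. a y - b y) x z = dd (\<lambda>y. ell y \<bullet> \<xi> y) x z"
      by (rule dd_cong[OF U x smooth_on_differentiable[OF smooth_on_diff[OF U smooth_a smooth_b] x]])
        (simp add: ell_xi)
    also have "\<dots> = ell x \<bullet> dd \<xi> x z + dd ell x z \<bullet> \<xi> x"
      by (rule dd_eq[OF has_derivative_inner[OF he smooth_on_has_derivative[OF smooth_xi x]]])
    also have "dd (\<lambda>y. a y - b y) x z = 4 * (b x)\<^sup>2 * \<tau> x z - 4 * a x * b x * \<tau> x z"
      by (rule dd_eq[OF has_derivative_diff[OF has_derivative_a[OF x] has_derivative_b[OF x]]])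
    finally show ?thesis
      unfolding weingarten[OF x] inner_scaleR_right ell_sigma[OF x] H_factor[OF x]
      by (simp add: power2_eq_square algebra_simps)
  qed
  show ?thesis
  proof (rule vector_eq_rdot[THEN iffD1], rule allI)
    fix y
    obtain w r where y: "y = dd \<sigma> x w + r *\<^sub>R \<xi> x" by (rule tangent_transversal_span[OF x])
    show "dd ell x z \<bullet> y = (((a x - 3 * b x) * \<tau> x z) *\<^sub>R ell x) \<bullet> y"
      unfolding y by (simp add: inner_add_right 1 2 ell_sigma[OF x] ell_xi[OF x] algebra_simps)
  qed
qed

text \<open>The logarithmic derivative of (a + b) exp(- p - q) is 4 b \<tau> - (a + b) \<tau>, which
  cancels the (a - 3 b) \<tau> of \<open>ell\<close>. The sign makes the fourth coordinate relative
  to the centre equal to exp(- p - q), hence positive.\<close>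

definition Lv :: "real^3 \<Rightarrow> real^4" where "Lv x = (- (a x + b x) * exp (- p x - q x)) *\<^sub>R ell x"

lemma Lv_constant: assumes x: "x \<in> U" shows "(Lv has_derivative (\<lambda>z. 0)) (at x)"
proof -
  have he: "(ell has_derivative (\<lambda>z. ((a x - 3 * b x) * \<tau> x z) *\<^sub>R ell x)) (at x)"
    using smooth_on_has_derivative[OF smooth_ell x] by (simp add: dd_ell[OF x])
  let ?E = "exp (- p x - q x)"
  have "(Lv has_derivative (\<lambda>z. (- (a x + b x) * ?E) *\<^sub>R (((a x - 3 * b x) * \<tau> x z) *\<^sub>R ell x)
      + (- (a x + b x) * (?E * (- (a x * \<tau> x z) - b x * \<tau> x z)) +
         - (4 * (b x)\<^sup>2 * \<tau> x z + 4 * a x * b x * \<tau> x z) * ?E) *\<^sub>R ell x)) (at x)"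
    unfolding Lv_def[abs_def]
    by (intro has_derivative_scaleR has_derivative_mult has_derivative_exp_left has_derivative_diff has_derivative_minus
        has_derivative_add has_derivative_a has_derivative_b has_derivative_p has_derivative_q he x)
  moreover have "(- (a x + b x) * ?E) *\<^sub>R (((a x - 3 * b x) * \<tau> x z) *\<^sub>R ell x)
      + (- (a x + b x) * (?E * (- (a x * \<tau> x z) - b x * \<tau> x z)) +
         - (4 * (b x)\<^sup>2 * \<tau> x z + 4 * a x * b x * \<tau> x z) * ?E) *\<^sub>R ell x = 0" for z
    unfolding vec_eq_iff by (simp add: power2_eq_square algebra_simps)
  ultimately show ?thesis by simp
qed

lemma Lv_sigma: "x \<in> U \<Longrightarrow> Lv x \<bullet> dd \<sigma> x z = - (a x + b x) * exp (- p x - q x) * \<tau> x z"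
  by (simp add: Lv_def ell_sigma)

lemma Lv_xi: "x \<in> U \<Longrightarrow> Lv x \<bullet> \<xi> x = - H * exp (- p x - q x)"
  unfolding H_factor[of x] by (simp add: Lv_def ell_xi algebra_simps)

lemma Lv_ev: "x \<in> U \<Longrightarrow> Lv x \<bullet> ev x = 0"
  by (simp add: Lv_def ev_def eta_def t_def inner_add_right ell_sigma ell_xi T_T)

end

section \<open>Independence of the chart, and global constants\<close>

lemma gauss_structure_cong:
  assumes "gauss_structure V \<sigma> \<xi> h \<Gamma> G H"
    and eq: "\<And>x. x \<in> V \<Longrightarrow> \<sigma> x = \<sigma>' x" "\<And>x. x \<in> V \<Longrightarrow> \<xi> x = \<xi>' x"
  shows "gauss_structure V \<sigma>' \<xi>' h \<Gamma> G H"
proof -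
  interpret gauss_structure V \<sigma> \<xi> h \<Gamma> G H by fact
  have d: "dd \<sigma>' x = dd \<sigma> x" "dd \<xi>' x = dd \<xi> x" if x: "x \<in> V" for x
    using dd_cong[OF U x smooth_on_differentiable[OF smooth_sigma x] eq(1)]
      dd_cong[OF U x smooth_on_differentiable[OF smooth_xi x] eq(2)] by auto
  have d2: "dd (\<lambda>y. dd \<sigma>' y v) x u = dd (\<lambda>y. dd \<sigma> y v) x u" if x: "x \<in> V" for x u v
    by (rule dd_cong[OF U x smooth_on_differentiable[OF smooth_on_dd[OF smooth_sigma] x], symmetric])
      (simp add: d)
  show ?thesis
  proof
    show "smooth_on V \<sigma>'" "smooth_on V \<xi>'"
      using smooth_on_cong[OF smooth_sigma U] smooth_on_cong[OF smooth_xi U] eq by auto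
    show "dd (\<lambda>y. dd \<sigma>' y v) x u = dd \<sigma>' x (\<Gamma> x u v) + h x u v *\<^sub>R \<xi>' x" if x: "x \<in> V" for x u v
      unfolding d2[OF x] d[OF x] eq(2)[OF x, symmetric] by (rule gauss[OF x])
    show "inj (dd \<sigma>' x)" if x: "x \<in> V" for x unfolding d[OF x] by (rule immersion[OF x])
    show "\<xi>' x \<notin> range (dd \<sigma>' x)" if x: "x \<in> V" for x
      unfolding d[OF x] eq(2)[OF x, symmetric] by (rule transversal[OF x])
    show "dd \<xi>' x u = - H *\<^sub>R dd \<sigma>' x u" if x: "x \<in> V" for x u
      unfolding d[OF x] by (rule weingarten[OF x])
  qed (fact U smooth_h h nondegenerate \<Gamma> G metric)+
qed

lemma canonical_frame_transport:
  assumes l: "linear f"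
    and hh: "\<And>u v. h' u v = h (f u) (f v)" and kk: "\<And>u v. f (k' u v) = k (f u) (f v)"
    and c: "canonical_frame h' k' a4 a6 t V W"
  shows "canonical_frame h k a4 a6 (f t) (f V) (f W)"
  using c unfolding canonical_frame_def hh[symmetric] kk[symmetric]
  by (simp add: linear_cmul[OF l] linear_add[OF l] linear_diff[OF l] linear_neg[OF l])

text \<open>The Gauss structure of one chart, pulled back along the transition map, is a second
  Gauss structure for the other chart. Both compute the same affine metric and difference tensor, so
  T and b correspond, and \<open>ev\<close> and \<open>Lv\<close> are built from these data. For the
  covector, its values on tangent vectors and on \<xi> decide.\<close>

lemma symmetric_sphere_reparam:
  assumes s1: "symmetric_sphere U1 \<sigma>1 \<xi>1 h1 \<Gamma>1 G1 H" and s2: "symmetric_sphere U2 \<sigma>2 \<xi>2 h2 \<Gamma>2 G2 H"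
    and V: "open V" "V \<subseteq> U2" and \<theta>: "smooth_on V \<theta>" "\<theta> ` V \<subseteq> U1" "\<And>x. x \<in> V \<Longrightarrow> bij (dd \<theta> x)"
    and eq: "\<And>x. x \<in> V \<Longrightarrow> \<sigma>2 x = \<sigma>1 (\<theta> x)" "\<And>x. x \<in> V \<Longrightarrow> \<xi>2 x = \<xi>1 (\<theta> x)"
    and x: "x \<in> V"
  shows "symmetric_sphere.ev \<sigma>2 \<xi>2 x = symmetric_sphere.ev \<sigma>1 \<xi>1 (\<theta> x)"
    "symmetric_sphere.Lv U2 \<sigma>2 \<xi>2 h2 x = symmetric_sphere.Lv U1 \<sigma>1 \<xi>1 h1 (\<theta> x)"
proof -
  interpret S1: symmetric_sphere U1 \<sigma>1 \<xi>1 h1 \<Gamma>1 G1 H by (rule s1)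
  interpret S2: symmetric_sphere U2 \<sigma>2 \<xi>2 h2 \<Gamma>2 G2 H by (rule s2)
  define N where "N A x u v = inv (dd \<theta> x) (A (\<theta> x) (dd \<theta> x u) (dd \<theta> x v) + dd (\<lambda>y. dd \<theta> y v) x u)" for A x u v
  have "gauss_structure V (\<lambda>x. \<sigma>1 (\<theta> x)) (\<lambda>x. \<xi>1 (\<theta> x)) (\<lambda>x u v. h1 (\<theta> x) (dd \<theta> x u) (dd \<theta> x v)) (N \<Gamma>1) (N G1) H"
    using gauss_structure_compose[OF S1.gauss_structure_axioms V(1) \<theta>] unfolding N_def[abs_def] .
  then have "gauss_structure V \<sigma>2 \<xi>2 (\<lambda>x u v. h1 (\<theta> x) (dd \<theta> x u) (dd \<theta> x v)) (N \<Gamma>1) (N G1) H"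
    by (rule gauss_structure_cong) (simp_all add: eq)
  then interpret P: gauss_structure V \<sigma>2 \<xi>2 "\<lambda>x u v. h1 (\<theta> x) (dd \<theta> x u) (dd \<theta> x v)" "N \<Gamma>1" "N G1" H .
  have \<theta>U: "\<theta> y \<in> U1" if "y \<in> V" for y using \<theta>(2) that by auto
  have l\<theta>: "linear (dd \<theta> y)" if "y \<in> V" for y using smooth_on_linear_dd[OF \<theta>(1) that] by simp
  have hh: "h2 y u v = h1 (\<theta> y) (dd \<theta> y u) (dd \<theta> y v)" if y: "y \<in> V" for y u v
    using P.affine_metric_eq[OF y] S2.affine_metric_eq[OF subsetD[OF V(2) y]] by metis
  have kk: "dd \<theta> y (S2.K y u v) = S1.K (\<theta> y) (dd \<theta> y u) (dd \<theta> y v)" if y: "y \<in> V" for y u v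
  proof -
    have "S2.K y u v = N \<Gamma>1 y u v - N G1 y u v"
      using P.difference_tensor_eq[OF y] S2.K_eq[OF subsetD[OF V(2) y]] by metis
    then show ?thesis
      using \<theta>(3)[OF y] by (simp add: N_def S1.K_def linear_diff[OF l\<theta>[OF y]] bij_is_surj surj_f_inv_f)
  qed
  have Tb: "S1.T (\<theta> y) = dd \<theta> y (S2.T y)" "S1.b (\<theta> y) = S2.b y" if y: "y \<in> V" for y
  proof -
    obtain X Y a6 where c: "a6 \<ge> 0" "S2.b y > 0" "canonical_frame (h2 y) (S2.K y) (S2.b y) a6 (S2.T y) X Y"
      by (rule S2.frame[OF subsetD[OF V(2) y]])
    have "canonical_frame (h1 (\<theta> y)) (S1.K (\<theta> y)) (S2.b y) a6 (dd \<theta> y (S2.T y)) (dd \<theta> y X) (dd \<theta> y Y)"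
      by (rule canonical_frame_transport[where f = "dd \<theta> y" and h = "h1 (\<theta> y)" and h' = "h2 y"
            and k = "S1.K (\<theta> y)" and k' = "S2.K y", OF l\<theta>[OF y] hh[OF y] kk[OF y] c(3)])
    from S1.canonical_T[OF \<theta>U[OF y] this c(2,1)]
    show "S1.T (\<theta> y) = dd \<theta> y (S2.T y)" "S1.b (\<theta> y) = S2.b y" by simp_all
  qed
  have d\<theta>: "\<theta> differentiable (at x)" by (rule smooth_on_differentiable[OF \<theta>(1) x])
  have xU: "x \<in> U2" using V x by auto
  have db: "dd S2.b x z = dd S1.b (\<theta> x) (dd \<theta> x z)" for z
  proof -
    have "dd S2.b x z = dd (\<lambda>y. S1.b (\<theta> y)) x z"
      by (rule dd_cong[OF V(1) x smooth_on_differentiable[OF S2.smooth_b xU]]) (simp add: Tb)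
    then show ?thesis
      unfolding dd_compose[OF d\<theta> smooth_on_differentiable[OF S1.smooth_b \<theta>U[OF x]]] .
  qed
  have ds: "dd \<sigma>2 x z = dd \<sigma>1 (\<theta> x) (dd \<theta> x z)" for z
  proof -
    have "dd \<sigma>2 x z = dd (\<lambda>y. \<sigma>1 (\<theta> y)) x z"
      by (rule dd_cong[OF V(1) x smooth_on_differentiable[OF S2.smooth_sigma xU]]) (simp add: eq)
    then show ?thesis
      unfolding dd_compose[OF d\<theta> smooth_on_differentiable[OF S1.smooth_sigma \<theta>U[OF x]]] .
  qed
  have a: "S2.a x = S1.a (\<theta> x)" by (simp add: S1.a_def S2.a_def db Tb x)
  have pq: "S2.p x = S1.p (\<theta> x)" "S2.q x = S1.q (\<theta> x)"
    by (simp_all add: S1.p_def S2.p_def S1.q_def S2.q_def a Tb x)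
  have t: "S2.t x = S1.t (\<theta> x)" by (simp add: S1.t_def S2.t_def ds Tb x)
  show "S2.ev x = S1.ev (\<theta> x)"
    by (simp add: S1.ev_def S2.ev_def S1.eta_def S2.eta_def a pq t Tb x eq)
  have "S2.ell x = S1.ell (\<theta> x)"
  proof (rule vector_eq_rdot[THEN iffD1], rule allI)
    fix y
    obtain w r where y: "y = dd \<sigma>2 x w + r *\<^sub>R \<xi>2 x" by (rule S2.tangent_transversal_span[OF xU])
    have "S1.ell (\<theta> x) \<bullet> dd \<sigma>2 x w = h2 x (S2.T x) w"
      unfolding ds S1.ell_sigma[OF \<theta>U[OF x]] hh[OF x] Tb[OF x] ..
    moreover have "S1.ell (\<theta> x) \<bullet> \<xi>2 x = S2.a x - S2.b x"
      unfolding eq(2)[OF x] S1.ell_xi[OF \<theta>U[OF x]] a Tb[OF x] ..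
    ultimately show "S2.ell x \<bullet> y = S1.ell (\<theta> x) \<bullet> y"
      unfolding y by (simp add: inner_add_right S2.ell_sigma[OF xU] S2.ell_xi[OF xU])
  qed
  then show "S2.Lv x = S1.Lv (\<theta> x)"
    by (simp add: S1.Lv_def S2.Lv_def a pq Tb x)
qed

lemma locally_constant_on_atlas:
  fixes F :: "(real^'n) set \<times> (real^'n \<Rightarrow> 'p::topological_space) \<Rightarrow> real^'n \<Rightarrow> 'z::real_normed_vector"
  assumes at: "oriented_atlas M A" and M: "connected M"
    and der: "\<And>D c x. (D, c) \<in> A \<Longrightarrow> x \<in> D \<Longrightarrow> (F (D, c) has_derivative (\<lambda>z. 0)) (at x)"
    and comp: "\<And>D c D' c' x x'. (D, c) \<in> A \<Longrightarrow> (D', c') \<in> A \<Longrightarrow> x \<in> D \<Longrightarrow> x' \<in> D' \<Longrightarrow> c x = c' x' \<Longrightarrow>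
      F (D, c) x = F (D', c') x'"
  obtains k where "\<And>D c x. (D, c) \<in> A \<Longrightarrow> x \<in> D \<Longrightarrow> F (D, c) x = k"
proof -
  have ex: "\<exists>z. \<forall>D c x. (D, c) \<in> A \<and> x \<in> D \<and> p = c x \<longrightarrow> F (D, c) x = z" if "p \<in> M" for p
  proof -
    obtain D c x where D: "(D, c) \<in> A" "x \<in> D" "p = c x"
      using \<open>p \<in> M\<close> at unfolding oriented_atlas_def by auto
    show ?thesis by (rule exI[of _ "F (D, c) x"]) (use comp D in blast)
  qed
  then obtain E where E: "\<And>p D c x. p \<in> M \<Longrightarrow> (D, c) \<in> A \<Longrightarrow> x \<in> D \<Longrightarrow> p = c x \<Longrightarrow> F (D, c) x = E p"
    by metis
  have cM: "c x \<in> M" if "(D, c) \<in> A" "x \<in> D" for D c x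
    using that at unfolding oriented_atlas_def by auto
  have E': "F (D, c) x = E (c x)" if "(D, c) \<in> A" "x \<in> D" for D c x
    using E[OF cM[OF that] that refl] .
  have loc: "\<forall>\<^sub>F r in at p within M. E p = E r" if p: "p \<in> M" for p
  proof -
    obtain D c x where D: "(D, c) \<in> A" "x \<in> D" "p = c x"
      using p at unfolding oriented_atlas_def by auto
    have tp: "topological_parametrization M D c"
      using at D(1) unfolding oriented_atlas_def smooth_parametrization_def by blast
    then have oD: "open D" and oc: "openin (top_of_set M) (c ` D)" and hom: "homeomorphism D (c ` D) c (inv_into D c)"
      by (auto simp: topological_parametrization_def)
    obtain r where r: "r > 0" "ball x r \<subseteq> D" using oD D(2) open_contains_ball by blast
    have const: "F (D, c) y = F (D, c) x" if "y \<in> ball x r" for y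
    proof -
      have "\<exists>k. \<forall>y\<in>ball x r. F (D, c) y = k"
      proof (rule has_derivative_zero_constant)
        show "(F (D, c) has_derivative (\<lambda>z. 0)) (at y within ball x r)" if "y \<in> ball x r" for y
          by (rule has_derivative_at_withinI[OF der[OF D(1) subsetD[OF r(2) that]]])
      qed simp
      then show ?thesis using that r(1) by (metis centre_in_ball)
    qed
    have "openin (top_of_set D) (ball x r)" using r(2) by (simp add: openin_open_eq oD)
    then have "openin (top_of_set (c ` D)) (c ` ball x r)"
      by (rule homeomorphism_imp_open_map[OF hom])
    then have "openin (top_of_set M) (c ` ball x r)" using oc openin_trans by blast
    then obtain O' where O: "open O'" "c ` ball x r = M \<inter> O'" by (auto simp: openin_open)
    have pO: "p \<in> O'" using O(2) D(3) r(1) by (metis IntD2 centre_in_ball imageI)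
    show ?thesis
      unfolding eventually_at_topological
    proof (intro exI[of _ O'] conjI ballI impI O(1) pO)
      fix s assume s: "s \<in> M" "s \<in> O'"
      then obtain y where y: "y \<in> ball x r" "s = c y" using O(2) by blast
      then have "F (D, c) y = E s" using E' D(1) r(2) by auto
      moreover have "F (D, c) x = E p" using E' D by auto
      ultimately show "E p = E s" using const[OF y(1)] by simp
    qed
  qed
  show thesis
  proof (cases "M = {}")
    case True
    then have "\<not> ((D, c) \<in> A \<and> x \<in> D)" for D c x using cM by blast
    then show ?thesis using that by blast
  next
    case False
    then obtain p0 where p0: "p0 \<in> M" by blast
    have c: "E p0 = E p" if "p \<in> M" for p
      by (rule connected_local_const[OF M p0 that]) (use loc in blast)
    show ?thesis
    proof (rule that)
      fix D c x assume "(D, c) \<in> A" "x \<in> D"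
      then show "F (D, c) x = E p0" unfolding E'[OF \<open>(D, c) \<in> A\<close> \<open>x \<in> D\<close>] using c[OF cM] by simp
    qed
  qed
qed

lemma transition_properties:
  fixes A :: "((real^'n) set \<times> (real^'n \<Rightarrow> 'p::topological_space)) set"
  assumes at: "oriented_atlas M A" and D: "(D, c) \<in> A" "(D', c') \<in> A"
  defines "V \<equiv> D \<inter> c -` (c' ` D')" and "\<theta> \<equiv> transition D' c' c"
  shows "open V" "smooth_on V \<theta>" "\<theta> ` V \<subseteq> D'" "\<And>x. x \<in> V \<Longrightarrow> bij (dd \<theta> x)" "\<And>x. x \<in> V \<Longrightarrow> c' (\<theta> x) = c x"
proof -
  have sp: "smooth_parametrization M A D c" "smooth_parametrization M A D' c'"
    using at D unfolding oriented_atlas_def by blast+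
  then have tp: "topological_parametrization M D c" "topological_parametrization M D' c'"
    by (auto simp: smooth_parametrization_def)
  then have oD: "open D" and cD: "c ` D \<subseteq> M" and cont: "continuous_on D c"
    and oc': "openin (top_of_set M) (c' ` D')"
    by (auto simp: topological_parametrization_def homeomorphism_def dest: openin_imp_subset)
  obtain O' where O: "open O'" "c' ` D' = M \<inter> O'" using oc' by (auto simp: openin_open)
  have "V = D \<inter> c -` O'" unfolding V_def O(2) using cD by auto
  then show V: "open V" using continuous_open_preimage[OF cont oD O(1)] by simp
  show s: "smooth_on V \<theta>"
    using sp(1) D(2) unfolding smooth_parametrization_def V_def \<theta>_def by auto
  show "\<theta> ` V \<subseteq> D'" unfolding V_def \<theta>_def transition_def by (auto intro: inv_into_into)
  show "c' (\<theta> x) = c x" if "x \<in> V" for x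
    using that unfolding V_def \<theta>_def transition_def by (auto intro: f_inv_into_f)
  show "bij (dd \<theta> x)" if x: "x \<in> V" for x
  proof -
    have l: "linear (dd \<theta> x)" using smooth_on_linear_dd[OF s x] by simp
    have "det (matrix (dd \<theta> x)) > 0"
      using at D x unfolding oriented_atlas_def V_def \<theta>_def by blast
    then have "inj (dd \<theta> x)" using det_nz_iff_inj[OF l] by simp
    then show ?thesis using linear_injective_imp_surjective[OF l] by (simp add: bij_def)
  qed
qed

text \<open>The affine map is built from these three vectors; this is what allows a single map for
  all of M.\<close>

lemma global_constants:
  assumes at: "oriented_atlas M A" and M: "connected M"
    and s: "\<And>D c. (D, c) \<in> A \<Longrightarrow> symmetric_sphere D (\<phi> \<circ> c) (\<xi> \<circ> c) (h (D, c)) (\<Gamma> (D, c)) (G (D, c)) H"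
  obtains e L k where
    "\<And>D c x. (D, c) \<in> A \<Longrightarrow> x \<in> D \<Longrightarrow> symmetric_sphere.ev (\<phi> \<circ> c) (\<xi> \<circ> c) x = e"
    "\<And>D c x. (D, c) \<in> A \<Longrightarrow> x \<in> D \<Longrightarrow> symmetric_sphere.Lv D (\<phi> \<circ> c) (\<xi> \<circ> c) (h (D, c)) x = L"
    "\<And>D c x. (D, c) \<in> A \<Longrightarrow> x \<in> D \<Longrightarrow> \<xi> (c x) + H *\<^sub>R \<phi> (c x) = k"
proof -
  have inv: "symmetric_sphere.ev (\<phi> \<circ> c) (\<xi> \<circ> c) x = symmetric_sphere.ev (\<phi> \<circ> c') (\<xi> \<circ> c') x'"
    "symmetric_sphere.Lv D (\<phi> \<circ> c) (\<xi> \<circ> c) (h (D, c)) x = symmetric_sphere.Lv D' (\<phi> \<circ> c') (\<xi> \<circ> c') (h (D', c')) x'"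
    if D: "(D, c) \<in> A" "(D', c') \<in> A" and x: "x \<in> D" "x' \<in> D'" "c x = c' x'" for D c D' c' x x'
  proof -
    let ?V = "D \<inter> c -` (c' ` D')" and ?\<theta> = "transition D' c' c"
    note tr = transition_properties[OF at D]
    have xV: "x \<in> ?V" using x by auto
    have hom: "homeomorphism D' (c' ` D') c' (inv_into D' c')"
      using at D(2) unfolding oriented_atlas_def smooth_parametrization_def topological_parametrization_def by blast
    have "?\<theta> x = inv_into D' c' (c' x')" using x(3) by (simp add: transition_def)
    then have x': "?\<theta> x = x'" using hom x(2) by (simp add: homeomorphism_def)
    have eq: "(f \<circ> c) y = (f \<circ> c') (?\<theta> y)" if "y \<in> ?V" for y and f :: "_ \<Rightarrow> real^4"
      using tr(5)[OF that] by simp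
    show "symmetric_sphere.ev (\<phi> \<circ> c) (\<xi> \<circ> c) x = symmetric_sphere.ev (\<phi> \<circ> c') (\<xi> \<circ> c') x'"
      "symmetric_sphere.Lv D (\<phi> \<circ> c) (\<xi> \<circ> c) (h (D, c)) x = symmetric_sphere.Lv D' (\<phi> \<circ> c') (\<xi> \<circ> c') (h (D', c')) x'"
      using symmetric_sphere_reparam[OF s[OF D(2)] s[OF D(1)] tr(1) Int_lower1 tr(2,3,4) eq eq xV]
      unfolding x' by blast+
  qed
  obtain e where e: "\<And>D c x. (D, c) \<in> A \<Longrightarrow> x \<in> D \<Longrightarrow> symmetric_sphere.ev (\<phi> \<circ> c) (\<xi> \<circ> c) x = e"
  proof (rule locally_constant_on_atlas[OF at M, of "\<lambda>(D, c). symmetric_sphere.ev (\<phi> \<circ> c) (\<xi> \<circ> c)"], goal_cases)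
    case (1 D c x)
    then show ?case using symmetric_sphere.ev_constant[OF s] by simp
  next
    case (2 D c D' c' x x')
    then show ?case using inv(1)[of D c D' c' x x'] by simp
  qed auto
  obtain L where L: "\<And>D c x. (D, c) \<in> A \<Longrightarrow> x \<in> D \<Longrightarrow> symmetric_sphere.Lv D (\<phi> \<circ> c) (\<xi> \<circ> c) (h (D, c)) x = L"
  proof (rule locally_constant_on_atlas[OF at M, of "\<lambda>(D, c). symmetric_sphere.Lv D (\<phi> \<circ> c) (\<xi> \<circ> c) (h (D, c))"], goal_cases)
    case (1 D c x)
    then show ?case using symmetric_sphere.Lv_constant[OF s] by simp
  next
    case (2 D c D' c' x x')
    then show ?case using inv(2)[of D c D' c' x x'] by simp
  qed auto
  obtain k where k: "\<And>D c x. (D, c) \<in> A \<Longrightarrow> x \<in> D \<Longrightarrow> symmetric_sphere.cv (\<phi> \<circ> c) (\<xi> \<circ> c) H x = k"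
  proof (rule locally_constant_on_atlas[OF at M, of "\<lambda>(D, c). symmetric_sphere.cv (\<phi> \<circ> c) (\<xi> \<circ> c) H"], goal_cases)
    case (1 D c x)
    then show ?case using symmetric_sphere.cv_constant[OF s] by simp
  next
    case (2 D c D' c' x x')
    then show ?case by (simp add: symmetric_sphere.cv_def[OF s])
  qed auto
  show thesis
    by (rule that[OF e L]) (use k in \<open>simp_all add: symmetric_sphere.cv_def[OF s]\<close>)
qed

section \<open>Normalized coordinates\<close>

lemma has_derivative_zero_eq:
  fixes f :: "'a::real_normed_vector \<Rightarrow> 'b::real_normed_vector"
  assumes "convex S" "open S" "\<And>x. x \<in> S \<Longrightarrow> (f has_derivative (\<lambda>_. 0)) (at x)" "x \<in> S" "y \<in> S"
  shows "f x = f y"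
proof -
  have "\<exists>k. \<forall>x\<in>S. f x = k"
    by (rule has_derivative_zero_constant[OF assms(1)]) (rule has_derivative_at_withinI[OF assms(3)])
  then show ?thesis using assms(4,5) by auto
qed

lemma dd_linear_compose:
  fixes f :: "'b::euclidean_space \<Rightarrow> 'c::euclidean_space"
  assumes "linear f" "g differentiable (at x)"
  shows "dd (\<lambda>y. f (g y)) x v = f (dd g x v)"
  by (rule dd_eq[OF bounded_linear.has_derivative[OF _ has_derivative_dd[OF assms(2)]]])
    (use assms(1) in \<open>simp add: linear_conv_bounded_linear\<close>)

lemma smooth_on_linear_compose:
  fixes f :: "'b::euclidean_space \<Rightarrow> 'c::real_normed_vector"
  assumes "linear f" "open U" "smooth_on U g"
  shows "smooth_on U (\<lambda>y. f (g y))"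
  by (rule smooth_on_compose[OF assms(2) open_UNIV _ assms(3) smooth_on_linear[OF assms(1) open_UNIV]]) simp

lemma dd_nth:
  fixes f :: "'a::real_normed_vector \<Rightarrow> real^'n"
  assumes "f differentiable (at x)" shows "dd (\<lambda>y. f y $ i) x v = dd f x v $ i"
  by (rule dd_linear_compose[OF _ assms, of "\<lambda>y. y $ i"]) (simp add: linear_iff)

lemma dd_divide:
  fixes f g :: "'a::real_normed_vector \<Rightarrow> real"
  assumes "f differentiable (at x)" "g differentiable (at x)" "g x \<noteq> 0"
  shows "dd (\<lambda>y. f y / g y) x v = (dd f x v * g x - f x * dd g x v) / (g x * g x)"
  by (rule dd_eq[OF has_derivative_divide'[OF has_derivative_dd[OF assms(1)] has_derivative_dd[OF assms(2)] assms(3)]])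

text \<open>\<open>B\<close> turns L into the fourth coordinate and the direction of
  \<open>e\<close> into the third axis. This leaves a free scale, and \<open>r_det\<close> fixes it
  so that the Hessian of the graph gets determinant 1.\<close>

locale normalized_sphere = symmetric_sphere U \<sigma> \<xi> h \<Gamma> G H
  for U \<sigma> \<xi> h \<Gamma> G H +
  fixes e L :: "real^4" and B :: "real^4^4" and r :: real
  assumes ev_eq: "\<And>x. x \<in> U \<Longrightarrow> ev x = e" and Lv_eq: "\<And>x. x \<in> U \<Longrightarrow> Lv x = L"
    and r: "r > 0" and r_det: "r\<^sup>2 = \<bar>det B\<bar>"
    and B4: "\<And>y. (B *v y) $ 4 = L \<bullet> y" and B_e: "B *v e = r *\<^sub>R axis 3 1"
begin

lemma det_B: "det B \<noteq> 0" using r r_det by auto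

lemma B_inj: "B *v y = B *v y' \<Longrightarrow> y = y'"
  using det_nz_iff_inj[OF matrix_vector_mul_linear[of B]] det_B by (auto dest: injD)

text \<open>As \<xi> + H \<sigma> is constant, this is \<open>B\<close> applied to the position
  relative to the centre; the form in \<xi> avoids naming the centre.\<close>

definition s :: "real^3 \<Rightarrow> real^4" where "s x = (- 1 / H) *\<^sub>R (B *v \<xi> x)"

lemma smooth_s: "smooth_on U s"
  unfolding s_def[abs_def]
  by (intro smooth_on_scaleR smooth_on_const U smooth_on_linear_compose[OF matrix_vector_mul_linear U smooth_xi])

lemma smooth_s_nth: "smooth_on U (\<lambda>x. s x $ i)"
  by (rule smooth_on_nth[OF U smooth_s])

lemma dd_s: assumes x: "x \<in> U" shows "dd s x z = B *v dd \<sigma> x z"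
proof -
  have "dd s x z = (- 1 / H) *\<^sub>R (B *v dd \<xi> x z)"
    unfolding s_def[abs_def]
    by (rule dd_linear_compose[of "\<lambda>y. (- 1 / H) *\<^sub>R (B *v y)"])
      (simp_all add: linear_iff matrix_vector_right_distrib matrix_vector_mult_scaleR algebra_simps
        smooth_on_differentiable[OF smooth_xi x])
  then show ?thesis using H by (simp add: weingarten[OF x] matrix_vector_mult_scaleR linear_neg[OF matrix_vector_mul_linear])
qed

lemma s4: assumes x: "x \<in> U" shows "s x $ 4 = exp (- p x - q x)"
proof -
  have "(B *v \<xi> x) $ 4 = - H * exp (- p x - q x)" unfolding B4 using Lv_xi[OF x] Lv_eq[OF x] by simp
  then show ?thesis using H by (simp add: s_def)
qed

lemma s4_pos: "x \<in> U \<Longrightarrow> s x $ 4 > 0"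
  by (simp add: s4)

lemma dd_s4: assumes x: "x \<in> U" shows "dd s x z $ 4 = - (a x + b x) * s x $ 4 * \<tau> x z"
  unfolding dd_s[OF x] B4 s4[OF x] using Lv_sigma[OF x, of z] Lv_eq[OF x] by simp

lemma B_eta: assumes x: "x \<in> U" shows "B *v eta x = (exp (p x - q x) * r) *\<^sub>R axis 3 1"
proof -
  have "eta x = exp (p x - q x) *\<^sub>R e"
    unfolding ev_eq[OF x, symmetric] ev_def by (simp flip: exp_add)
  then show ?thesis by (simp add: matrix_vector_mult_scaleR B_e)
qed

text \<open>Solving \<open>eta\<close> = \<xi> + (a - b) t for t expresses it by the position and
  the third axis. Along T the point s thus moves in the plane of these two vectors, which keeps
  s1/s4 and s2/s4 fixed.\<close>

lemma dd_s_T: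
  assumes x: "x \<in> U"
  shows "dd s x (T x) = (a x + b x) *\<^sub>R s x + (exp (p x - q x) * r / (a x - b x)) *\<^sub>R axis 3 1"
proof -
  have "B *v \<xi> x = B *v eta x - (a x - b x) *\<^sub>R (B *v t x)"
    by (simp add: eta_def matrix_vector_right_distrib matrix_vector_mult_scaleR)
  moreover have "B *v \<xi> x = - H *\<^sub>R s x" using H by (simp add: s_def)
  ultimately have "(a x - b x) *\<^sub>R (B *v t x) = H *\<^sub>R s x + (exp (p x - q x) * r) *\<^sub>R axis 3 1"
    unfolding B_eta[OF x] by (simp add: algebra_simps)
  then have "(1 / (a x - b x)) *\<^sub>R ((a x - b x) *\<^sub>R (B *v t x)) =
      (1 / (a x - b x)) *\<^sub>R (H *\<^sub>R s x + (exp (p x - q x) * r) *\<^sub>R axis 3 1)" by simp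
  moreover have "H / (a x - b x) = a x + b x"
    by (subst H_factor[OF x]) (use a_minus_b[OF x] in simp)
  ultimately show ?thesis
    using a_minus_b[OF x] unfolding dd_s[OF x] t_def by (simp add: scaleR_add_right)
qed

definition \<Psi> :: "real^3 \<Rightarrow> real^3" where "\<Psi> x = vector [s x $ 4, s x $ 1 / s x $ 4, s x $ 2 / s x $ 4]"

lemma s_eq_vector:
  assumes x: "x \<in> U" and P: "\<Psi> x = vector [t', z1, z2]"
  shows "s x = vector [t' * z1, t' * z2, t' * (s x $ 3 / s x $ 4), t']"
proof -
  have "s x $ 4 = t'" "s x $ 1 / s x $ 4 = z1" "s x $ 2 / s x $ 4 = z2"
    using arg_cong[OF P, of "\<lambda>w. w $ 1"] arg_cong[OF P, of "\<lambda>w. w $ 2"]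
      arg_cong[OF P, of "\<lambda>w. w $ 3"] by (simp_all add: \<Psi>_def)
  moreover have "s x $ i = s x $ 4 * (s x $ i / s x $ 4)" for i
    using s4_pos[OF x] by simp
  ultimately have "s x $ 1 = t' * z1" "s x $ 2 = t' * z2" "s x $ 3 = t' * (s x $ 3 / s x $ 4)" "s x $ 4 = t'"
    by metis+
  then show ?thesis by (subst vec_eq_iff) (simp add: forall_4 vector_def)
qed

lemma smooth_quotient: "smooth_on U (\<lambda>x. s x $ i / s x $ 4)"
  by (rule smooth_on_divide[OF U smooth_s_nth smooth_s_nth]) (use s4_pos in fastforce)

lemma smooth_\<Psi>: "smooth_on U \<Psi>"
proof (rule smooth_on_vec[OF U])
  fix i :: 3
  show "smooth_on U (\<lambda>x. \<Psi> x $ i)"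
    using exhaust_3[of i] by (auto simp: \<Psi>_def smooth_quotient smooth_s_nth)
qed

lemma dd_quotient:
  assumes x: "x \<in> U"
  shows "dd (\<lambda>x. s x $ i / s x $ 4) x z = (dd s x z $ i * s x $ 4 - s x $ i * dd s x z $ 4) / (s x $ 4 * s x $ 4)"
proof -
  note d = smooth_on_differentiable[OF smooth_s_nth x] and ds = smooth_on_differentiable[OF smooth_s x]
  show ?thesis
    using dd_divide[OF d d, of 4 i z] s4_pos[OF x] unfolding dd_nth[OF ds] by simp
qed

lemma dd_\<Psi>:
  assumes x: "x \<in> U"
  shows "dd \<Psi> x z $ 1 = dd s x z $ 4"
    "dd \<Psi> x z $ 2 = (dd s x z $ 1 * s x $ 4 - s x $ 1 * dd s x z $ 4) / (s x $ 4 * s x $ 4)"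
    "dd \<Psi> x z $ 3 = (dd s x z $ 2 * s x $ 4 - s x $ 2 * dd s x z $ 4) / (s x $ 4 * s x $ 4)"
proof -
  note d = smooth_on_differentiable[OF smooth_\<Psi> x] and ds = smooth_on_differentiable[OF smooth_s x]
  show "dd \<Psi> x z $ 1 = dd s x z $ 4"
    unfolding dd_nth[OF d, symmetric] dd_nth[OF ds, symmetric] by (simp add: \<Psi>_def)
  show "dd \<Psi> x z $ 2 = (dd s x z $ 1 * s x $ 4 - s x $ 1 * dd s x z $ 4) / (s x $ 4 * s x $ 4)"
    "dd \<Psi> x z $ 3 = (dd s x z $ 2 * s x $ 4 - s x $ 2 * dd s x z $ 4) / (s x $ 4 * s x $ 4)"
    unfolding dd_nth[OF d, symmetric] dd_quotient[OF x, symmetric] by (simp_all add: \<Psi>_def)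
qed

lemma tau_eq_0: "x \<in> U \<Longrightarrow> dd \<Psi> x z $ 1 = 0 \<Longrightarrow> \<tau> x z = 0"
  using s4_pos[of x] a_plus_b[of x] by (simp add: dd_\<Psi> dd_s4)

text \<open>A kernel vector is mapped by ds into the third axis, so its image under the derivative
  of \<sigma> is a multiple of \<open>eta\<close>. But \<open>eta\<close> has coefficient 1 along
  \<xi>, hence the multiple is zero.\<close>

lemma inj_dd_\<Psi>: assumes x: "x \<in> U" shows "inj (dd \<Psi> x)"
proof -
  have l: "linear (dd \<Psi> x)" using smooth_on_linear_dd[OF smooth_\<Psi> x] by simp
  have "z = 0" if z: "dd \<Psi> x z = 0" for z
  proof -
    have s: "dd s x z $ 4 = 0" "dd s x z $ 1 = 0" "dd s x z $ 2 = 0"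
      using z dd_\<Psi>[OF x, of z] s4_pos[OF x] by auto
    define m where "m = dd s x z $ 3 / (exp (p x - q x) * r)"
    have "dd s x z = dd s x z $ 3 *\<^sub>R axis 3 1"
      using s by (simp add: vec_eq_iff forall_4 axis_def)
    also have "\<dots> = B *v (m *\<^sub>R eta x)"
      unfolding matrix_vector_mult_scaleR B_eta[OF x] m_def using r by simp
    finally have "dd \<sigma> x z = m *\<^sub>R eta x" unfolding dd_s[OF x] by (rule B_inj)
    then have "dd \<sigma> x z + 0 *\<^sub>R \<xi> x = dd \<sigma> x ((m * (a x - b x)) *\<^sub>R T x) + m *\<^sub>R \<xi> x"
      by (simp add: eta_def t_def linear_cmul[OF linear_sigma[OF x]] scaleR_add_right)
    from tangent_transversal_unique[OF x this] show "z = 0" by simp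
  qed
  then show ?thesis unfolding linear_injective_0[OF l] by blast
qed

lemma dd_\<Psi>_T: assumes x: "x \<in> U" shows "dd \<Psi> x (T x) = ((a x + b x) * s x $ 4) *\<^sub>R axis 1 1"
  unfolding vec_eq_iff forall_3 dd_\<Psi>[OF x] dd_s_T[OF x] by (simp add: axis_def)

text \<open>The part of ds(T) along s does not change a quotient of coordinates; only the term along
  the third axis survives.\<close>

lemma dd_height_T:
  assumes x: "x \<in> U"
  shows "dd (\<lambda>x. s x $ 3 / s x $ 4) x (T x) = exp (p x - q x) * r / ((a x - b x) * s x $ 4)"
proof -
  have "s x $ 4 \<noteq> 0" using s4_pos[OF x] by simp
  then show ?thesis
    using a_minus_b[OF x] unfolding dd_quotient[OF x] dd_s_T[OF x] by (simp add: axis_def field_simps)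
qed

text \<open>\<open>\<kappa>\<close> parametrizes the leaf \<open>s\<^sub>4 = t\<^sub>0\<close>; the fourth and fifth equations compare the second derivatives
  of \<open>s \<circ> \<kappa>\<close> computed from the graph and from the Gauss formula.\<close>

lemma leaf:
  fixes \<kappa> :: "real^2 \<Rightarrow> real^3"
  assumes N: "open N" and \<kappa>: "smooth_on N \<kappa>" "\<kappa> ` N \<subseteq> U"
    and leaf: "\<forall>z\<in>N. \<Psi> (\<kappa> z) = vector [t0, z $ 1, z $ 2]"
    and f_def: "f = (\<lambda>z. s (\<kappa> z) $ 3 / s (\<kappa> z) $ 4)"
    and z: "z \<in> N"
  shows "dd \<Psi> (\<kappa> z) (dd \<kappa> z v) = vector [0, v $ 1, v $ 2]"
    "s (\<kappa> z) = vector [t0 * z $ 1, t0 * z $ 2, t0 * f z, t0]"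
    "dd s (\<kappa> z) (dd \<kappa> z v) = vector [t0 * v $ 1, t0 * v $ 2, t0 * dd f z v, 0]"
    "h (\<kappa> z) (dd \<kappa> z u) (dd \<kappa> z v) =
       t0 * dd (\<lambda>y. dd f y v) z u * exp (q (\<kappa> z) - p (\<kappa> z)) / r"
    "\<Gamma> (\<kappa> z) (dd \<kappa> z u) (dd \<kappa> z v) + dd (\<lambda>y. dd \<kappa> y v) z u =
       ((a (\<kappa> z) - b (\<kappa> z)) * h (\<kappa> z) (dd \<kappa> z u) (dd \<kappa> z v)) *\<^sub>R T (\<kappa> z)"
    "smooth_on N f"
proof -
  have \<Psi>\<kappa>: "\<Psi> (\<kappa> z) = vector [t0, z $ 1, z $ 2]" if "z \<in> N" for z using leaf that by blast
  have \<kappa>U: "\<kappa> y \<in> U" if "y \<in> N" for y using \<kappa>(2) that by auto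
  have d\<kappa>: "\<kappa> differentiable (at y)" if "y \<in> N" for y by (rule smooth_on_differentiable[OF \<kappa>(1) that])
  have jl: "linear (\<lambda>v::real^2. vector [0, v $ 1, v $ 2] :: real^3)"
    by (simp add: linear_iff vec_eq_iff forall_3)
  have dd\<Psi>: "dd \<Psi> (\<kappa> y) (dd \<kappa> y v) = vector [0, v $ 1, v $ 2]" if y: "y \<in> N" for y v
  proof -
    have "dd \<Psi> (\<kappa> y) (dd \<kappa> y v) = dd (\<lambda>y. \<Psi> (\<kappa> y)) y v"
      by (rule dd_compose[OF d\<kappa>[OF y] smooth_on_differentiable[OF smooth_\<Psi> \<kappa>U[OF y]], symmetric])
    also have "\<dots> = dd (\<lambda>y. vector [0, y $ 1, y $ 2] + vector [t0, 0, 0]) y v"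
    proof (rule dd_cong[OF N y])
      show "(\<lambda>y. \<Psi> (\<kappa> y)) differentiable (at y)"
        by (rule smooth_on_differentiable[OF smooth_on_compose[OF N U \<kappa>(2,1) smooth_\<Psi>] y])
      show "\<Psi> (\<kappa> y) = vector [0, y $ 1, y $ 2] + vector [t0, 0, 0]" if "y \<in> N" for y
        unfolding \<Psi>\<kappa>[OF that] by (simp add: vec_eq_iff forall_3)
    qed
    also have "\<dots> = vector [0, v $ 1, v $ 2] + 0"
    proof (rule dd_eq[OF has_derivative_add[OF _ has_derivative_const]])
      show "((\<lambda>y::real^2. vector [0, y $ 1, y $ 2] :: real^3) has_derivative (\<lambda>v. vector [0, v $ 1, v $ 2])) (at y)"
        using jl by (intro bounded_linear_imp_has_derivative) (simp add: linear_conv_bounded_linear)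
    qed
    finally show ?thesis by simp
  qed
  then show "dd \<Psi> (\<kappa> z) (dd \<kappa> z v) = vector [0, v $ 1, v $ 2]" using z by blast
  have sf: "smooth_on N f"
    unfolding f_def by (rule smooth_on_compose[OF N U \<kappa>(2,1) smooth_quotient])
  then show "smooth_on N f" .
  have s\<kappa>: "s (\<kappa> y) = vector [t0 * y $ 1, t0 * y $ 2, t0 * f y, t0]" if y: "y \<in> N" for y
    using s_eq_vector[OF \<kappa>U[OF y] \<Psi>\<kappa>[OF y]] unfolding f_def .
  then show "s (\<kappa> z) = vector [t0 * z $ 1, t0 * z $ 2, t0 * f z, t0]" using z by blast
  have ds: "dd s (\<kappa> y) (dd \<kappa> y v) = vector [t0 * v $ 1, t0 * v $ 2, t0 * dd f y v, 0]" if y: "y \<in> N" for y v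
  proof -
    have "dd s (\<kappa> y) (dd \<kappa> y v) = dd (\<lambda>y. s (\<kappa> y)) y v"
      by (rule dd_compose[OF d\<kappa>[OF y] smooth_on_differentiable[OF smooth_s \<kappa>U[OF y]], symmetric])
    also have "\<dots> = dd (\<lambda>y. (\<chi> i. vector [t0 * y $ 1, t0 * y $ 2, t0 * f y, t0] $ i) :: real^4) y v"
    proof (rule dd_cong[OF N y])
      show "(\<lambda>y. s (\<kappa> y)) differentiable (at y)"
        by (rule smooth_on_differentiable[OF smooth_on_compose[OF N U \<kappa>(2,1) smooth_s] y])
    qed (simp add: s\<kappa>)
    also have "\<dots> = vector [t0 * v $ 1, t0 * v $ 2, t0 * dd f y v, 0]"
    proof -
      have c: "((\<lambda>y::real^2. y $ i) has_derivative (\<lambda>v. v $ i)) (at y)" for i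
        by (intro bounded_linear_imp_has_derivative bounded_linear_vec_nth)
      have "((\<lambda>y. \<Sum>i\<in>UNIV. (vector [t0 * y $ 1, t0 * y $ 2, t0 * f y, t0] $ i) *\<^sub>R axis i (1::real) :: real^4) has_derivative
        (\<lambda>v. \<Sum>i\<in>UNIV. (vector [t0 * v $ 1, t0 * v $ 2, t0 * dd f y v, 0] $ i) *\<^sub>R axis i 1)) (at y)"
      proof (intro has_derivative_sum has_derivative_scaleR_left)
        fix i :: 4
        show "((\<lambda>y. vector [t0 * y $ 1, t0 * y $ 2, t0 * f y, t0] $ i :: real) has_derivative
          (\<lambda>v. vector [t0 * v $ 1, t0 * v $ 2, t0 * dd f y v, 0] $ i)) (at y)"
          using exhaust_4[of i]
          by (elim disjE) (simp_all add: vector_def has_derivative_mult_right c smooth_on_has_derivative[OF sf y])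
      qed
      moreover have "(\<Sum>i\<in>UNIV. (w $ i) *\<^sub>R axis i (1::real)) = w" for w :: "real^4"
        using basis_expansion[of w] by (simp add: scalar_mult_eq_scaleR)
      ultimately show ?thesis by (intro dd_eq) simp
    qed
    finally show ?thesis .
  qed
  then show "dd s (\<kappa> z) (dd \<kappa> z v) = vector [t0 * v $ 1, t0 * v $ 2, t0 * dd f z v, 0]" using z by blast
  let ?x = "\<kappa> z" and ?E = "exp (p (\<kappa> z) - q (\<kappa> z))" and ?D = "dd (\<lambda>y. dd f y v) z u"
  note xU = \<kappa>U[OF z]
  have smZ: "smooth_on N (\<lambda>y. dd \<kappa> y v)" by (rule smooth_on_dd[OF \<kappa>(1)])
  have sm\<sigma>: "smooth_on N (\<lambda>y. dd \<sigma> (\<kappa> y) w)" for w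
    by (rule smooth_on_compose[OF N U \<kappa>(2,1) smooth_on_dd[OF smooth_sigma]])
  have lin: "linear (dd \<sigma> (\<kappa> y))" if "y \<in> N" for y by (rule linear_sigma[OF \<kappa>U[OF that]])
  have sm: "smooth_on N (\<lambda>y. dd \<sigma> (\<kappa> y) (dd \<kappa> y v))"
    by (rule smooth_on_family[OF N lin sm\<sigma> smZ])
  have "dd (\<lambda>y. dd \<sigma> (\<kappa> y) (dd \<kappa> y v)) z u =
      dd (\<lambda>y. dd \<sigma> (\<kappa> y) (dd \<kappa> z v)) z u + dd \<sigma> ?x (dd (\<lambda>y. dd \<kappa> y v) z u)"
    by (rule dd_family[OF N z lin sm\<sigma> smZ])
  also have "dd (\<lambda>y. dd \<sigma> (\<kappa> y) (dd \<kappa> z v)) z u = dd (\<lambda>y. dd \<sigma> y (dd \<kappa> z v)) ?x (dd \<kappa> z u)"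
    by (rule dd_compose[OF d\<kappa>[OF z] smooth_on_differentiable[OF smooth_on_dd[OF smooth_sigma] xU]])
  finally have 1: "dd (\<lambda>y. dd \<sigma> (\<kappa> y) (dd \<kappa> y v)) z u =
      dd \<sigma> ?x (\<Gamma> ?x (dd \<kappa> z u) (dd \<kappa> z v) + dd (\<lambda>y. dd \<kappa> y v) z u)
        + h ?x (dd \<kappa> z u) (dd \<kappa> z v) *\<^sub>R \<xi> ?x"
    unfolding gauss[OF xU] by (simp add: linear_add[OF lin[OF z]])
  \<comment> \<open>In graph coordinates on the leaf only the third component has second
    derivatives, so the result is t0 Hess f times the third axis, that is, a multiple of
    \<open>eta\<close>. Splitting \<open>eta\<close> into (a - b) t and \<xi> separates the
    tangential part from the metric.\<close>
  have "B *v dd (\<lambda>y. dd \<sigma> (\<kappa> y) (dd \<kappa> y v)) z u = dd (\<lambda>y. B *v dd \<sigma> (\<kappa> y) (dd \<kappa> y v)) z u"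
    by (rule dd_linear_compose[OF matrix_vector_mul_linear smooth_on_differentiable[OF sm z], symmetric])
  also have "\<dots> = dd (\<lambda>y. vector [t0 * v $ 1, t0 * v $ 2, 0, 0] + (t0 * dd f y v) *\<^sub>R axis 3 1) z u"
  proof (rule dd_cong[OF N z])
    show "(\<lambda>y. B *v dd \<sigma> (\<kappa> y) (dd \<kappa> y v)) differentiable (at z)"
      by (rule smooth_on_differentiable[OF smooth_on_linear_compose[OF matrix_vector_mul_linear N sm] z])
    show "B *v dd \<sigma> (\<kappa> y) (dd \<kappa> y v) = vector [t0 * v $ 1, t0 * v $ 2, 0, 0] + (t0 * dd f y v) *\<^sub>R axis 3 1"
      if y: "y \<in> N" for y
      unfolding dd_s[OF \<kappa>U[OF y], symmetric] ds[OF y] by (simp add: vec_eq_iff forall_4 axis_def vector_def)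
  qed
  also have "\<dots> = 0 + (t0 * ?D) *\<^sub>R axis 3 1"
    by (rule dd_eq) (intro has_derivative_add has_derivative_const has_derivative_scaleR_left
        has_derivative_mult_right smooth_on_has_derivative[OF smooth_on_dd[OF sf] z])
  also have "\<dots> = B *v ((t0 * ?D / (?E * r)) *\<^sub>R eta ?x)"
    unfolding matrix_vector_mult_scaleR B_eta[OF xU] using r by simp
  finally have "dd (\<lambda>y. dd \<sigma> (\<kappa> y) (dd \<kappa> y v)) z u = (t0 * ?D / (?E * r)) *\<^sub>R eta ?x"
    by (rule B_inj)
  then have "dd \<sigma> ?x (\<Gamma> ?x (dd \<kappa> z u) (dd \<kappa> z v) + dd (\<lambda>y. dd \<kappa> y v) z u)
        + h ?x (dd \<kappa> z u) (dd \<kappa> z v) *\<^sub>R \<xi> ?x =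
      dd \<sigma> ?x ((t0 * ?D / (?E * r) * (a ?x - b ?x)) *\<^sub>R T ?x) + (t0 * ?D / (?E * r)) *\<^sub>R \<xi> ?x"
    unfolding 1 by (simp add: eta_def t_def linear_cmul[OF lin[OF z]] scaleR_add_right)
  from tangent_transversal_unique[OF xU this]
  have 2: "\<Gamma> ?x (dd \<kappa> z u) (dd \<kappa> z v) + dd (\<lambda>y. dd \<kappa> y v) z u = (t0 * ?D / (?E * r) * (a ?x - b ?x)) *\<^sub>R T ?x"
    and 3: "h ?x (dd \<kappa> z u) (dd \<kappa> z v) = t0 * ?D / (?E * r)" by auto
  have E: "exp (q ?x - p ?x) = 1 / ?E" by (metis exp_minus_inverse inverse_eq_divide minus_diff_eq exp_minus)
  show "h ?x (dd \<kappa> z u) (dd \<kappa> z v) = t0 * ?D * exp (q ?x - p ?x) / r"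
    unfolding 3 E by simp
  show "\<Gamma> ?x (dd \<kappa> z u) (dd \<kappa> z v) + dd (\<lambda>y. dd \<kappa> y v) z u =
       ((a ?x - b ?x) * h ?x (dd \<kappa> z u) (dd \<kappa> z v)) *\<^sub>R T ?x"
    unfolding 2 3 by (simp add: mult.commute)
qed

end

section \<open>The volume condition in an arbitrary tangential frame\<close>

lemma det_4:
  "det (A::real^4^4) =
    A$1$1 * (A$2$2 * A$3$3 * A$4$4 + A$2$3 * A$3$4 * A$4$2 + A$2$4 * A$3$2 * A$4$3
      - A$2$2 * A$3$4 * A$4$3 - A$2$3 * A$3$2 * A$4$4 - A$2$4 * A$3$3 * A$4$2)
    - A$1$2 * (A$2$1 * A$3$3 * A$4$4 + A$2$3 * A$3$4 * A$4$1 + A$2$4 * A$3$1 * A$4$3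
      - A$2$1 * A$3$4 * A$4$3 - A$2$3 * A$3$1 * A$4$4 - A$2$4 * A$3$3 * A$4$1)
    + A$1$3 * (A$2$1 * A$3$2 * A$4$4 + A$2$2 * A$3$4 * A$4$1 + A$2$4 * A$3$1 * A$4$2
      - A$2$1 * A$3$4 * A$4$2 - A$2$2 * A$3$1 * A$4$4 - A$2$4 * A$3$2 * A$4$1)
    - A$1$4 * (A$2$1 * A$3$2 * A$4$3 + A$2$2 * A$3$3 * A$4$1 + A$2$3 * A$3$1 * A$4$2
      - A$2$1 * A$3$3 * A$4$2 - A$2$2 * A$3$1 * A$4$3 - A$2$3 * A$3$2 * A$4$1)"
proof -
  have f1234: "finite {2::4, 3, 4}" "1 \<notin> {2::4, 3, 4}" by auto
  have f234: "finite {3::4, 4}" "2 \<notin> {3::4, 4}" by auto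
  have f34: "finite {4::4}" "3 \<notin> {4::4}" by auto
  show ?thesis
    unfolding det_def UNIV_4
    unfolding sum_over_permutations_insert[OF f1234]
    unfolding sum_over_permutations_insert[OF f234]
    unfolding sum_over_permutations_insert[OF f34]
    unfolding permutes_sing
    by (simp add: sign_swap_id permutation_swap_id permutation_compose sign_compose sign_id swap_id_eq algebra_simps)
qed

text \<open>One concrete order of the columns, with \<xi> last, replacing the unspecified
  bijection.\<close>

definition std_numbering :: "4 \<Rightarrow> 3 option" where
  "std_numbering j = (if j = 1 then Some 1 else if j = 2 then Some 2 else if j = 3 then Some 3 else None)"

lemma bij_std_numbering: "bij std_numbering"
proof (rule bijI)
  show "inj std_numbering" unfolding inj_def forall_4 by (simp add: std_numbering_def)
  have "y \<in> range std_numbering" for y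
  proof (cases y)
    case None
    then have "y = std_numbering 4" by (simp add: std_numbering_def)
    then show ?thesis by blast
  next
    case (Some k)
    then have "y = std_numbering (if k = 1 then 1 else if k = 2 then 2 else 3)"
      using exhaust_3[of k] by (auto simp: std_numbering_def)
    then show ?thesis by blast
  qed
  then show "surj std_numbering" by blast
qed

lemma det_frame_matrix_numbering:
  fixes \<beta> :: "4 \<Rightarrow> 3 option"
  assumes \<beta>: "bij \<beta>"
  shows "\<bar>det (frame_matrix \<beta> \<sigma> \<xi> x)\<bar> = \<bar>det (frame_matrix std_numbering \<sigma> \<xi> x)\<bar>"
proof -
  define \<pi> where "\<pi> = inv std_numbering \<circ> \<beta>"
  have "bij \<pi>" unfolding \<pi>_def by (intro bij_comp \<beta> bij_imp_bij_inv bij_std_numbering)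
  then have \<pi>: "\<pi> permutes UNIV" using bij_imp_permutes[of \<pi> UNIV] by simp
  have "std_numbering (\<pi> j) = \<beta> j" for j
    using bij_std_numbering by (simp add: \<pi>_def bij_is_surj surj_f_inv_f)
  then have "frame_matrix \<beta> \<sigma> \<xi> x = (\<chi> i j. frame_matrix std_numbering \<sigma> \<xi> x $ i $ \<pi> j)"
    by (simp add: frame_matrix_def vec_eq_iff)
  then have "det (frame_matrix \<beta> \<sigma> \<xi> x) = of_int (sign \<pi>) * det (frame_matrix std_numbering \<sigma> \<xi> x)"
    using det_permute_columns[OF \<pi>] by simp
  then show ?thesis by (cases \<pi> rule: sign_cases) (simp_all add: abs_mult)
qed

text \<open>Passing from coordinate fields to u1, u2, u3 multiplies the frame determinant by det P
  and the Gram determinant by (det P)^2, so the squared volume condition persists; applying B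
  contributes (det B)^2.\<close>

lemma frame_volume:
  fixes \<sigma> \<xi> :: "real^3 \<Rightarrow> real^4" and h :: "real^3 \<Rightarrow> real^3 \<Rightarrow> real" and B :: "real^4^4"
    and u1 u2 u3 :: "real^3"
  assumes \<beta>: "bij \<beta>" and vol: "\<bar>det (frame_matrix \<beta> \<sigma> \<xi> x)\<bar> = sqrt \<bar>det (gram_matrix h)\<bar>"
    and l: "linear (dd \<sigma> x)" and h: "sym_bilinear h"
  defines "M \<equiv> \<chi> i j. (B *v (vector [dd \<sigma> x u1, dd \<sigma> x u2, dd \<sigma> x u3, \<xi> x] $ j)) $ i"
    and "g \<equiv> \<chi> i j. h (vector [u1, u2, u3] $ i) (vector [u1, u2, u3] $ j) :: real^3^3"
  shows "(det M)\<^sup>2 = (det B)\<^sup>2 * \<bar>det g\<bar>"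
proof -
  define F where "F = frame_matrix std_numbering \<sigma> \<xi> x"
  define P :: "real^3^3" where "P = (\<chi> i j. vector [u1, u2, u3] $ j $ i)"
  define Q :: "real^4^4" where "Q = vector [vector [u1$1, u2$1, u3$1, 0], vector [u1$2, u2$2, u3$2, 0],
    vector [u1$3, u2$3, u3$3, 0], vector [0, 0, 0, 1]]"
  have e: "dd \<sigma> x z = z $ 1 *\<^sub>R dd \<sigma> x (axis 1 1) + z $ 2 *\<^sub>R dd \<sigma> x (axis 2 1) + z $ 3 *\<^sub>R dd \<sigma> x (axis 3 1)" for z
    unfolding linear_axis_expand[OF l, of z] sum_3 by (rule refl)
  have FQ: "(F ** Q) $ i $ j = vector [dd \<sigma> x u1, dd \<sigma> x u2, dd \<sigma> x u3, \<xi> x] $ j $ i" for i j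
    unfolding e[of u1] e[of u2] e[of u3] using exhaust_4[of j]
    by (auto simp: matrix_matrix_mult_def sum_4 F_def Q_def frame_matrix_def std_numbering_def vector_def mult.commute)
  have "M = B ** (F ** Q)"
    unfolding M_def matrix_matrix_mult_def[of B] matrix_vector_mult_def by (simp add: vec_eq_iff FQ)
  moreover have "det Q = det P"
    unfolding det_4 det_3 by (simp add: Q_def P_def vector_def algebra_simps)
  ultimately have 1: "det M = det B * (det F * det P)" by (simp add: det_mul)
  have "g = transpose P ** (gram_matrix h ** P)"
  proof -
    have GP: "(gram_matrix h ** P) $ k $ j = h (axis k 1) (vector [u1, u2, u3] $ j)" for k j
      using gram_matrix_mult[OF h, of "vector [u1, u2, u3] $ j" k]
      by (simp add: matrix_matrix_mult_def matrix_vector_mult_def P_def)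
    show ?thesis
      unfolding g_def vec_eq_iff matrix_matrix_mult_def[of "transpose P"] sym_bilinear_expand[OF h, of "vector [u1, u2, u3] $ _"]
      by (simp add: GP transpose_def) (simp add: P_def)
  qed
  then have 2: "det g = (det P)\<^sup>2 * det (gram_matrix h)" by (simp add: det_mul power2_eq_square)
  have "(det F)\<^sup>2 = \<bar>det (gram_matrix h)\<bar>"
    using vol unfolding det_frame_matrix_numbering[OF \<beta>] F_def[symmetric]
    by (metis abs_ge_zero power2_abs real_sqrt_pow2)
  then show ?thesis unfolding 1 2 by (simp add: power_mult_distrib abs_mult)
qed

context symmetric_sphere
begin

lemma h_pos:
  assumes x: "x \<in> U" and z: "\<tau> x z = 0" "z \<noteq> 0" shows "h x z z > 0"
proof -
  obtain V W a6 where c: "canonical_frame (h x) (K x) (b x) a6 (T x) V W" by (rule frame[OF x])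
  note hl = sym_bilinearD[OF h[OF x]] and fr = canonical_frame_lorentz[OF c]
  have f: "h x V V = 1" "h x W W = 1" "h x V W = 0" "h x W V = 0"
    using fr sym_bilinear_commute[OF h[OF x]] unfolding lorentz_frame_def by metis+
  obtain v w where e: "z = v *\<^sub>R V + w *\<^sub>R W"
    using lorentz_frame_expand[OF h[OF x] fr, of z] z(1) by simp
  have "h x z z = v\<^sup>2 + w\<^sup>2" unfolding e hl f by (simp add: power2_eq_square)
  moreover have "v \<noteq> 0 \<or> w \<noteq> 0" using z(2) e by auto
  ultimately show ?thesis by (simp add: sum_power2_gt_zero_iff)
qed

lemma K_SO2:
  assumes x: "x \<in> U" and c: "canonical_frame (h x) (K x) a4 0 t' V W" "a4 > 0"
    and u: "\<tau> x u = 0" and v: "\<tau> x v = 0"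
  shows "K x u v = (- b x * h x u v) *\<^sub>R T x"
proof -
  have c: "canonical_frame (h x) (K x) (b x) 0 (T x) V W" using c canonical_T[OF x c] by simp
  note hl = sym_bilinearD[OF h[OF x]] and Kl = sym_bilinearD[OF K[OF x]] and fr = canonical_frame_lorentz[OF c]
  have f: "h x V V = 1" "h x W W = 1" "h x V W = 0" "h x W V = 0"
    using fr sym_bilinear_commute[OF h[OF x]] unfolding lorentz_frame_def by metis+
  have k: "K x V V = (- b x) *\<^sub>R T x" "K x V W = 0" "K x W V = 0" "K x W W = (- b x) *\<^sub>R T x"
    using c sym_bilinear_commute[OF K[OF x], of W V] unfolding canonical_frame_def by auto
  obtain u1 u2 where e: "u = u1 *\<^sub>R V + u2 *\<^sub>R W"
    using lorentz_frame_expand[OF h[OF x] fr, of u] u by simp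
  obtain v1 v2 where e': "v = v1 *\<^sub>R V + v2 *\<^sub>R W"
    using lorentz_frame_expand[OF h[OF x] fr, of v] v by simp
  show ?thesis unfolding e e' hl Kl f k by (simp add: algebra_simps)
qed

end

section \<open>The leaves: positivity, Hessian determinant and third derivatives\<close>

context normalized_sphere
begin

context
  fixes N :: "(real^2) set" and \<kappa> :: "real^2 \<Rightarrow> real^3" and t0 :: real and f :: "real^2 \<Rightarrow> real"
  assumes N: "open N" and \<kappa>: "smooth_on N \<kappa>" "\<kappa> ` N \<subseteq> U"
    and \<Psi>\<kappa>: "\<forall>z\<in>N. \<Psi> (\<kappa> z) = vector [t0, z $ 1, z $ 2]"
    and f: "f = (\<lambda>z. s (\<kappa> z) $ 3 / s (\<kappa> z) $ 4)"
begin

private lemma \<kappa>U: "z \<in> N \<Longrightarrow> \<kappa> z \<in> U" using \<kappa>(2) by auto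

lemmas leaf' = leaf[OF N \<kappa> \<Psi>\<kappa> f]

lemma leaf_tau: "z \<in> N \<Longrightarrow> \<tau> (\<kappa> z) (dd \<kappa> z v) = 0"
  by (rule tau_eq_0[OF \<kappa>U]) (simp_all add: leaf'(1))

lemma leaf_nonzero: "z \<in> N \<Longrightarrow> v \<noteq> 0 \<Longrightarrow> dd \<kappa> z v \<noteq> 0"
proof
  assume z: "z \<in> N" and v: "v \<noteq> 0" "dd \<kappa> z v = 0"
  have "linear (dd \<Psi> (\<kappa> z))" using smooth_on_linear_dd[OF smooth_\<Psi> \<kappa>U[OF z]] by simp
  then have "vector [0, v $ 1, v $ 2] = (0 :: real^3)" using leaf'(1)[OF z, of v] v(2) by (simp add: linear_0)
  then show False using v(1) by (simp add: vec_eq_iff forall_3 forall_2)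
qed

lemma leaf_t0: "z \<in> N \<Longrightarrow> t0 > 0"
  using s4_pos[OF \<kappa>U, of z] arg_cong[OF leaf'(2), of z "\<lambda>w. w $ 4"] by (simp add: vector_def)

text \<open>On the leaf the affine metric is a positive multiple of the Hessian, and the leaf is
  tangent to the spacelike complement of T.\<close>

lemma leaf_hessian_pos: assumes z: "z \<in> N" and v: "v \<noteq> 0" shows "dd (\<lambda>y. dd f y v) z v > 0"
proof -
  have "h (\<kappa> z) (dd \<kappa> z v) (dd \<kappa> z v) > 0"
    by (rule h_pos[OF \<kappa>U[OF z] leaf_tau[OF z] leaf_nonzero[OF z v]])
  then show ?thesis
    unfolding leaf'(4)[OF z] using leaf_t0[OF z] r
    by (simp add: zero_less_mult_iff zero_less_divide_iff)
qed

text \<open>The volume condition is evaluated in the frame of T and the two coordinate fields of the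
  leaf, where h splits. The powers of \<open>r\<close> cancel by \<open>r_det\<close> and those of
  exp(p), exp(q) by the choice of the integrating factors.\<close>

lemma leaf_hessian_det:
  assumes z: "z \<in> N"
    and \<beta>: "bij \<beta>" "\<bar>det (frame_matrix \<beta> \<sigma> \<xi> (\<kappa> z))\<bar> = sqrt \<bar>det (gram_matrix (h (\<kappa> z)))\<bar>"
  defines "D \<equiv> \<lambda>u v. dd (\<lambda>y. dd f y v) z u"
  shows "\<bar>det (gram_matrix D)\<bar> = 1"
proof -
  let ?x = "\<kappa> z"
  note x = \<kappa>U[OF z]
  define E where "E = exp (p ?x - q ?x)"
  have E0: "E > 0" and E: "exp (q ?x - p ?x) = 1 / E"
    unfolding E_def by (simp, metis exp_minus_inverse inverse_eq_divide minus_diff_eq exp_minus)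
  define Z :: "2 \<Rightarrow> real^3" where "Z i = dd \<kappa> z (axis i 1)" for i
  define w where "w = a ?x + b ?x"
  have t0: "t0 > 0" by (rule leaf_t0[OF z])
  have st: "s ?x $ 4 = t0" using arg_cong[OF leaf'(2)[OF z], of "\<lambda>w. w $ 4"] by (simp add: vector_def)
  have hZ: "h ?x (Z i) (Z j) = t0 / (E * r) * D (axis i 1) (axis j 1)" for i j
    unfolding Z_def leaf'(4)[OF z] E D_def by simp
  have hT: "h ?x (T ?x) (Z i) = 0" "h ?x (Z i) (T ?x) = 0" for i
    using leaf_tau[OF z] sym_bilinear_commute[OF h[OF x]] unfolding Z_def by metis+
  define c where "c = B *v t ?x"
  have c4: "c $ 4 = w * t0"
    using dd_s4[OF x, of "T ?x"] T_T[OF x] st unfolding c_def t_def dd_s[OF x] w_def by (simp add: algebra_simps)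
  have BZ: "B *v dd \<sigma> ?x (Z i) = vector [t0 * axis i 1 $ 1, t0 * axis i 1 $ 2, t0 * dd f z (axis i 1), 0]" for i
    unfolding dd_s[OF x, symmetric] Z_def leaf'(3)[OF z] ..
  have Bxi: "B *v \<xi> ?x = (E * r) *\<^sub>R axis 3 1 - (a ?x - b ?x) *\<^sub>R c"
  proof -
    have "\<xi> ?x = eta ?x - (a ?x - b ?x) *\<^sub>R t ?x" by (simp add: eta_def)
    then show ?thesis
      unfolding c_def E_def using B_eta[OF x]
      by (simp add: matrix_vector_mult_diff_distrib matrix_vector_mult_scaleR)
  qed
  let ?M = "\<chi> i j. (B *v (vector [dd \<sigma> ?x (T ?x), dd \<sigma> ?x (Z 1), dd \<sigma> ?x (Z 2), \<xi> ?x] $ j)) $ i"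
  let ?g = "\<chi> i j. h ?x (vector [T ?x, Z 1, Z 2] $ i) (vector [T ?x, Z 1, Z 2] $ j) :: real^3^3"
  have M: "(det ?M)\<^sup>2 = (det B)\<^sup>2 * \<bar>det ?g\<bar>"
    by (rule frame_volume[OF \<beta> linear_sigma[OF x] h[OF x]])
  have "\<bar>det ?M\<bar> = \<bar>t0 ^ 3 * w * (E * r)\<bar>"
  proof -
    \<comment> \<open>Up to a multiple of the first column, the last one is \<open>E * r\<close>
      times the third axis. What remains is the product of \<open>c $ 4\<close>, two entries
      \<open>t0\<close> and \<open>E * r\<close>, with a sign.\<close>
    have "det ?M = - (t0 ^ 3 * w * (E * r)) \<or> det ?M = t0 ^ 3 * w * (E * r)"
      unfolding det_4 using c4
      by (simp add: vector_def BZ Bxi t_def[symmetric] c_def[symmetric] axis_def power3_eq_cube algebra_simps)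
    then show ?thesis by auto
  qed
  then have M2: "(det ?M)\<^sup>2 = (t0 ^ 3 * w * (E * r))\<^sup>2" by (metis power2_abs)
  have "det ?g = - (h ?x (Z 1) (Z 1) * h ?x (Z 2) (Z 2) - h ?x (Z 1) (Z 2) * h ?x (Z 2) (Z 1))"
    unfolding det_3 by (simp add: hT T_T[OF x])
  also have "\<dots> = - ((t0 / (E * r))\<^sup>2 * det (gram_matrix D))"
    unfolding hZ det_2 by (simp add: gram_matrix_def power2_eq_square algebra_simps)
  finally have g: "\<bar>det ?g\<bar> = (t0 / (E * r))\<^sup>2 * \<bar>det (gram_matrix D)\<bar>" by (simp add: abs_mult)
  have B2: "(det B)\<^sup>2 = r ^ 4" using r_det by (metis power2_abs power2_eq_square power4_eq_xxxx mult.assoc)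
  \<comment> \<open>With t0 = exp(- p - q), w^2 = exp(8 q) and E = exp(p - q) the exponents add up
    to zero.\<close>
  have one: "t0 ^ 4 * w\<^sup>2 * E ^ 4 = 1"
  proof -
    have t: "t0 = exp (- p ?x - q ?x)" using s4[OF x] st by simp
    have "w\<^sup>2 = exp (8 * q ?x)" using a_plus_b[OF x] unfolding q_def w_def by simp
    moreover have "exp y ^ 4 = exp (4 * y)" for y :: real using exp_of_nat_mult[of 4 y] by simp
    ultimately have "t0 ^ 4 * w\<^sup>2 * E ^ 4 = exp (4 * (- p ?x - q ?x)) * exp (8 * q ?x) * exp (4 * (p ?x - q ?x))"
      unfolding t E_def by simp
    then show ?thesis by (simp flip: exp_add)
  qed
  have "(t0 ^ 3 * w * (E * r))\<^sup>2 = r ^ 4 * ((t0 / (E * r))\<^sup>2 * \<bar>det (gram_matrix D)\<bar>)"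
    using M unfolding M2 g B2 .
  moreover have "(t0 ^ 3 * w * (E * r))\<^sup>2 = (r * t0 / E)\<^sup>2 * (t0 ^ 4 * w\<^sup>2 * E ^ 4)"
    using E0 by (simp add: field_simps power2_eq_square power3_eq_cube power4_eq_xxxx)
  moreover have "r ^ 4 * ((t0 / (E * r))\<^sup>2 * \<bar>det (gram_matrix D)\<bar>) = (r * t0 / E)\<^sup>2 * \<bar>det (gram_matrix D)\<bar>"
    using E0 r by (simp add: field_simps power2_eq_square power4_eq_xxxx)
  ultimately have "(r * t0 / E)\<^sup>2 * \<bar>det (gram_matrix D)\<bar> = (r * t0 / E)\<^sup>2 * 1" unfolding one by simp
  then show ?thesis using E0 r t0 by simp
qed

text \<open>For a6 = 0 the value of K on two leaf vectors is a multiple of T, so the cubic form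
  vanishes on the leaf. By \<open>leaf'(5)\<close> the coordinate fields of the leaf have induced
  derivatives along T, orthogonal to the leaf. So the metric coefficients are stationary; p and q
  are stationary too because \<tau> = 0 on the leaf, and the Hessian follows.\<close>

lemma leaf_third_derivative:
  assumes z: "z \<in> N" and c: "canonical_frame (h (\<kappa> z)) (K (\<kappa> z)) a4 0 t' V W" "a4 > 0"
  shows "dd (\<lambda>y. dd (\<lambda>y. dd f y v) y u) z w = 0"
proof -
  let ?x = "\<kappa> z" and ?D = "\<lambda>y. dd (\<lambda>y. dd f y v) y u"
  note x = \<kappa>U[OF z]
  have dk: "\<kappa> differentiable (at z)" by (rule smooth_on_differentiable[OF \<kappa>(1) z])
  have smZ: "smooth_on N (\<lambda>y. dd \<kappa> y v)" for v by (rule smooth_on_dd[OF \<kappa>(1)])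
  have bil: "bilinear (h (\<kappa> y))" if "y \<in> N" for y by (rule bilinear_h[OF \<kappa>U[OF that]])
  have smh: "smooth_on N (\<lambda>y. h (\<kappa> y) v w)" for v w
    by (rule smooth_on_compose[OF N U \<kappa>(2,1) smooth_h])
  note hl = sym_bilinearD[OF h[OF x]] and hc = sym_bilinear_commute[OF h[OF x]]
  have T0: "\<tau> ?x (dd \<kappa> z v) = 0" "h ?x (dd \<kappa> z v) (T ?x) = 0" for v
    using leaf_tau[OF z] hc by metis+
  have "dd (\<lambda>y. h (\<kappa> y) (dd \<kappa> y u) (dd \<kappa> y v)) z w =
      dd (\<lambda>y. h (\<kappa> y) (dd \<kappa> z u) (dd \<kappa> z v)) z w
      + h ?x (dd (\<lambda>y. dd \<kappa> y u) z w) (dd \<kappa> z v) + h ?x (dd \<kappa> z u) (dd (\<lambda>y. dd \<kappa> y v) z w)"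
    by (rule dd_family2[OF N z bil smh smZ smZ])
  also have "dd (\<lambda>y. h (\<kappa> y) (dd \<kappa> z u) (dd \<kappa> z v)) z w = dh ?x (dd \<kappa> z w) (dd \<kappa> z u) (dd \<kappa> z v)"
    by (rule dd_compose[OF dk smooth_on_differentiable[OF smooth_h x]])
  also have "\<dots> = C ?x (dd \<kappa> z w) (dd \<kappa> z u) (dd \<kappa> z v)
      + h ?x (\<Gamma> ?x (dd \<kappa> z w) (dd \<kappa> z u)) (dd \<kappa> z v) + h ?x (dd \<kappa> z u) (\<Gamma> ?x (dd \<kappa> z w) (dd \<kappa> z v))"
    by (simp add: C_def)
  also have "C ?x (dd \<kappa> z w) (dd \<kappa> z u) (dd \<kappa> z v) = 0"
    unfolding C_eq[OF x] K_SO2[OF x c T0(1) T0(1)] hl T0 by simp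
  finally have "dd (\<lambda>y. h (\<kappa> y) (dd \<kappa> y u) (dd \<kappa> y v)) z w =
      h ?x (\<Gamma> ?x (dd \<kappa> z w) (dd \<kappa> z u) + dd (\<lambda>y. dd \<kappa> y u) z w) (dd \<kappa> z v)
      + h ?x (dd \<kappa> z u) (\<Gamma> ?x (dd \<kappa> z w) (dd \<kappa> z v) + dd (\<lambda>y. dd \<kappa> y v) z w)"
    unfolding hl by simp
  also have "\<dots> = 0" unfolding leaf'(5)[OF z] hl T0 by simp
  finally have 0: "dd (\<lambda>y. h (\<kappa> y) (dd \<kappa> y u) (dd \<kappa> y v)) z w = 0" .
  let ?E = "exp (q ?x - p ?x)"
  have "((\<lambda>y. q (\<kappa> y)) has_derivative (\<lambda>w. b ?x * \<tau> ?x (dd \<kappa> z w))) (at z)"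
    "((\<lambda>y. p (\<kappa> y)) has_derivative (\<lambda>w. a ?x * \<tau> ?x (dd \<kappa> z w))) (at z)"
    using has_derivative_compose[OF has_derivative_dd[OF dk] has_derivative_q[OF x]]
      has_derivative_compose[OF has_derivative_dd[OF dk] has_derivative_p[OF x]] .
  then have pq: "((\<lambda>y. q (\<kappa> y)) has_derivative (\<lambda>w. 0)) (at z)" "((\<lambda>y. p (\<kappa> y)) has_derivative (\<lambda>w. 0)) (at z)"
    by (simp_all add: T0)
  have hD: "(?D has_derivative (\<lambda>w. dd ?D z w)) (at z)"
    by (rule smooth_on_has_derivative[OF smooth_on_dd[OF smooth_on_dd[OF leaf'(6)[OF z]]] z])
  have "((\<lambda>y. (t0 / r) * (?D y * exp (q (\<kappa> y) - p (\<kappa> y)))) has_derivative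
    (\<lambda>w. (t0 / r) * (?D z * (?E * (0 - 0)) + dd ?D z w * ?E))) (at z)"
    by (intro has_derivative_mult_right has_derivative_mult has_derivative_exp_left has_derivative_diff pq hD)
  moreover have "h (\<kappa> y) (dd \<kappa> y u) (dd \<kappa> y v) = (t0 / r) * (?D y * exp (q (\<kappa> y) - p (\<kappa> y)))" if "y \<in> N" for y
    unfolding leaf'(4)[OF that] by simp
  ultimately have "((\<lambda>y. h (\<kappa> y) (dd \<kappa> y u) (dd \<kappa> y v)) has_derivative
      (\<lambda>w. (t0 / r) * (?D z * (?E * (0 - 0)) + dd ?D z w * ?E))) (at z)"
    using has_derivative_transform_within_open[OF _ N z] by (metis (no_types, lifting))
  from dd_eq[OF this, of w] have "(t0 / r) * (dd ?D z w * ?E) = 0" unfolding 0 by simp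
  then show ?thesis using leaf_t0[OF z] r by simp
qed

end

end

section \<open>Product coordinates around a point\<close>

definition coord :: "real \<times> (real^2) \<Rightarrow> real^3" where "coord y = vector [fst y, snd y $ 1, snd y $ 2]"

lemma linear_coord: "linear coord"
  by (simp add: linear_iff coord_def vec_eq_iff forall_3)

lemma coord_nth: "coord y $ 1 = fst y" "coord y $ 2 = snd y $ 1" "coord y $ 3 = snd y $ 2"
  by (simp_all add: coord_def)

lemma linear_uncoord: "linear (\<lambda>w::real^3. (w $ 1, vector [w $ 2, w $ 3] :: real^2))"
  by (simp add: linear_iff vec_eq_iff forall_2)

lemma uncoord_coord: "(coord y $ 1, vector [coord y $ 2, coord y $ 3]) = y"
  by (cases y) (simp add: coord_nth vec_eq_iff forall_2)

context normalized_sphere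
begin

text \<open>Inverting \<Psi> over an interval times a disc straightens T. There the t-derivative of
  s3/s4 depends on t alone, so s3/s4 is a function of z plus a function of t; multiplication by s4 =
  t gives t f(z) + \<gamma>(t).\<close>

lemma local_parametrization:
  assumes x0: "x0 \<in> U"
  obtains I :: "real set" and N :: "(real^2) set" and \<Theta> \<omega> \<gamma> f t0
  where "open I" "is_interval I" "open N" "convex N" "t0 \<in> I"
    "smooth_on (I \<times> N) \<Theta>" "\<Theta> ` (I \<times> N) \<subseteq> U" "x0 \<in> \<Theta> ` (I \<times> N)" "open (\<Theta> ` (I \<times> N))"
    "smooth_on (\<Theta> ` (I \<times> N)) \<omega>" "\<And>y. y \<in> I \<times> N \<Longrightarrow> \<omega> (\<Theta> y) = y"
    "smooth_on I \<gamma>" "smooth_on N (\<lambda>z. \<Theta> (t0, z))" "\<forall>z\<in>N. \<Psi> (\<Theta> (t0, z)) = vector [t0, z $ 1, z $ 2]"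
    "f = (\<lambda>z. s (\<Theta> (t0, z)) $ 3 / s (\<Theta> (t0, z)) $ 4)"
    "\<And>t z. t \<in> I \<Longrightarrow> z \<in> N \<Longrightarrow> s (\<Theta> (t, z)) = vector [t * z $ 1, t * z $ 2, t * f z + \<gamma> t, t]"
proof -
  obtain U' V g where g: "open U'" "U' \<subseteq> U" "x0 \<in> U'" "open V" "\<Psi> x0 \<in> V" "homeomorphism U' V \<Psi> g"
    "smooth_on V g" and dg: "\<And>y v. y \<in> V \<Longrightarrow> dd \<Psi> (g y) (dd g y v) = v"
    using smooth_local_inverse[OF U x0 smooth_\<Psi>] inj_dd_\<Psi>[OF x0] by blast
  define y0 where "y0 = (\<Psi> x0 $ 1, vector [\<Psi> x0 $ 2, \<Psi> x0 $ 3] :: real^2)"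
  have cy0: "coord y0 = \<Psi> x0" by (simp add: y0_def coord_def vec_eq_iff forall_3)
  have ccont: "continuous_on UNIV coord" by (rule linear_continuous_on) (simp add: linear_coord linear_conv_bounded_linear[symmetric])
  have "open (coord -` V)" using open_vimage[OF g(4) ccont] .
  moreover have "y0 \<in> coord -` V" using cy0 g(5) by simp
  ultimately obtain A1 A2 where A: "open A1" "open A2" "y0 \<in> A1 \<times> A2" "A1 \<times> A2 \<subseteq> coord -` V"
    by (rule open_prod_elim)
  obtain r1 where r1: "r1 > 0" "ball (fst y0) r1 \<subseteq> A1" using A by (metis mem_Times_iff open_contains_ball)
  obtain r2 where r2: "r2 > 0" "ball (snd y0) r2 \<subseteq> A2" using A by (metis mem_Times_iff open_contains_ball)
  define I where "I = ball (fst y0) r1"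
  define N where "N = ball (snd y0) r2"
  define t0 where "t0 = fst y0"
  define z0 where "z0 = snd y0"
  have I: "open I" "convex I" "is_interval I" "t0 \<in> I"
    using r1 by (simp_all add: I_def t0_def is_interval_convex_1)
  have N: "open N" "convex N" "z0 \<in> N" using r2 by (simp_all add: N_def z0_def)
  have W: "open (I \<times> N)" by (rule open_Times[OF I(1) N(1)])
  have cV: "coord y \<in> V" if "y \<in> I \<times> N" for y
    using that A(4) r1(2) r2(2) unfolding I_def N_def by auto
  define \<Theta> where "\<Theta> y = g (coord y)" for y
  have \<Psi>g: "\<Psi> (g y) = y" "g y \<in> U'" if "y \<in> V" for y using g(6) that by (auto simp: homeomorphism_def)
  have g\<Psi>: "g (\<Psi> x) = x" "\<Psi> x \<in> V" if "x \<in> U'" for x using g(6) that by (auto simp: homeomorphism_def)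
  have \<Psi>\<Theta>: "\<Psi> (\<Theta> y) = coord y" if "y \<in> I \<times> N" for y unfolding \<Theta>_def by (rule \<Psi>g(1)[OF cV[OF that]])
  have \<Theta>U: "\<Theta> y \<in> U" if "y \<in> I \<times> N" for y using \<Psi>g(2)[OF cV[OF that]] g(2) by (auto simp: \<Theta>_def)
  have \<Theta>s: "smooth_on (I \<times> N) \<Theta>"
    unfolding \<Theta>_def using cV
    by (intro smooth_on_compose[OF W g(4) _ smooth_on_linear[OF linear_coord W] g(7)]) auto
  define \<omega> where "\<omega> x = (\<Psi> x $ 1, vector [\<Psi> x $ 2, \<Psi> x $ 3] :: real^2)" for x
  have \<omega>\<Theta>: "\<omega> (\<Theta> y) = y" if "y \<in> I \<times> N" for y unfolding \<omega>_def \<Psi>\<Theta>[OF that] by (rule uncoord_coord)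
  have \<omega>s: "smooth_on U \<omega>"
    unfolding \<omega>_def[abs_def] by (rule smooth_on_linear_compose[OF linear_uncoord U smooth_\<Psi>])
  have im: "\<Theta> ` (I \<times> N) = U' \<inter> \<omega> -` (I \<times> N)"
  proof (intro equalityI subsetI)
    fix x assume "x \<in> \<Theta> ` (I \<times> N)"
    then show "x \<in> U' \<inter> \<omega> -` (I \<times> N)" using \<omega>\<Theta> \<Psi>g(2) cV by (auto simp: \<Theta>_def)
  next
    fix x assume x: "x \<in> U' \<inter> \<omega> -` (I \<times> N)"
    have "coord (\<omega> x) = \<Psi> x" by (simp add: \<omega>_def coord_def vec_eq_iff forall_3)
    then have "\<Theta> (\<omega> x) = x" using g\<Psi> x by (simp add: \<Theta>_def)
    then show "x \<in> \<Theta> ` (I \<times> N)" using x by (metis IntD2 imageI vimageE)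
  qed
  have oim: "open (\<Theta> ` (I \<times> N))"
    unfolding im
    by (rule continuous_open_preimage[OF continuous_on_subset[OF smooth_on_continuous[OF \<omega>s] g(2)] g(1) W])
  have y0: "y0 \<in> I \<times> N" using I(4) N(3) by (simp add: t0_def z0_def mem_Times_iff)
  have x0im: "x0 \<in> \<Theta> ` (I \<times> N)"
  proof -
    have "\<Theta> y0 = x0" unfolding \<Theta>_def cy0 by (rule g\<Psi>(1)[OF g(3)])
    then show ?thesis using y0 by blast
  qed
  define F where "F x = s x $ 3 / s x $ 4" for x
  have Fs: "smooth_on U F" unfolding F_def[abs_def] by (rule smooth_quotient)
  have s\<Theta>: "s (\<Theta> (t, z)) = vector [t * z $ 1, t * z $ 2, t * F (\<Theta> (t, z)), t]" if "t \<in> I" "z \<in> N" for t z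
  proof -
    have y: "(t, z) \<in> I \<times> N" using that by simp
    show ?thesis
      using s_eq_vector[OF \<Theta>U[OF y], of t "z $ 1" "z $ 2"] \<Psi>\<Theta>[OF y] by (simp add: F_def coord_def)
  qed
  have dcoord: "((\<lambda>t. coord (t, z)) has_derivative (\<lambda>d. coord (d, 0))) (at t)"
    "((\<lambda>z. coord (t, z)) has_derivative (\<lambda>d. coord (0, d))) (at z)" for t z
  proof -
    have c: "(coord has_derivative coord) (at y)" for y
      using linear_coord by (intro bounded_linear_imp_has_derivative) (simp add: linear_conv_bounded_linear)
    have "((\<lambda>t. (t, z)) has_derivative (\<lambda>d. (d, 0))) (at t)" "((\<lambda>z. (t, z)) has_derivative (\<lambda>d. (0, d))) (at z)"
      by (auto intro!: derivative_eq_intros)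
    from has_derivative_compose[OF this(1) c] has_derivative_compose[OF this(2) c]
    show "((\<lambda>t. coord (t, z)) has_derivative (\<lambda>d. coord (d, 0))) (at t)"
      "((\<lambda>z. coord (t, z)) has_derivative (\<lambda>d. coord (0, d))) (at z)" .
  qed
  have d\<Theta>: "((\<lambda>t. \<Theta> (t, z)) has_derivative (\<lambda>d. dd g (coord (t, z)) (coord (d, 0)))) (at t)"
    "((\<lambda>z. \<Theta> (t, z)) has_derivative (\<lambda>d. dd g (coord (t, z)) (coord (0, d)))) (at z)"
    if "t \<in> I" "z \<in> N" for t z
  proof -
    have y: "(t, z) \<in> I \<times> N" using that by simp
    show "((\<lambda>t. \<Theta> (t, z)) has_derivative (\<lambda>d. dd g (coord (t, z)) (coord (d, 0)))) (at t)"
      unfolding \<Theta>_def by (rule has_derivative_compose[OF dcoord(1) smooth_on_has_derivative[OF g(7) cV[OF y]]])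
    show "((\<lambda>z. \<Theta> (t, z)) has_derivative (\<lambda>d. dd g (coord (t, z)) (coord (0, d)))) (at z)"
      unfolding \<Theta>_def by (rule has_derivative_compose[OF dcoord(2) smooth_on_has_derivative[OF g(7) cV[OF y]]])
  qed
  define E where "E t z = exp (p (\<Theta> (t, z)) - q (\<Theta> (t, z)))" for t z
  \<comment> \<open>On a leaf \<tau> vanishes, and dp and dq are multiples of \<tau>.\<close>
  have E_const: "E t z = E t z0" if t: "t \<in> I" and z: "z \<in> N" for t z
  proof (rule has_derivative_zero_eq[OF N(2,1) _ z N(3)])
    fix z assume z: "z \<in> N"
    have y: "(t, z) \<in> I \<times> N" using t z by simp
    note x = \<Theta>U[OF y]
    have 0: "\<tau> (\<Theta> (t, z)) (dd g (coord (t, z)) (coord (0, d))) = 0" for d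
    proof (rule tau_eq_0[OF x])
      have "dd \<Psi> (\<Theta> (t, z)) (dd g (coord (t, z)) (coord (0, d))) = coord (0, d)"
        unfolding \<Theta>_def by (rule dg[OF cV[OF y]])
      then show "dd \<Psi> (\<Theta> (t, z)) (dd g (coord (t, z)) (coord (0, d))) $ 1 = 0" by (simp add: coord_nth)
    qed
    have "((\<lambda>z. E t z) has_derivative (\<lambda>d. exp (p (\<Theta> (t, z)) - q (\<Theta> (t, z))) *
       (a (\<Theta> (t, z)) * \<tau> (\<Theta> (t, z)) (dd g (coord (t, z)) (coord (0, d)))
       - b (\<Theta> (t, z)) * \<tau> (\<Theta> (t, z)) (dd g (coord (t, z)) (coord (0, d)))))) (at z)"
      unfolding E_def
      by (intro has_derivative_exp_left has_derivative_diff
          has_derivative_compose[OF d\<Theta>(2)[OF t z] has_derivative_p[OF x]]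
          has_derivative_compose[OF d\<Theta>(2)[OF t z] has_derivative_q[OF x]])
    then show "((\<lambda>z. E t z) has_derivative (\<lambda>_. 0)) (at z)" unfolding 0 by simp
  qed
  have dF: "((\<lambda>t. F (\<Theta> (t, z))) has_derivative (\<lambda>d. d * (E t z0 * r / (H * t * t)))) (at t)"
    if t: "t \<in> I" and z: "z \<in> N" for t z
  proof -
    have y: "(t, z) \<in> I \<times> N" using t z by simp
    let ?x = "\<Theta> (t, z)"
    note x = \<Theta>U[OF y]
    have st: "s ?x $ 4 = t" using arg_cong[OF s\<Theta>[OF t z], of "\<lambda>w. w $ 4"] by (simp add: vector_def)
    have t0: "t > 0" using s4_pos[OF x] st by simp
    have l\<Psi>: "linear (dd \<Psi> ?x)" using smooth_on_linear_dd[OF smooth_\<Psi> x] by simp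
    have lF: "linear (dd F ?x)" using smooth_on_linear_dd[OF Fs x] by simp
    \<comment> \<open>The coordinate lines in the t-direction are reparametrized integral curves of
      T, since \<Psi> sends T to (a + b) s4 times the first axis.\<close>
    have dgT: "dd g (coord (t, z)) (coord (d, 0)) = (d / ((a ?x + b ?x) * t)) *\<^sub>R T ?x" for d
    proof (rule injD[OF inj_dd_\<Psi>[OF x]])
      have "dd \<Psi> ?x (dd g (coord (t, z)) (coord (d, 0))) = coord (d, 0)"
        unfolding \<Theta>_def by (rule dg[OF cV[OF y]])
      also have "\<dots> = dd \<Psi> ?x ((d / ((a ?x + b ?x) * t)) *\<^sub>R T ?x)"
        unfolding linear_cmul[OF l\<Psi>] dd_\<Psi>_T[OF x] st using a_plus_b[OF x] t0
        by (simp add: vec_eq_iff forall_3 coord_nth axis_def)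
      finally show "dd \<Psi> ?x (dd g (coord (t, z)) (coord (d, 0))) = dd \<Psi> ?x ((d / ((a ?x + b ?x) * t)) *\<^sub>R T ?x)" .
    qed
    have "((\<lambda>t. F (\<Theta> (t, z))) has_derivative (\<lambda>d. dd F ?x (dd g (coord (t, z)) (coord (d, 0))))) (at t)"
      by (rule has_derivative_compose[OF d\<Theta>(1)[OF t z] smooth_on_has_derivative[OF Fs x]])
    moreover have "dd F ?x (dd g (coord (t, z)) (coord (d, 0))) = d * (E t z0 * r / (H * t * t))" for d
    proof -
      have "dd F ?x (T ?x) = E t z * r / ((a ?x - b ?x) * t)"
        using dd_height_T[OF x] unfolding F_def[abs_def] E_def st .
      then have "dd F ?x (dd g (coord (t, z)) (coord (d, 0))) =
          (d / ((a ?x + b ?x) * t)) * (E t z0 * r / ((a ?x - b ?x) * t))"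
        unfolding dgT linear_cmul[OF lF] E_const[OF t z] by simp
      \<comment> \<open>The coefficients a and b occur only in the product (a - b)(a + b) = H, so
        nothing depending on z is left.\<close>
      also have "\<dots> = d * (E t z0 * r / (((a ?x - b ?x) * (a ?x + b ?x)) * t * t))" by (simp add: mult_ac)
      finally show ?thesis unfolding H_factor[OF x, symmetric] .
    qed
    ultimately show ?thesis by simp
  qed
  have split: "F (\<Theta> (t, z)) = F (\<Theta> (t0, z)) + (F (\<Theta> (t, z0)) - F (\<Theta> (t0, z0)))" if t: "t \<in> I" and z: "z \<in> N" for t z
  proof -
    have "F (\<Theta> (t, z)) - F (\<Theta> (t, z0)) = F (\<Theta> (t0, z)) - F (\<Theta> (t0, z0))"
    proof (rule has_derivative_zero_eq[OF I(2,1) _ t I(4)])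
      fix t assume t: "t \<in> I"
      show "((\<lambda>t. F (\<Theta> (t, z)) - F (\<Theta> (t, z0))) has_derivative (\<lambda>_. 0)) (at t)"
        using has_derivative_diff[OF dF[OF t z] dF[OF t N(3)]] by simp
    qed
    then show ?thesis by simp
  qed
  have slice: "smooth_on N (\<lambda>z. \<Theta> (t, z))" if "t \<in> I" for t
  proof (rule smooth_on_compose[OF N(1) W _ _ \<Theta>s])
    show "smooth_on N (\<lambda>z. (t, z))"
    proof -
      have "smooth_on N (\<lambda>z. (t, 0) + (0, z))"
        by (intro smooth_on_add smooth_on_const N(1) smooth_on_linear) (simp add: linear_iff)
      then show ?thesis by simp
    qed
  qed (use that in auto)
  have slice': "smooth_on I (\<lambda>t. \<Theta> (t, z0))"
  proof (rule smooth_on_compose[OF I(1) W _ _ \<Theta>s])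
    show "smooth_on I (\<lambda>t. (t, z0))"
    proof -
      have "smooth_on I (\<lambda>t. (0, z0) + (t, 0))"
        by (intro smooth_on_add smooth_on_const I(1) smooth_on_linear) (simp add: linear_iff)
      then show ?thesis by simp
    qed
  qed (use N(3) in auto)
  \<comment> \<open>Normalized to vanish at \<open>t0\<close>, since f already carries the values of
    s3/s4 on the leaf over \<open>t0\<close>.\<close>
  define \<gamma> where "\<gamma> t = t * (F (\<Theta> (t, z0)) - F (\<Theta> (t0, z0)))" for t
  show thesis
  proof (rule that[of I N t0 \<Theta> \<omega> \<gamma>])
    show "smooth_on I \<gamma>"
      unfolding \<gamma>_def[abs_def] using \<Theta>U N(3)
      by (intro smooth_on_mult smooth_on_diff smooth_on_const smooth_on_ident I(1)
          smooth_on_compose[OF I(1) U _ slice' Fs]) auto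
    show "smooth_on (\<Theta> ` (I \<times> N)) \<omega>" by (rule smooth_on_subset[OF \<omega>s]) (use \<Theta>U in blast)
    show "\<forall>z\<in>N. \<Psi> (\<Theta> (t0, z)) = vector [t0, z $ 1, z $ 2]"
      using \<Psi>\<Theta> I(4) by (simp add: coord_def)
    show "s (\<Theta> (t, z)) = vector [t * z $ 1, t * z $ 2, t * (s (\<Theta> (t0, z)) $ 3 / s (\<Theta> (t0, z)) $ 4) + \<gamma> t, t]"
      if "t \<in> I" "z \<in> N" for t z
      unfolding s\<Theta>[OF that] split[OF that] \<gamma>_def unfolding F_def by (simp add: algebra_simps)
  qed (use I N \<Theta>s \<Theta>U x0im oim \<omega>\<Theta> slice in auto)
qed

end

text \<open>\<Theta> is a diffeomorphism onto an open part of the chart domain with inverse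
  \<omega>, so the new transition maps are those of the atlas composed with \<Theta> or
  \<omega>.\<close>

lemma smooth_parametrization_compose:
  fixes A :: "((real^'n) set \<times> (real^'n \<Rightarrow> 'p::topological_space)) set"
    and \<Theta> :: "'b::euclidean_space \<Rightarrow> real^'n"
  assumes at: "oriented_atlas M A" and Dc: "(D, c) \<in> A"
    and W: "open W" and \<Theta>: "smooth_on W \<Theta>" "\<Theta> ` W \<subseteq> D" "open (\<Theta> ` W)"
    and \<omega>: "smooth_on (\<Theta> ` W) \<omega>" "\<And>y. y \<in> W \<Longrightarrow> \<omega> (\<Theta> y) = y"
  shows "smooth_parametrization M A W (\<lambda>y. c (\<Theta> y))"
proof -
  have tp: "topological_parametrization M D c"
    using at Dc unfolding oriented_atlas_def smooth_parametrization_def by blast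
  then have oD: "open D" and oc: "openin (top_of_set M) (c ` D)" and hom: "homeomorphism D (c ` D) c (inv_into D c)"
    by (auto simp: topological_parametrization_def)
  have injc: "inj_on c D" using hom by (metis homeomorphism_def inj_on_inverseI)
  have inj\<Theta>: "inj_on \<Theta> W" by (rule inj_on_inverseI[of _ \<omega>]) (rule \<omega>(2))
  have injc\<Theta>: "inj_on (\<lambda>y. c (\<Theta> y)) W"
    using comp_inj_on[OF inj\<Theta> inj_on_subset[OF injc \<Theta>(2)]] by (simp add: o_def)
  have "openin (top_of_set D) (\<Theta> ` W)" using \<Theta>(2,3) by (simp add: openin_open_eq oD)
  then have "openin (top_of_set (c ` D)) (c ` \<Theta> ` W)" by (rule homeomorphism_imp_open_map[OF hom])
  then have oim: "openin (top_of_set M) ((\<lambda>y. c (\<Theta> y)) ` W)" using oc openin_trans by (metis image_image)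
  have h1: "homeomorphism W (\<Theta> ` W) \<Theta> \<omega>"
    unfolding homeomorphism_def using smooth_on_continuous[OF \<Theta>(1)] smooth_on_continuous[OF \<omega>(1)] \<omega>(2)
    by (auto simp: image_image)
  have h2: "homeomorphism (\<Theta> ` W) (c ` \<Theta> ` W) c (inv_into D c)"
    by (rule homeomorphism_of_subsets[OF hom \<Theta>(2)]) (use \<Theta>(2) in auto)
  have h3: "homeomorphism W (c ` \<Theta> ` W) (c \<circ> \<Theta>) (\<omega> \<circ> inv_into D c)"
    by (rule homeomorphism_compose[OF h1 h2])
  have inv: "inv_into W (\<lambda>y. c (\<Theta> y)) x = \<omega> (inv_into D c x)" if x: "x \<in> (\<lambda>y. c (\<Theta> y)) ` W" for x
  proof -
    obtain y where y: "y \<in> W" "x = c (\<Theta> y)" using x by blast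
    have "inv_into D c x = \<Theta> y" unfolding y(2) by (rule inv_into_f_f[OF injc]) (use y \<Theta>(2) in auto)
    then show ?thesis using inv_into_f_f[OF injc\<Theta> y(1)] y \<omega>(2) by simp
  qed
  have "homeomorphism W ((\<lambda>y. c (\<Theta> y)) ` W) (\<lambda>y. c (\<Theta> y)) (inv_into W (\<lambda>y. c (\<Theta> y)))"
    by (rule homeomorphism_cong[OF h3]) (auto simp: image_image inv)
  then have top: "topological_parametrization M W (\<lambda>y. c (\<Theta> y))"
    unfolding topological_parametrization_def using W oim by blast
  have "smooth_on (W \<inter> (\<lambda>y. c (\<Theta> y)) -` (c' ` D')) (transition D' c' (\<lambda>y. c (\<Theta> y)))"
    "smooth_on (D' \<inter> c' -` ((\<lambda>y. c (\<Theta> y)) ` W)) (transition W (\<lambda>y. c (\<Theta> y)) c')" if D': "(D', c') \<in> A" for D' c'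
  proof -
    note tr = transition_properties[OF at Dc D'] and tr' = transition_properties[OF at D' Dc]
    let ?V = "D \<inter> c -` (c' ` D')" and ?V' = "D' \<inter> c' -` (c ` D)"
    have e: "W \<inter> (\<lambda>y. c (\<Theta> y)) -` (c' ` D') = W \<inter> \<Theta> -` ?V" using \<Theta>(2) by auto
    have o1: "open (W \<inter> \<Theta> -` ?V)"
      by (rule continuous_open_preimage[OF smooth_on_continuous[OF \<Theta>(1)] W tr(1)])
    have "smooth_on (W \<inter> \<Theta> -` ?V) (\<lambda>y. transition D' c' c (\<Theta> y))"
      by (rule smooth_on_compose[OF o1 tr(1) _ smooth_on_subset[OF \<Theta>(1)] tr(2)]) auto
    then show "smooth_on (W \<inter> (\<lambda>y. c (\<Theta> y)) -` (c' ` D')) (transition D' c' (\<lambda>y. c (\<Theta> y)))"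
      unfolding e by (simp add: transition_def o_def)
    let ?\<theta> = "transition D c c'"
    have im: "c' y \<in> (\<lambda>y. c (\<Theta> y)) ` W \<longleftrightarrow> ?\<theta> y \<in> \<Theta> ` W" if "y \<in> ?V'" for y
    proof
      assume "c' y \<in> (\<lambda>y. c (\<Theta> y)) ` W"
      then obtain w where w: "w \<in> W" "c' y = c (\<Theta> w)" by blast
      then have "?\<theta> y = \<Theta> w"
        unfolding transition_def o_def using inv_into_f_f[OF injc, of "\<Theta> w"] \<Theta>(2) by auto
      then show "?\<theta> y \<in> \<Theta> ` W" using w by blast
    next
      assume "?\<theta> y \<in> \<Theta> ` W"
      then obtain w where w: "w \<in> W" "?\<theta> y = \<Theta> w" by blast
      have "c' y = c (\<Theta> w)" using tr'(5)[OF that] w(2) by simp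
      then show "c' y \<in> (\<lambda>y. c (\<Theta> y)) ` W" using w(1) by blast
    qed
    have e': "D' \<inter> c' -` ((\<lambda>y. c (\<Theta> y)) ` W) = ?V' \<inter> ?\<theta> -` (\<Theta> ` W)"
      using im \<Theta>(2) by blast
    have o2: "open (?V' \<inter> ?\<theta> -` (\<Theta> ` W))"
      by (rule continuous_open_preimage[OF smooth_on_continuous[OF tr'(2)] tr'(1) \<Theta>(3)])
    have "smooth_on (?V' \<inter> ?\<theta> -` (\<Theta> ` W)) (\<lambda>y. \<omega> (?\<theta> y))"
      by (rule smooth_on_compose[OF o2 \<Theta>(3) _ smooth_on_subset[OF tr'(2)] \<omega>(1)]) auto
    then have "smooth_on (?V' \<inter> ?\<theta> -` (\<Theta> ` W)) (transition W (\<lambda>y. c (\<Theta> y)) c')"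
    proof (rule smooth_on_cong[OF _ o2])
      fix y assume "y \<in> ?V' \<inter> ?\<theta> -` (\<Theta> ` W)"
      then have "c' y \<in> (\<lambda>y. c (\<Theta> y)) ` W" using im by blast
      from inv[OF this] show "\<omega> (?\<theta> y) = transition W (\<lambda>y. c (\<Theta> y)) c' y" by (simp add: transition_def)
    qed
    then show "smooth_on (D' \<inter> c' -` ((\<lambda>y. c (\<Theta> y)) ` W)) (transition W (\<lambda>y. c (\<Theta> y)) c')" unfolding e' .
  qed
  then show ?thesis unfolding smooth_parametrization_def using top by auto
qed

section \<open>Graphs\<close>

lemma dd_graph_immersion:
  assumes "f differentiable (at z)"
  shows "dd (graph_immersion f) z u = vector [u $ 1, u $ 2, dd f z u]"
proof (rule dd_eq)
  have c: "((\<lambda>y::real^2. y $ i) has_derivative (\<lambda>v. v $ i)) (at z)" for i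
    by (intro bounded_linear_imp_has_derivative bounded_linear_vec_nth)
  have "((\<lambda>y. y $ 1 *\<^sub>R axis 1 1 + y $ 2 *\<^sub>R axis 2 1 + f y *\<^sub>R axis 3 1 :: real^3) has_derivative
    (\<lambda>v. v $ 1 *\<^sub>R axis 1 1 + v $ 2 *\<^sub>R axis 2 1 + dd f z v *\<^sub>R axis 3 1)) (at z)"
    by (intro has_derivative_add has_derivative_scaleR_left c has_derivative_dd assms)
  moreover have "(\<lambda>y. y $ 1 *\<^sub>R axis 1 1 + y $ 2 *\<^sub>R axis 2 1 + f y *\<^sub>R axis 3 1) = graph_immersion f"
    by (simp add: fun_eq_iff vec_eq_iff forall_3 graph_immersion_def axis_def)
  moreover have "(\<lambda>v. v $ 1 *\<^sub>R axis 1 1 + v $ 2 *\<^sub>R axis 2 1 + dd f z v *\<^sub>R axis 3 1) =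
      (\<lambda>u. vector [u $ 1, u $ 2, dd f z u] :: real^3)"
    by (simp add: fun_eq_iff vec_eq_iff forall_3 axis_def)
  ultimately show "(graph_immersion f has_derivative (\<lambda>u. vector [u $ 1, u $ 2, dd f z u])) (at z)" by simp
qed

lemma smooth_graph_immersion:
  assumes "open N" "smooth_on N f" shows "smooth_on N (graph_immersion f)"
proof (rule smooth_on_vec[OF assms(1)])
  fix i :: 3
  show "smooth_on N (\<lambda>z. graph_immersion f z $ i)"
    using exhaust_3[of i] smooth_on_nth[OF assms(1) smooth_on_ident[OF assms(1)]] assms(2)
    by (auto simp: graph_immersion_def)
qed

text \<open>The second derivatives of a graph are Hess f times (0, 0, 1). With this constant
  transversal field the affine metric is the Hessian, the shape operator vanishes and the frame
  determinant is 1, so the volume condition is the Monge-Ampere equation for f.\<close>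

lemma improper_affine_sphere_graph:
  fixes f :: "real^2 \<Rightarrow> real"
  assumes N: "open N" and f: "smooth_on N f"
    and pos: "\<And>z v. z \<in> N \<Longrightarrow> v \<noteq> 0 \<Longrightarrow> dd (\<lambda>y. dd f y v) z v > 0"
    and det: "\<And>z. z \<in> N \<Longrightarrow> \<bar>det (gram_matrix (\<lambda>u v. dd (\<lambda>y. dd f y v) z u))\<bar> = 1"
  shows "affine_sphere_on N (graph_immersion f) (\<lambda>_. vector [0, 0, 1]) 0"
    "z \<in> N \<Longrightarrow> positive_definite (affine_metric (graph_immersion f) (\<lambda>_. vector [0, 0, 1]) z)"
proof -
  let ?\<psi> = "graph_immersion f" and ?e = "\<lambda>_. vector [0, 0, 1] :: real^3"
  have df: "f differentiable (at z)" if "z \<in> N" for z by (rule smooth_on_differentiable[OF f that])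
  note d\<psi> = dd_graph_immersion[OF df]
  have sm: "smooth_on N ?\<psi>" by (rule smooth_graph_immersion[OF N f])
  have d2: "dd (\<lambda>y. dd ?\<psi> y v) z u = dd (\<lambda>y. dd f y v) z u *\<^sub>R vector [0, 0, 1]" if z: "z \<in> N" for z u v
  proof -
    have "dd (\<lambda>y. dd ?\<psi> y v) z u = dd (\<lambda>y. vector [v $ 1, v $ 2, 0] + dd f y v *\<^sub>R vector [0, 0, 1]) z u"
      by (rule dd_cong[OF N z smooth_on_differentiable[OF smooth_on_dd[OF sm] z]])
        (simp add: d\<psi> vec_eq_iff forall_3)
    also have "\<dots> = 0 + dd (\<lambda>y. dd f y v) z u *\<^sub>R vector [0, 0, 1]"
      by (rule dd_eq) (intro has_derivative_add has_derivative_const has_derivative_scaleR_left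
          smooth_on_has_derivative[OF smooth_on_dd[OF f] z])
    finally show ?thesis by simp
  qed
  have am: "affine_metric ?\<psi> ?e z = (\<lambda>u v. dd (\<lambda>y. dd f y v) z u)" if z: "z \<in> N" for z
  proof (intro ext)
    fix u v
    have l: "linear (dd f z)" using smooth_on_linear_dd[OF f z] by simp
    show "affine_metric ?\<psi> ?e z u v = dd (\<lambda>y. dd f y v) z u"
      unfolding affine_metric_def d2[OF z] d\<psi>[OF z]
    proof (rule the_equality)
      show "\<exists>w. dd (\<lambda>y. dd f y v) z u *\<^sub>R vector [0, 0, 1] =
        vector [w $ 1, w $ 2, dd f z w] + dd (\<lambda>y. dd f y v) z u *\<^sub>R (vector [0, 0, 1] :: real^3)"
        by (rule exI[of _ 0]) (simp add: vec_eq_iff forall_3 linear_0[OF l])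
      fix r assume "\<exists>w. dd (\<lambda>y. dd f y v) z u *\<^sub>R vector [0, 0, 1] =
        vector [w $ 1, w $ 2, dd f z w] + r *\<^sub>R (vector [0, 0, 1] :: real^3)"
      then obtain w :: "real^2" where w: "dd (\<lambda>y. dd f y v) z u *\<^sub>R vector [0, 0, 1] =
        vector [w $ 1, w $ 2, dd f z w] + r *\<^sub>R (vector [0, 0, 1] :: real^3)" by blast
      then have "w $ 1 = 0" "w $ 2 = 0" "dd (\<lambda>y. dd f y v) z u = dd f z w + r"
        by (simp_all add: vec_eq_iff forall_3)
      moreover then have "w = 0" by (simp add: vec_eq_iff forall_2)
      ultimately show "r = dd (\<lambda>y. dd f y v) z u" by (simp add: linear_0[OF l])
    qed
  qed
  show "positive_definite (affine_metric ?\<psi> ?e z)" if "z \<in> N"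
    unfolding am[OF that] positive_definite_def using pos[OF that] by blast
  \<comment> \<open>The order with the transversal vector last, for which the frame determinant is
    1.\<close>
  define \<beta> :: "3 \<Rightarrow> 2 option" where "\<beta> j = (if j = 1 then Some 1 else if j = 2 then Some 2 else None)" for j
  have \<beta>: "bij \<beta>"
  proof (rule bijI)
    show "inj \<beta>" unfolding inj_def forall_3 by (simp add: \<beta>_def)
    have "y \<in> range \<beta>" for y
    proof (cases y)
      case None
      then have "y = \<beta> 3" by (simp add: \<beta>_def)
      then show ?thesis by blast
    next
      case (Some k)
      then have "y = \<beta> (if k = 1 then 1 else 2)" using exhaust_2[of k] by (auto simp: \<beta>_def)
      then show ?thesis by blast
    qed
    then show "surj \<beta>" by blast
  qed
  have de: "dd ?e z u = 0" for z u :: "real^2" by (rule dd_eq[OF has_derivative_const])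
  have inj: "inj (dd ?\<psi> z)" if z: "z \<in> N" for z
    unfolding inj_def d\<psi>[OF z] by (simp add: vec_eq_iff forall_3 forall_2)
  have bl: "blaschke_immersion N ?\<psi> ?e"
    unfolding blaschke_immersion_def
  proof (intro conjI ballI sm smooth_on_const N)
    fix z assume z: "z \<in> N"
    show "inj (dd ?\<psi> z)" by (rule inj[OF z])
    show "vector [0, 0, 1] \<notin> range (dd ?\<psi> z)"
    proof
      assume "vector [0, 0, 1] \<in> range (dd ?\<psi> z)"
      then obtain w :: "real^2" where w: "vector [0, 0, 1] = (vector [w $ 1, w $ 2, dd f z w] :: real^3)"
        using d\<psi>[OF z] by auto
      then have "w = 0" "dd f z w = 1" by (simp_all add: vec_eq_iff forall_3 forall_2)
      then show False using linear_0[OF linear_frechet_derivative[OF df[OF z]]] by simp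
    qed
    show "\<forall>u. u \<noteq> 0 \<longrightarrow> (\<exists>v. affine_metric ?\<psi> ?e z u v \<noteq> 0)"
      unfolding am[OF z] using pos[OF z] by (metis less_irrefl)
    show "range (dd ?e z) \<subseteq> range (dd ?\<psi> z)"
    proof -
      have "dd ?\<psi> z 0 = 0" using linear_0[OF linear_frechet_derivative[OF smooth_on_differentiable[OF sm z]]] .
      then show ?thesis using de by (metis (no_types, lifting) image_subset_iff rangeI)
    qed
    show "\<exists>b. bij b \<and> \<bar>det (frame_matrix b ?\<psi> ?e z)\<bar> = sqrt \<bar>det (gram_matrix (affine_metric ?\<psi> ?e z))\<bar>"
    proof (rule exI[of _ \<beta>], rule conjI[OF \<beta>])
      have "det (frame_matrix \<beta> ?\<psi> ?e z) = 1"
        unfolding det_3 by (simp add: frame_matrix_def \<beta>_def d\<psi>[OF z] axis_def)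
      then show "\<bar>det (frame_matrix \<beta> ?\<psi> ?e z)\<bar> = sqrt \<bar>det (gram_matrix (affine_metric ?\<psi> ?e z))\<bar>"
        unfolding am[OF z] det[OF z] by simp
    qed
  qed
  show "affine_sphere_on N ?\<psi> ?e 0"
    unfolding affine_sphere_on_def
  proof (intro conjI bl ballI allI)
    fix z u assume z: "z \<in> N"
    have l: "linear (dd ?\<psi> z)" using smooth_on_linear_dd[OF sm z] by simp
    have "shape_operator ?\<psi> ?e z u = 0"
      unfolding shape_operator_def de
    proof (rule the_equality)
      show "0 = - dd ?\<psi> z 0" by (simp add: linear_0[OF l])
      fix w assume "0 = - dd ?\<psi> z w"
      then have "dd ?\<psi> z w = dd ?\<psi> z 0" by (simp add: linear_0[OF l])
      then show "w = 0" using inj[OF z] by (auto dest: injD)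
    qed
    then show "shape_operator ?\<psi> ?e z u = 0 *\<^sub>R u" by simp
  qed
qed

section \<open>Quadratic graphs\<close>

lemma elliptic_paraboloid_quadratic:
  fixes z0 :: "real^2"
  assumes A: "A > 0" and d: "A * C - B\<^sup>2 > 0"
  shows "elliptic_paraboloid {w. w $ 3 = f0 + l1 * (w $ 1 - z0 $ 1) + l2 * (w $ 2 - z0 $ 2)
     + (A * (w $ 1 - z0 $ 1)\<^sup>2 + 2 * B * (w $ 1 - z0 $ 1) * (w $ 2 - z0 $ 2) + C * (w $ 2 - z0 $ 2)\<^sup>2) / 2}"
    (is "elliptic_paraboloid ?P")
proof -
  \<comment> \<open>Completing the square: half the quadratic form is (\<alpha> (x + B y / A))^2 +
    (\<delta> y)^2. \<open>L'\<close> takes the two roots as coordinates and subtracts the linear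
    part from the height; \<open>L\<close> is its inverse.\<close>
  define \<alpha> where "\<alpha> = sqrt (A / 2)"
  define \<delta> where "\<delta> = sqrt ((A * C - B\<^sup>2) / (2 * A))"
  have \<alpha>: "\<alpha> > 0" "\<alpha>\<^sup>2 = A / 2" using A by (simp_all add: \<alpha>_def)
  have \<delta>: "\<delta> > 0" "\<delta>\<^sup>2 = (A * C - B\<^sup>2) / (2 * A)" using A d by (simp_all add: \<delta>_def)
  define b1 where "b1 q = q $ 1 / \<alpha> - (B / A) * (q $ 2 / \<delta>)" for q :: "real^3"
  define b2 where "b2 q = q $ 2 / \<delta>" for q :: "real^3"
  define L where "L q = (vector [b1 q, b2 q, l1 * b1 q + l2 * b2 q + q $ 3] :: real^3)" for q
  define L' where "L' w = (vector [\<alpha> * (w $ 1 + B / A * w $ 2), \<delta> * w $ 2, w $ 3 - l1 * w $ 1 - l2 * w $ 2] :: real^3)" for w :: "real^3"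
  define v0 where "v0 = (vector [z0 $ 1, z0 $ 2, f0] :: real^3)"
  have LL': "L (L' w) = w" and L'L: "L' (L q) = q" for w q
    using \<alpha>(1) \<delta>(1) by (simp_all add: L_def L'_def b1_def b2_def vec_eq_iff forall_3 field_simps)
  have "bij L" by (rule o_bij[of L']) (simp_all add: fun_eq_iff LL' L'L)
  moreover have "linear L"
    by (simp add: linear_iff L_def b1_def b2_def vec_eq_iff forall_3 algebra_simps add_divide_distrib)
  ultimately have aff: "affine_transformation (\<lambda>q. L q + v0)" unfolding affine_transformation_def by blast
  have key: "(A * x\<^sup>2 + 2 * B * x * y + C * y\<^sup>2) / 2 = (\<alpha> * (x + B / A * y))\<^sup>2 + (\<delta> * y)\<^sup>2" for x y
    unfolding power_mult_distrib \<alpha>(2) \<delta>(2) using A by (simp add: field_simps power2_eq_square)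
  have mem: "w \<in> ?P \<longleftrightarrow> (L' (w - v0)) $ 3 = ((L' (w - v0)) $ 1)\<^sup>2 + ((L' (w - v0)) $ 2)\<^sup>2" for w
    unfolding mem_Collect_eq key by (auto simp: L'_def v0_def algebra_simps)
  have "?P = (\<lambda>q. L q + v0) ` {q. q $ 3 = (q $ 1)\<^sup>2 + (q $ 2)\<^sup>2}"
  proof (intro equalityI subsetI)
    fix w assume "w \<in> ?P"
    then have "L' (w - v0) \<in> {q. q $ 3 = (q $ 1)\<^sup>2 + (q $ 2)\<^sup>2}" using mem by simp
    moreover have "w = L (L' (w - v0)) + v0" by (simp add: LL')
    ultimately show "w \<in> (\<lambda>q. L q + v0) ` {q. q $ 3 = (q $ 1)\<^sup>2 + (q $ 2)\<^sup>2}" by blast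
  next
    fix w assume "w \<in> (\<lambda>q. L q + v0) ` {q. q $ 3 = (q $ 1)\<^sup>2 + (q $ 2)\<^sup>2}"
    then obtain q where q: "q $ 3 = (q $ 1)\<^sup>2 + (q $ 2)\<^sup>2" "w = L q + v0" by blast
    then have "L' (w - v0) = q" by (simp add: L'L)
    then show "w \<in> ?P" using mem q(1) by simp
  qed
  then show ?thesis using aff unfolding elliptic_paraboloid_def by blast
qed

text \<open>Three integrations over the convex domain, for the Hessian, the gradient and f, give the
  Taylor polynomial of degree two without remainder.\<close>

lemma quadratic_graph_paraboloid:
  fixes f :: "real^2 \<Rightarrow> real"
  assumes N: "open N" "convex N" and f: "smooth_on N f"
    and pos: "\<And>z v. z \<in> N \<Longrightarrow> v \<noteq> 0 \<Longrightarrow> dd (\<lambda>y. dd f y v) z v > 0"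
    and third: "\<And>z u v w. z \<in> N \<Longrightarrow> dd (\<lambda>y. dd (\<lambda>y. dd f y v) y u) z w = 0"
    and z0: "z0 \<in> N"
  shows "\<exists>P. elliptic_paraboloid P \<and> graph_immersion f ` N \<subseteq> P"
proof -
  let ?Q = "\<lambda>u v. dd (\<lambda>y. dd f y v) z0 u"
  have const: "f' x = f' y" if "\<And>x. x \<in> N \<Longrightarrow> (f' has_derivative (\<lambda>_. 0)) (at x)" "x \<in> N" "y \<in> N"
    for f' :: "real^2 \<Rightarrow> real" and x y
    by (rule has_derivative_zero_eq[OF N(2,1) that])
  have Q: "dd (\<lambda>y. dd f y v) y u = ?Q u v" if y: "y \<in> N" for y u v
  proof (rule const[OF _ y z0])
    fix x assume x: "x \<in> N"
    show "((\<lambda>y. dd (\<lambda>y. dd f y v) y u) has_derivative (\<lambda>_. 0)) (at x)"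
      using smooth_on_has_derivative[OF smooth_on_dd[OF smooth_on_dd[OF f]] x, of v u] by (simp add: third[OF x])
  qed
  have Qsym: "?Q u v = ?Q v u" for u v by (rule dd_commute_real[OF N(1) z0 f])
  have Qlin: "linear (\<lambda>u. ?Q u v)" for v by (rule smooth_on_linear_dd[OF smooth_on_dd[OF f] z0])
  have hQ: "((\<lambda>y. ?Q (y - z0) v) has_derivative (\<lambda>w. ?Q w v)) (at x)" for v x
  proof -
    have b: "bounded_linear (\<lambda>u. ?Q u v)" using Qlin[of v] by (simp add: linear_conv_bounded_linear)
    have d: "((\<lambda>y. y - z0) has_derivative (\<lambda>w. w)) (at x)" by (auto intro!: derivative_eq_intros)
    show ?thesis by (rule bounded_linear.has_derivative[OF b d])
  qed
  have D1: "dd f y v = dd f z0 v + ?Q (y - z0) v" if y: "y \<in> N" for y v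
  proof -
    have "dd f y v - ?Q (y - z0) v = dd f z0 v - ?Q (z0 - z0) v"
    proof (rule const[OF _ y z0])
      fix x assume x: "x \<in> N"
      show "((\<lambda>y. dd f y v - ?Q (y - z0) v) has_derivative (\<lambda>_. 0)) (at x)"
        using has_derivative_diff[OF smooth_on_has_derivative[OF smooth_on_dd[OF f] x, of v] hQ[of v x]]
        by (simp add: Q[OF x])
    qed
    then show ?thesis using linear_0[OF Qlin[of v]] by simp
  qed
  define A where "A = ?Q (axis 1 1) (axis 1 1)"
  define B where "B = ?Q (axis 1 1) (axis 2 1)"
  define C where "C = ?Q (axis 2 1) (axis 2 1)"
  define l1 where "l1 = dd f z0 (axis 1 1)"
  define l2 where "l2 = dd f z0 (axis 2 1)"
  have v: "v = v $ 1 *\<^sub>R axis 1 1 + v $ 2 *\<^sub>R axis 2 1" for v :: "real^2"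
    by (simp add: vec_eq_iff forall_2 axis_def)
  have Qc: "?Q u v = A * u $ 1 * v $ 1 + B * (u $ 1 * v $ 2 + u $ 2 * v $ 1) + C * u $ 2 * v $ 2" for u v
  proof -
    have e: "?Q u w = u $ 1 * ?Q (axis 1 1) w + u $ 2 * ?Q (axis 2 1) w" for u w
      using arg_cong[OF v[of u], of "\<lambda>u. ?Q u w"] linear_add[OF Qlin[of w]] linear_cmul[OF Qlin[of w]] by simp
    have "?Q (axis 1 1) v = ?Q v (axis 1 1)" by (rule Qsym)
    also have "\<dots> = v $ 1 * ?Q (axis 1 1) (axis 1 1) + v $ 2 * ?Q (axis 2 1) (axis 1 1)" by (rule e)
    also have "?Q (axis 2 1) (axis 1 1) = B" unfolding B_def by (rule Qsym)
    finally have e1: "?Q (axis 1 1) v = v $ 1 * A + v $ 2 * B" unfolding A_def .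
    have "?Q (axis 2 1) v = ?Q v (axis 2 1)" by (rule Qsym)
    also have "\<dots> = v $ 1 * ?Q (axis 1 1) (axis 2 1) + v $ 2 * ?Q (axis 2 1) (axis 2 1)" by (rule e)
    finally have e2: "?Q (axis 2 1) v = v $ 1 * B + v $ 2 * C" unfolding B_def C_def .
    show ?thesis unfolding e[where u = u and w = v] e1 e2 by (simp add: algebra_simps)
  qed
  have lc: "dd f z0 v = l1 * v $ 1 + l2 * v $ 2" for v
  proof -
    have l: "linear (dd f z0)" using smooth_on_linear_dd[OF f z0] by simp
    show ?thesis using arg_cong[OF v[of v], of "dd f z0"] linear_add[OF l] linear_cmul[OF l]
      by (simp add: l1_def l2_def mult.commute)
  qed
  have A: "A > 0" unfolding A_def by (rule pos[OF z0]) (simp add: axis_eq_0_iff)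
  have AC: "A * C - B\<^sup>2 > 0"
  proof -
    \<comment> \<open>At this vector the Hessian form takes the value A (A C - B^2).\<close>
    let ?v = "vector [- B, A] :: real^2"
    have "?Q ?v ?v > 0" by (rule pos[OF z0]) (use A in \<open>simp add: vec_eq_iff forall_2\<close>)
    then have "A * (A * C - B\<^sup>2) > 0" unfolding Qc by (simp add: power2_eq_square algebra_simps)
    then show ?thesis using A by (simp add: zero_less_mult_iff)
  qed
  have hn: "((\<lambda>y::real^2. y $ i - z0 $ i) has_derivative (\<lambda>w. w $ i)) (at x)" for i x
  proof -
    have "((\<lambda>y::real^2. y $ i) has_derivative (\<lambda>w. w $ i)) (at x)"
      by (intro bounded_linear_imp_has_derivative bounded_linear_vec_nth)
    from has_derivative_diff[OF this has_derivative_const[of "z0 $ i"]] show ?thesis by simp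
  qed
  let ?R = "\<lambda>y::real^2. (l1 * (y $ 1 - z0 $ 1) + l2 * (y $ 2 - z0 $ 2))
     + (1/2) * (A * ((y $ 1 - z0 $ 1) * (y $ 1 - z0 $ 1)) + (2 * B) * ((y $ 1 - z0 $ 1) * (y $ 2 - z0 $ 2))
       + C * ((y $ 2 - z0 $ 2) * (y $ 2 - z0 $ 2)))"
  have fR: "f y = f z0 + ?R y" if y: "y \<in> N" for y
  proof -
    have "f y - ?R y = f z0 - ?R z0"
    proof (rule const[OF _ y z0])
      fix x assume x: "x \<in> N"
      have "((\<lambda>y. f y - ?R y) has_derivative (\<lambda>w. dd f x w - ((l1 * w $ 1 + l2 * w $ 2) + (1/2) *
        (A * ((x $ 1 - z0 $ 1) * w $ 1 + w $ 1 * (x $ 1 - z0 $ 1))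
          + (2 * B) * ((x $ 1 - z0 $ 1) * w $ 2 + w $ 1 * (x $ 2 - z0 $ 2))
          + C * ((x $ 2 - z0 $ 2) * w $ 2 + w $ 2 * (x $ 2 - z0 $ 2)))))) (at x)"
        by (intro has_derivative_diff has_derivative_add has_derivative_mult_right has_derivative_mult hn
            smooth_on_has_derivative[OF f x])
      moreover have "dd f x w - ((l1 * w $ 1 + l2 * w $ 2) + (1/2) *
        (A * ((x $ 1 - z0 $ 1) * w $ 1 + w $ 1 * (x $ 1 - z0 $ 1))
          + (2 * B) * ((x $ 1 - z0 $ 1) * w $ 2 + w $ 1 * (x $ 2 - z0 $ 2))
          + C * ((x $ 2 - z0 $ 2) * w $ 2 + w $ 2 * (x $ 2 - z0 $ 2)))) = 0" for w
        unfolding D1[OF x] lc Qc by (simp add: field_simps)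
      ultimately show "((\<lambda>y. f y - ?R y) has_derivative (\<lambda>_. 0)) (at x)" by simp
    qed
    then show ?thesis by simp
  qed
  have "graph_immersion f ` N \<subseteq> {w. w $ 3 = f z0 + l1 * (w $ 1 - z0 $ 1) + l2 * (w $ 2 - z0 $ 2)
     + (A * (w $ 1 - z0 $ 1)\<^sup>2 + 2 * B * (w $ 1 - z0 $ 1) * (w $ 2 - z0 $ 2) + C * (w $ 2 - z0 $ 2)\<^sup>2) / 2}"
  proof
    fix w assume "w \<in> graph_immersion f ` N"
    then obtain y where y: "y \<in> N" "w = vector [y $ 1, y $ 2, f y]" by (auto simp: graph_immersion_def)
    show "w \<in> {w. w $ 3 = f z0 + l1 * (w $ 1 - z0 $ 1) + l2 * (w $ 2 - z0 $ 2)
     + (A * (w $ 1 - z0 $ 1)\<^sup>2 + 2 * B * (w $ 1 - z0 $ 1) * (w $ 2 - z0 $ 2) + C * (w $ 2 - z0 $ 2)\<^sup>2) / 2}"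
      unfolding y(2) using fR[OF y(1)] by (simp add: power2_eq_square mult.assoc)
  qed
  then show ?thesis using elliptic_paraboloid_quadratic[OF A AC] by blast
qed

text \<open>Once e is rotated to the third axis, L has no third component and can be completed to an
  invertible matrix by the third axis and two further rows. The scale k of the third row is free: r
  = k |e| and |det B| = k |d|, so r^2 = |det B| forces k = |d| / |e|^2.\<close>

lemma normalizing_matrix:
  fixes e L :: "real^4"
  assumes "e \<noteq> 0" "L \<noteq> 0" "L \<bullet> e = 0"
  obtains B r where "r > 0" "r\<^sup>2 = \<bar>det B\<bar>" "\<And>y. (B *v y) $ 4 = L \<bullet> y" "B *v e = r *\<^sub>R axis 3 1"
proof -
  have "norm e = norm (norm e *\<^sub>R axis 3 1 :: real^4)" by simp
  from orthogonal_transformation_exists[OF this]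
  obtain R :: "real^4 \<Rightarrow> real^4" where R: "orthogonal_transformation R" "R e = norm e *\<^sub>R axis 3 1" by blast
  have lR: "linear R" using R(1) by (simp add: orthogonal_transformation_def)
  have Rin: "R x \<bullet> R y = x \<bullet> y" for x y using R(1) by (simp add: orthogonal_transformation_def)
  define l where "l = R L"
  have "l \<bullet> R e = 0" unfolding l_def Rin by (rule assms(3))
  then have l3: "l $ 3 = 0" using assms(1) unfolding R(2) by (simp add: inner_axis)
  have "l \<noteq> 0"
    using Rin[of L L] assms(2) unfolding l_def by auto
  then have l0: "l $ 1 \<noteq> 0 \<or> l $ 2 \<noteq> 0 \<or> l $ 4 \<noteq> 0"
    using l3 by (auto simp: vec_eq_iff forall_4)
  \<comment> \<open>The rows have no third component, so that e is mapped into the third axis; the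
    choice of axes depends on which coordinate of l is nonzero.\<close>
  obtain m1 m2 :: "real^4" where m: "m1 $ 3 = 0" "m2 $ 3 = 0"
    "det (vector [m1, m2, axis 3 1, l] :: real^4^4) \<noteq> 0"
  proof (cases "l $ 4 = 0")
    case False
    show ?thesis
      by (rule that[of "axis 1 1" "axis 2 1"]) (use False in \<open>simp_all add: det_4 vector_def axis_def\<close>)
  next
    case 4: True
    show ?thesis
    proof (cases "l $ 1 = 0")
      case False
      show ?thesis
        by (rule that[of "axis 2 1" "axis 4 1"]) (use False 4 in \<open>simp_all add: det_4 vector_def axis_def\<close>)
    next
      case True
      then have "l $ 2 \<noteq> 0" using l0 4 by simp
      then show ?thesis
        by (intro that[of "axis 1 1" "axis 4 1"]) (use True 4 in \<open>simp_all add: det_4 vector_def axis_def\<close>)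
    qed
  qed
  let ?d = "det (vector [m1, m2, axis 3 1, l] :: real^4^4)"
  define k where "k = \<bar>?d\<bar> / (norm e)\<^sup>2"
  have k: "k > 0" using m(3) assms(1) by (simp add: k_def)
  define M :: "real^4^4" where "M = vector [m1, m2, k *\<^sub>R axis 3 1, l]"
  define B where "B = M ** matrix R"
  have By: "B *v y = M *v R y" for y
    unfolding B_def by (simp add: matrix_works lR flip: matrix_vector_mul_assoc)
  have detM: "det M = k * ?d"
    unfolding det_4 M_def by (simp add: vector_def axis_def algebra_simps)
  have "\<bar>det (matrix R)\<bar> = 1"
    using det_orthogonal_matrix[of "matrix R"] R(1) by (auto simp: orthogonal_transformation_matrix)
  then have detB: "\<bar>det B\<bar> = k * \<bar>?d\<bar>"
    unfolding B_def det_mul abs_mult detM using k by simp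
  show thesis
  proof (rule that[of "k * norm e" B])
    show "k * norm e > 0" using k assms(1) by simp
    show "(k * norm e)\<^sup>2 = \<bar>det B\<bar>"
      unfolding detB using assms(1) by (simp add: k_def power2_eq_square)
    show "(B *v y) $ 4 = L \<bullet> y" for y
    proof -
      have "(B *v y) $ 4 = l \<bullet> R y"
        unfolding By by (simp add: M_def matrix_vector_mult_def inner_vec_def vector_def)
      then show ?thesis unfolding l_def Rin .
    qed
    show "B *v e = (k * norm e) *\<^sub>R axis 3 1"
      unfolding By R(2)
      by (simp add: vec_eq_iff forall_4 M_def matrix_vector_mult_def vector_def sum_4 axis_def m l3)
  qed
qed

text \<open>Affine equivalence is expressed by one affine map for all of M and a product
  parametrization around every point: e, L and the centre are global, whereas I, N, f and \<gamma>2
  come from inverting \<Psi> near p.\<close>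

theorem theorem4:
  fixes M :: "'p::{t2_space, second_countable_topology} set"
    and A :: "((real^3) set \<times> (real^3 \<Rightarrow> 'p)) set"
    and \<phi> \<xi> :: "'p \<Rightarrow> real^4"
    and H :: real
  assumes "oriented_atlas M A" and "connected M"
    and "affine_sphere A \<phi> \<xi> H" and "H \<noteq> 0"
    and "lorentzian_hypersurface A \<phi> \<xi>"
    and "pointwise_Z3_symmetry A \<phi> \<xi> \<or> pointwise_SO2_symmetry A \<phi> \<xi>"
    and "\<forall>(D, c)\<in>A. \<forall>x\<in>D.
           H = (coeff_a22 (\<phi> \<circ> c) (\<xi> \<circ> c) x)\<^sup>2 - (coeff_a4 (\<phi> \<circ> c) (\<xi> \<circ> c) x)\<^sup>2"
  shows "\<exists>B. affine_transformation B \<and>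
    (\<forall>p\<in>M. \<exists>(I :: real set) (N :: (real^2) set) (\<Theta> :: real \<times> (real^2) \<Rightarrow> 'p)
        (\<gamma>\<^sub>1 :: real \<Rightarrow> real) (\<gamma>\<^sub>2 :: real \<Rightarrow> real) (f :: real^2 \<Rightarrow> real).
      open I \<and> is_interval I \<and> open N \<and> connected N \<and>
      smooth_on I \<gamma>\<^sub>1 \<and> smooth_on I \<gamma>\<^sub>2 \<and>
      affine_sphere_on N (graph_immersion f) (\<lambda>_. vector [0, 0, 1]) 0 \<and>
      (\<forall>z\<in>N. positive_definite (affine_metric (graph_immersion f) (\<lambda>_. vector [0, 0, 1]) z)) \<and>
      smooth_parametrization M A (I \<times> N) \<Theta> \<and> p \<in> \<Theta> ` (I \<times> N) \<and>
      (\<forall>t\<in>I. \<forall>z\<in>N. B (\<phi> (\<Theta> (t, z)))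
         = vector [\<gamma>\<^sub>1 t * z $ 1, \<gamma>\<^sub>1 t * z $ 2, \<gamma>\<^sub>1 t * f z + \<gamma>\<^sub>2 t, \<gamma>\<^sub>1 t]) \<and>
      (pointwise_SO2_symmetry A \<phi> \<xi> \<longrightarrow>
         (\<exists>P. elliptic_paraboloid P \<and> graph_immersion f ` N \<subseteq> P)))"
proof (cases "M = {}")
  case True
  have "affine_transformation (\<lambda>x::real^4. x)"
    unfolding affine_transformation_def
    by (rule exI[of _ "\<lambda>x. x"], rule exI[of _ 0]) (simp add: linear_iff bij_id[unfolded id_def])
  then show ?thesis using True by blast
next
  case False
  note at = assms(1)
  have oD: "open D" if "(D, c) \<in> A" for D c
    using at that unfolding oriented_atlas_def smooth_parametrization_def topological_parametrization_def by blast
  have ason: "affine_sphere_on D (\<phi> \<circ> c) (\<xi> \<circ> c) H" if "(D, c) \<in> A" for D c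
    using assms(3) that unfolding affine_sphere_def by blast
  have "\<exists>h \<Gamma> G. symmetric_sphere D (\<phi> \<circ> c) (\<xi> \<circ> c) h \<Gamma> G H" if Dc: "(D, c) \<in> A" for D c
  proof -
    obtain h \<Gamma> G where g: "gauss_structure D (\<phi> \<circ> c) (\<xi> \<circ> c) h \<Gamma> G H"
      "\<And>u v. smooth_on D (\<lambda>x. \<Gamma> x u v)" "\<And>u v. smooth_on D (\<lambda>x. G x u v)"
      using affine_sphere_on_gauss_structure[OF ason[OF Dc] oD[OF Dc]] by blast
    have "symmetric_sphere_axioms D (\<phi> \<circ> c) (\<xi> \<circ> c) \<Gamma> G H"
    proof
      show "(\<forall>x\<in>D. \<exists>T V W a4 a6. a4 > 0 \<and> a6 > 0 \<and>
          canonical_frame (affine_metric (\<phi> \<circ> c) (\<xi> \<circ> c) x) (difference_tensor (\<phi> \<circ> c) (\<xi> \<circ> c) x) a4 a6 T V W)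
        \<or> (\<forall>x\<in>D. \<exists>T V W a4 a6. a4 > 0 \<and> a6 = 0 \<and>
          canonical_frame (affine_metric (\<phi> \<circ> c) (\<xi> \<circ> c) x) (difference_tensor (\<phi> \<circ> c) (\<xi> \<circ> c) x) a4 a6 T V W)"
        using assms(6)
      proof
        assume "pointwise_Z3_symmetry A \<phi> \<xi>"
        then show ?thesis using Dc unfolding pointwise_Z3_symmetry_def by (intro disjI1) blast
      next
        assume "pointwise_SO2_symmetry A \<phi> \<xi>"
        then show ?thesis using Dc unfolding pointwise_SO2_symmetry_def by (intro disjI2) blast
      qed
      show "H = (coeff_a22 (\<phi> \<circ> c) (\<xi> \<circ> c) x)\<^sup>2 - (coeff_a4 (\<phi> \<circ> c) (\<xi> \<circ> c) x)\<^sup>2" if "x \<in> D" for x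
        using assms(7) Dc that by blast
    qed (rule g assms(4))+
    then show ?thesis using g(1) unfolding symmetric_sphere_def by blast
  qed
  then have "\<forall>Dc\<in>A. \<exists>hGG. symmetric_sphere (fst Dc) (\<phi> \<circ> snd Dc) (\<xi> \<circ> snd Dc) (fst hGG) (fst (snd hGG)) (snd (snd hGG)) H"
    by fastforce
  then obtain hGG where hGG: "\<And>Dc. Dc \<in> A \<Longrightarrow>
      symmetric_sphere (fst Dc) (\<phi> \<circ> snd Dc) (\<xi> \<circ> snd Dc) (fst (hGG Dc)) (fst (snd (hGG Dc))) (snd (snd (hGG Dc))) H"
    by metis
  define h where "h Dc = fst (hGG Dc)" for Dc
  define \<Gamma> where "\<Gamma> Dc = fst (snd (hGG Dc))" for Dc
  define G where "G Dc = snd (snd (hGG Dc))" for Dc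
  have s: "symmetric_sphere D (\<phi> \<circ> c) (\<xi> \<circ> c) (h (D, c)) (\<Gamma> (D, c)) (G (D, c)) H" if "(D, c) \<in> A" for D c
    using hGG[OF that] by (simp add: h_def \<Gamma>_def G_def)
  obtain e L k where
    e: "\<And>D c x. (D, c) \<in> A \<Longrightarrow> x \<in> D \<Longrightarrow> symmetric_sphere.ev (\<phi> \<circ> c) (\<xi> \<circ> c) x = e"
    and L: "\<And>D c x. (D, c) \<in> A \<Longrightarrow> x \<in> D \<Longrightarrow> symmetric_sphere.Lv D (\<phi> \<circ> c) (\<xi> \<circ> c) (h (D, c)) x = L"
    and k: "\<And>D c x. (D, c) \<in> A \<Longrightarrow> x \<in> D \<Longrightarrow> \<xi> (c x) + H *\<^sub>R \<phi> (c x) = k"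
    using global_constants[OF at assms(2) s] by blast
  have point: "\<exists>D c x. (D, c) \<in> A \<and> x \<in> D \<and> p = c x" if "p \<in> M" for p
    using that at unfolding oriented_atlas_def by auto
  obtain D1 c1 x1 where 1: "(D1, c1) \<in> A" "x1 \<in> D1" using point False by blast
  interpret S1: symmetric_sphere D1 "\<phi> \<circ> c1" "\<xi> \<circ> c1" "h (D1, c1)" "\<Gamma> (D1, c1)" "G (D1, c1)" H by (rule s[OF 1(1)])
  \<comment> \<open>The coefficient of \<open>eta\<close> along the transversal \<xi> is 1; this is
    what makes e nonzero.\<close>
  have "S1.eta x1 \<noteq> 0"
  proof
    assume "S1.eta x1 = 0"
    then have "dd (\<phi> \<circ> c1) x1 ((S1.a x1 - S1.b x1) *\<^sub>R S1.T x1) + 1 *\<^sub>R (\<xi> \<circ> c1) x1 = dd (\<phi> \<circ> c1) x1 0 + 0 *\<^sub>R (\<xi> \<circ> c1) x1"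
      by (simp add: S1.eta_def S1.t_def linear_cmul[OF S1.linear_sigma[OF 1(2)]] linear_0[OF S1.linear_sigma[OF 1(2)]] add.commute)
    from S1.tangent_transversal_unique[OF 1(2) this] show False by simp
  qed
  then have e0: "e \<noteq> 0" using e[OF 1] by (auto simp: S1.ev_def)
  have L0: "L \<noteq> 0" using S1.Lv_xi[OF 1(2)] L[OF 1] assms(4) by auto
  have Le: "L \<bullet> e = 0" using S1.Lv_ev[OF 1(2)] L[OF 1] e[OF 1] by simp
  obtain B r where B: "r > 0" "r\<^sup>2 = \<bar>det B\<bar>" "\<And>y. (B *v y) $ 4 = L \<bullet> y" "B *v e = r *\<^sub>R axis 3 1"
    by (rule normalizing_matrix[OF e0 L0 Le]) blast
  \<comment> \<open>The translation moves the centre k / H of the sphere to the origin.\<close>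
  define Bf where "Bf y = B *v y + B *v (- (1 / H) *\<^sub>R k)" for y
  have "bij ((*v) B)"
  proof -
    have "inj ((*v) B)"
      using det_nz_iff_inj[OF matrix_vector_mul_linear[of B]] B(1,2) by auto
    then show ?thesis
      using linear_injective_imp_surjective[of "(*v) B"] by (simp add: bij_def)
  qed
  then have aff: "affine_transformation Bf"
    unfolding affine_transformation_def Bf_def[abs_def] using matrix_vector_mul_linear[of B] by blast
  show ?thesis
  proof (rule exI[of _ Bf], intro conjI aff ballI)
    fix p assume "p \<in> M"
    then obtain D c x0 where Dc: "(D, c) \<in> A" and x0: "x0 \<in> D" "p = c x0" using point by blast
    interpret normalized_sphere D "\<phi> \<circ> c" "\<xi> \<circ> c" "h (D, c)" "\<Gamma> (D, c)" "G (D, c)" H e L B r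
      by (intro normalized_sphere.intro normalized_sphere_axioms.intro s[OF Dc] e[OF Dc] L[OF Dc] B)
    obtain I :: "real set" and N :: "(real^2) set" and \<Theta> :: "real \<times> (real^2) \<Rightarrow> real^3" and \<omega> \<gamma> f t0 where
      I: "open I" "is_interval I" and N: "open N" "convex N" and t0: "t0 \<in> I"
      and \<Theta>: "smooth_on (I \<times> N) \<Theta>" "\<Theta> ` (I \<times> N) \<subseteq> D" "x0 \<in> \<Theta> ` (I \<times> N)" "open (\<Theta> ` (I \<times> N))"
      and \<omega>: "smooth_on (\<Theta> ` (I \<times> N)) \<omega>" "\<And>y. y \<in> I \<times> N \<Longrightarrow> \<omega> (\<Theta> y) = y"
      and \<gamma>: "smooth_on I \<gamma>" and \<kappa>: "smooth_on N (\<lambda>z. \<Theta> (t0, z))"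
      and \<Psi>\<kappa>: "\<forall>z\<in>N. \<Psi> (\<Theta> (t0, z)) = vector [t0, z $ 1, z $ 2]"
      and f: "f = (\<lambda>z. s (\<Theta> (t0, z)) $ 3 / s (\<Theta> (t0, z)) $ 4)"
      and form: "\<And>t z. t \<in> I \<Longrightarrow> z \<in> N \<Longrightarrow> s (\<Theta> (t, z)) = vector [t * z $ 1, t * z $ 2, t * f z + \<gamma> t, t]"
      by (rule local_parametrization[OF x0(1)]) blast
    have \<kappa>D: "(\<lambda>z. \<Theta> (t0, z)) ` N \<subseteq> D" using \<Theta>(2) t0 by auto
    note lf = N(1) \<kappa> \<kappa>D \<Psi>\<kappa> f
    have fs: "smooth_on N f"
    \<comment> \<open>The leaf lemma is stated at a given point of N; such a point exists because
      \<open>x0\<close> lies in the image of the chart.\<close>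
    proof (cases "N = {}")
      case True
      then show ?thesis using \<Theta>(3) by simp
    next
      case False
      then show ?thesis using leaf(6)[OF lf] by blast
    qed
    have pos: "dd (\<lambda>y. dd f y v) z v > 0" if "z \<in> N" "v \<noteq> 0" for z v
      by (rule leaf_hessian_pos[OF lf that])
    have det: "\<bar>det (gram_matrix (\<lambda>u v. dd (\<lambda>y. dd f y v) z u))\<bar> = 1" if z: "z \<in> N" for z
    proof -
      have x: "\<Theta> (t0, z) \<in> D" using \<kappa>D z by blast
      then obtain \<beta> where \<beta>: "bij \<beta>" "\<bar>det (frame_matrix \<beta> (\<phi> \<circ> c) (\<xi> \<circ> c) (\<Theta> (t0, z)))\<bar> =
          sqrt \<bar>det (gram_matrix (affine_metric (\<phi> \<circ> c) (\<xi> \<circ> c) (\<Theta> (t0, z))))\<bar>"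
        using ason[OF Dc] unfolding affine_sphere_on_def blaschke_immersion_def by blast
      show ?thesis by (rule leaf_hessian_det[OF lf z \<beta>(1) \<beta>(2)[unfolded affine_metric_eq[OF x]]])
    qed
    have par: "smooth_parametrization M A (I \<times> N) (\<lambda>y. c (\<Theta> y))"
      by (rule smooth_parametrization_compose[OF at Dc open_Times[OF I(1) N(1)] \<Theta>(1,2,4) \<omega>])
    have form': "Bf (\<phi> (c (\<Theta> (t, z)))) = vector [t * z $ 1, t * z $ 2, t * f z + \<gamma> t, t]"
      if "t \<in> I" "z \<in> N" for t z
    proof -
      have x: "\<Theta> (t, z) \<in> D" using \<Theta>(2) that by auto
      have "Bf (\<phi> (c (\<Theta> (t, z)))) = B *v (\<phi> (c (\<Theta> (t, z))) - (1 / H) *\<^sub>R k)"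
        by (simp add: Bf_def flip: matrix_vector_right_distrib)
      also have "\<phi> (c (\<Theta> (t, z))) - (1 / H) *\<^sub>R k = (- 1 / H) *\<^sub>R \<xi> (c (\<Theta> (t, z)))"
        using assms(4) by (simp flip: k[OF Dc x] add: scaleR_add_right)
      also have "B *v \<dots> = s (\<Theta> (t, z))" unfolding s_def matrix_vector_mult_scaleR by simp
      finally show ?thesis unfolding form[OF that] .
    qed
    have SO2: "\<exists>P. elliptic_paraboloid P \<and> graph_immersion f ` N \<subseteq> P" if "pointwise_SO2_symmetry A \<phi> \<xi>"
    proof -
      obtain z0 where z0: "z0 \<in> N" using \<Theta>(3) by auto
      have third: "dd (\<lambda>y. dd (\<lambda>y. dd f y v) y u) z w = 0" if z: "z \<in> N" for z u v w
      proof -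
        have x: "\<Theta> (t0, z) \<in> D" using \<kappa>D z by blast
        obtain t' V W a4 where c: "a4 > 0" "canonical_frame (h (D, c) (\<Theta> (t0, z))) (K (\<Theta> (t0, z))) a4 0 t' V W"
          using \<open>pointwise_SO2_symmetry A \<phi> \<xi>\<close> Dc x
          unfolding pointwise_SO2_symmetry_def by (fastforce simp: affine_metric_eq[OF x] K_eq[OF x])
        show ?thesis by (rule leaf_third_derivative[OF lf z c(2,1)])
      qed
      show ?thesis by (rule quadratic_graph_paraboloid[OF N fs pos third z0])
    qed
    show "\<exists>(I :: real set) (N :: (real^2) set) (\<Theta> :: real \<times> (real^2) \<Rightarrow> 'p)
        (\<gamma>\<^sub>1 :: real \<Rightarrow> real) (\<gamma>\<^sub>2 :: real \<Rightarrow> real) (f :: real^2 \<Rightarrow> real).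
      open I \<and> is_interval I \<and> open N \<and> connected N \<and>
      smooth_on I \<gamma>\<^sub>1 \<and> smooth_on I \<gamma>\<^sub>2 \<and>
      affine_sphere_on N (graph_immersion f) (\<lambda>_. vector [0, 0, 1]) 0 \<and>
      (\<forall>z\<in>N. positive_definite (affine_metric (graph_immersion f) (\<lambda>_. vector [0, 0, 1]) z)) \<and>
      smooth_parametrization M A (I \<times> N) \<Theta> \<and> p \<in> \<Theta> ` (I \<times> N) \<and>
      (\<forall>t\<in>I. \<forall>z\<in>N. Bf (\<phi> (\<Theta> (t, z)))
         = vector [\<gamma>\<^sub>1 t * z $ 1, \<gamma>\<^sub>1 t * z $ 2, \<gamma>\<^sub>1 t * f z + \<gamma>\<^sub>2 t, \<gamma>\<^sub>1 t]) \<and>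
      (pointwise_SO2_symmetry A \<phi> \<xi> \<longrightarrow>
         (\<exists>P. elliptic_paraboloid P \<and> graph_immersion f ` N \<subseteq> P))"
    \<comment> \<open>The parameter is the fourth coordinate itself, so the first component of the
      curve is the identity.\<close>
    proof (rule exI[of _ I], rule exI[of _ N], rule exI[of _ "\<lambda>y. c (\<Theta> y)"], rule exI[of _ "\<lambda>t. t"],
        rule exI[of _ \<gamma>], rule exI[of _ f], intro conjI ballI impI)
      show "smooth_on I (\<lambda>t. t)" by (rule smooth_on_ident[OF I(1)])
      show "connected N" by (rule convex_connected[OF N(2)])
      show "affine_sphere_on N (graph_immersion f) (\<lambda>_. vector [0, 0, 1]) 0"
        by (rule improper_affine_sphere_graph(1)[OF N(1) fs pos det])
      show "positive_definite (affine_metric (graph_immersion f) (\<lambda>_. vector [0, 0, 1]) z)" if "z \<in> N" for z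
        by (rule improper_affine_sphere_graph(2)[OF N(1) fs pos det that])
      show "p \<in> (\<lambda>y. c (\<Theta> y)) ` (I \<times> N)" using \<Theta>(3) x0(2) by blast
    qed (fact I N \<gamma> par form' SO2)+
  qed
qed

end
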